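(* Let $(M,\circ,g,e)$ be a (pseudo-)Riemannian F-manifold with Killing unit vector field, and let $\theta$ be its counit. 1. There is a unique torsionless connection $\nabla$ on $M$ satisfying $$(\nabla_X g)(Y,Z)=\tfrac12 d\theta(X\circ Y,Z)+\tfrac12 d\theta(X\circ Z,Y)$$ for all vector fields $X,Y,Z$. This connection is given by $$\nabla_X Y=\widetilde\nabla_X Y-\tfrac12\left(\iota_{X\circ Y}d\theta\right)^\sharp$$ for all vector fields $X,Y$, where $\widetilde\nabla$ is the Levi-Civita connection of $g$, $\iota_X$ is the contraction with $X$, and $\sharp$ is the isomorphism from one-forms to vector fields induced by $g^{-1}$. 2. The tuple $(M,\circ,\nabla,e)$ is a flat F-manifold.
   Context: $M$ is a smooth manifold; "vector field" means smooth local vector field; metrics are pseudo-Riemannian (nondegenerate, symmetric). $d\theta(X,Y)=X(\theta(Y))-Y(\theta(X))-\theta([X,Y])$ and $\iota_X d\theta=d\theta(X,\cdot)$. The Riemann tensor of a connection $\nabla$ is $R(X,Y)Z=\nabla_X\nabla_YZ-\nabla_Y\nabla_XZ-\nabla_{[X,Y]}Z$. F-manifold: a triple $(M,\circ,e)$ where $\circ$ is a commutative associative $C^\infty$-bilinear product on vector fields such that $\mathcal L_{X\circ Y}(\circ)=X\circ\mathcal L_Y(\circ)+Y\circ\mathcal L_X(\circ)$ for all vector fields $X,Y$ ($\circ$ being viewed as a $(1,2)$ tensor, $\mathcal L$ the Lie derivative), and $e$ is a vector field with $e\circ X=X$ for all $X$. (Pseudo-)Riemannian F-manifold with Killing unit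 vector field: an F-manifold $(M,\circ,e)$ with a (pseudo-)Riemannian metric $g$ such that (i) $g$ is invariant: $g(X\circ Y,Z)=g(X,Y\circ Z)$; (ii) the Riemann tensor $R$ of (the Levi-Civita connection of) $g$ satisfies $R(Y,Z)(X\circ W)+R(X,Y)(Z\circ W)+R(Z,X)(Y\circ W)=0$ for all vector fields $X,Y,Z,W$; (iii) $\mathcal L_e g=0$. The counit is the one-form $\theta(X)=g(e,X)$. Flat F-manifold: a tuple $(M,\circ,\nabla,e)$ where $\circ$ is a commutative associative $C^\infty$-bilinear product on vector fields with unit vector field $e$, and $\nabla$ is a torsionless flat connection with $\nabla e=0$ that is compatible with the product, i.e. writing $c(X,Y)=X\circ Y$, the expression $(\nabla_X c)(Y,Z)$ is symmetric in $X,Y,Z$. *)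

theory Defs
  imports "HOL-Analysis.Analysis" "HOL-Library.Function_Algebras"
begin

section \<open>Smooth manifolds\<close>

text \<open>\<open>Ck_on k S f\<close> says that \<open>f\<close> is \<open>k\<close> times continuously differentiable on the \<^emph>\<open>open\<close> set \<open>S\<close>:
  the iterated directional derivatives up to order \<open>k\<close> exist in the Frechet sense and are continuous.\<close>

primrec Ck_on ::
  "nat \<Rightarrow> 'a::real_normed_vector set \<Rightarrow> ('a \<Rightarrow> 'b::real_normed_vector) \<Rightarrow> bool" where
  "Ck_on 0 S f \<longleftrightarrow> continuous_on S f"
| "Ck_on (Suc k) S f \<longleftrightarrow>
     (\<forall>x\<in>S. f differentiable (at x)) \<and>
     (\<forall>v. Ck_on k S (\<lambda>x. frechet_derivative f (at x) v))"

definition smooth_on ::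
  "'a::real_normed_vector set \<Rightarrow> ('a \<Rightarrow> 'b::real_normed_vector) \<Rightarrow> bool" where
  "smooth_on S f \<longleftrightarrow> (\<forall>k. Ck_on k S f)"

text \<open>A chart is a domain together with a coordinate map into the model space. Values of the
  coordinate map outside of the domain are irrelevant.\<close>

type_synonym ('m, 'e) chart = "'m set \<times> ('m \<Rightarrow> 'e)"

definition is_chart :: "('m::topological_space, 'e::euclidean_space) chart \<Rightarrow> bool" where
  "is_chart = (\<lambda>(D, \<phi>). open D \<and> open (\<phi> ` D) \<and> homeomorphism D (\<phi> ` D) \<phi> (inv_into D \<phi>))"

text \<open>A manifold is given by a smooth atlas. Its points are the points covered by the charts; they form
  an open subset of a Hausdorff and second countable space.\<close>

definition smooth_manifold ::
  "('m::{t2_space, second_countable_topology}, 'e::euclidean_space) chart set \<Rightarrow> bool" where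
  "smooth_manifold M \<longleftrightarrow>
     (\<forall>K\<in>M. is_chart K) \<and>
     (\<forall>(D, \<phi>)\<in>M. \<forall>(D', \<phi>')\<in>M. smooth_on (\<phi> ` (D \<inter> D')) (\<phi>' \<circ> inv_into D \<phi>))"

definition carrier :: "('m, 'e) chart set \<Rightarrow> 'm set" where
  "carrier M = \<Union> (fst ` M)"

definition opens :: "('m::topological_space, 'e) chart set \<Rightarrow> 'm set set" where
  "opens M = {U. open U \<and> U \<subseteq> carrier M}"

text \<open>The functions that are smooth on \<open>U\<close>; nothing is required of their values outside of \<open>U\<close>.\<close>

definition smooth_functions ::
  "('m, 'e::euclidean_space) chart set \<Rightarrow> 'm set \<Rightarrow> ('m \<Rightarrow> real) set" where
  "smooth_functions M U = {f. \<forall>(D, \<phi>)\<in>M. smooth_on (\<phi> ` (D \<inter> U)) (f \<circ> inv_into D \<phi>)}"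

definition smooth_near ::
  "('m::topological_space, 'e::euclidean_space) chart set \<Rightarrow> 'm \<Rightarrow> ('m \<Rightarrow> real) set" where
  "smooth_near M p = {f. \<exists>U\<in>opens M. p \<in> U \<and> f \<in> smooth_functions M U}"


section \<open>Vector fields\<close>

text \<open>Tangent vectors at \<open>p\<close> are the derivations of the algebra of germs of smooth functions at \<open>p\<close>.
  They are extended by zero to functions which are not smooth near \<open>p\<close>, so that two tangent vectors are
  equal as functions iff they are equal as derivations.\<close>

type_synonym 'm tangent_vector = "('m \<Rightarrow> real) \<Rightarrow> real"

definition tangent_space ::
  "('m::topological_space, 'e::euclidean_space) chart set \<Rightarrow> 'm \<Rightarrow> 'm tangent_vector set" where
  "tangent_space M p = {v.
     (\<forall>f\<in>smooth_near M p. \<forall>h\<in>smooth_near M p. v (f + h) = v f + v h) \<and>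
     (\<forall>f\<in>smooth_near M p. \<forall>a. v (\<lambda>q. a * f q) = a * v f) \<and>
     (\<forall>f\<in>smooth_near M p. \<forall>h\<in>smooth_near M p. v (f * h) = f p * v h + h p * v f) \<and>
     (\<forall>f\<in>smooth_near M p. \<forall>h. (\<forall>\<^sub>F q in nhds p. f q = h q) \<longrightarrow> v f = v h) \<and>
     (\<forall>f. f \<notin> smooth_near M p \<longrightarrow> v f = 0)}"

text \<open>A local vector field on the open set \<open>U\<close> is a smooth section of the tangent bundle over \<open>U\<close>,
  extended by zero. Since the domain cannot be recovered from the section, operations on local vector
  fields which are not given pointwise take the domain as an additional argument.\<close>

type_synonym 'm vector_field = "'m \<Rightarrow> 'm tangent_vector"

definition vector_fields ::
  "('m::topological_space, 'e::euclidean_space) chart set \<Rightarrow> 'm set \<Rightarrow> 'm vector_field set" where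
  "vector_fields M U = {X.
     (\<forall>p\<in>U. X p \<in> tangent_space M p) \<and>
     (\<forall>p. p \<notin> U \<longrightarrow> X p = 0) \<and>
     (\<forall>V\<in>opens M. V \<subseteq> U \<longrightarrow>
        (\<forall>f\<in>smooth_functions M V. (\<lambda>p. X p f) \<in> smooth_functions M V))}"

definition restrict_vf :: "'m set \<Rightarrow> 'm vector_field \<Rightarrow> 'm vector_field" where
  "restrict_vf U X = (\<lambda>p. if p \<in> U then X p else 0)"

definition scale_vf :: "('m \<Rightarrow> real) \<Rightarrow> 'm vector_field \<Rightarrow> 'm vector_field" where
  "scale_vf h X = (\<lambda>p f. h p * X p f)"

definition lie_bracket ::
  "('m::topological_space, 'e::euclidean_space) chart set \<Rightarrow>
    'm vector_field \<Rightarrow> 'm vector_field \<Rightarrow> 'm vector_field" where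
  "lie_bracket M X Y =
     (\<lambda>p f. if f \<in> smooth_near M p then X p (\<lambda>q. Y q f) - Y p (\<lambda>q. X q f) else 0)"


section \<open>Differential forms and metrics\<close>

text \<open>A one-form is represented by its action on local vector fields. Only its values on the domain
  of its argument are meaningful, and likewise for the exterior derivative, which is evaluated on two local
  vector fields at points where both are defined.\<close>

type_synonym 'm one_form = "'m vector_field \<Rightarrow> 'm \<Rightarrow> real"

definition ext_deriv ::
  "('m::topological_space, 'e::euclidean_space) chart set \<Rightarrow> 'm one_form \<Rightarrow>
    'm vector_field \<Rightarrow> 'm vector_field \<Rightarrow> 'm \<Rightarrow> real" where
  "ext_deriv M \<theta> X Y = (\<lambda>p. X p (\<theta> Y) - Y p (\<theta> X) - \<theta> (lie_bracket M X Y) p)"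

definition contraction ::
  "'m vector_field \<Rightarrow> ('m vector_field \<Rightarrow> 'm vector_field \<Rightarrow> 'm \<Rightarrow> real) \<Rightarrow> 'm one_form" where
  "contraction X \<omega> = \<omega> X"

type_synonym 'm metric = "'m \<Rightarrow> 'm tangent_vector \<Rightarrow> 'm tangent_vector \<Rightarrow> real"

definition metric_vf :: "'m metric \<Rightarrow> 'm vector_field \<Rightarrow> 'm vector_field \<Rightarrow> 'm \<Rightarrow> real" where
  "metric_vf g X Y = (\<lambda>p. g p (X p) (Y p))"

definition pseudo_riemannian_metric ::
  "('m::topological_space, 'e::euclidean_space) chart set \<Rightarrow> 'm metric \<Rightarrow> bool" where
  "pseudo_riemannian_metric M g \<longleftrightarrow>
     (\<forall>p\<in>carrier M. \<forall>u\<in>tangent_space M p. \<forall>v\<in>tangent_space M p.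
        (\<forall>w\<in>tangent_space M p. g p (u + v) w = g p u w + g p v w) \<and>
        (\<forall>a. g p (\<lambda>f. a * u f) v = a * g p u v) \<and>
        g p u v = g p v u) \<and>
     (\<forall>p\<in>carrier M. \<forall>u\<in>tangent_space M p. (\<forall>v\<in>tangent_space M p. g p u v = 0) \<longrightarrow> u = 0) \<and>
     (\<forall>U\<in>opens M. \<forall>X\<in>vector_fields M U. \<forall>Y\<in>vector_fields M U.
        metric_vf g X Y \<in> smooth_functions M U)"

definition sharp ::
  "('m::topological_space, 'e::euclidean_space) chart set \<Rightarrow> 'm metric \<Rightarrow> 'm set \<Rightarrow>
    'm one_form \<Rightarrow> 'm vector_field" where
  "sharp M g U \<alpha> = (THE W. W \<in> vector_fields M U \<and>
     (\<forall>V\<in>opens M. V \<subseteq> U \<longrightarrow>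
        (\<forall>Z\<in>vector_fields M V. \<forall>p\<in>V. metric_vf g W Z p = \<alpha> Z p)))"

definition lie_deriv_metric ::
  "('m::topological_space, 'e::euclidean_space) chart set \<Rightarrow> 'm metric \<Rightarrow>
    'm vector_field \<Rightarrow> 'm vector_field \<Rightarrow> 'm vector_field \<Rightarrow> 'm \<Rightarrow> real" where
  "lie_deriv_metric M g X Y Z = (\<lambda>p. X p (metric_vf g Y Z)
     - metric_vf g (lie_bracket M X Y) Z p - metric_vf g Y (lie_bracket M X Z) p)"


section \<open>Connections\<close>

type_synonym 'm vf_operation = "'m set \<Rightarrow> 'm vector_field \<Rightarrow> 'm vector_field \<Rightarrow> 'm vector_field"

definition local_operation ::
  "('m::topological_space, 'e::euclidean_space) chart set \<Rightarrow> 'm vf_operation \<Rightarrow> bool" where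
  "local_operation M F \<longleftrightarrow>
     (\<forall>U\<in>opens M. \<forall>X\<in>vector_fields M U. \<forall>Y\<in>vector_fields M U.
        F U X Y \<in> vector_fields M U \<and>
        (\<forall>V\<in>opens M. V \<subseteq> U \<longrightarrow>
           F V (restrict_vf V X) (restrict_vf V Y) = restrict_vf V (F U X Y)))"

text \<open>The last clause fixes the irrelevant values of a connection, so that two connections are equal
  as HOL functions iff they agree on all local vector fields.\<close>

definition connection ::
  "('m::topological_space, 'e::euclidean_space) chart set \<Rightarrow> 'm vf_operation \<Rightarrow> bool" where
  "connection M nabla \<longleftrightarrow>
     local_operation M nabla \<and>
     (\<forall>U\<in>opens M. \<forall>X\<in>vector_fields M U. \<forall>Y\<in>vector_fields M U. \<forall>Z\<in>vector_fields M U.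
        nabla U (X + Y) Z = nabla U X Z + nabla U Y Z \<and>
        nabla U X (Y + Z) = nabla U X Y + nabla U X Z) \<and>
     (\<forall>U\<in>opens M. \<forall>h\<in>smooth_functions M U. \<forall>X\<in>vector_fields M U. \<forall>Y\<in>vector_fields M U.
        nabla U (scale_vf h X) Y = scale_vf h (nabla U X Y) \<and>
        nabla U X (scale_vf h Y) = scale_vf (\<lambda>p. X p h) Y + scale_vf h (nabla U X Y)) \<and>
     (\<forall>U X Y. \<not> (U \<in> opens M \<and> X \<in> vector_fields M U \<and> Y \<in> vector_fields M U) \<longrightarrow> nabla U X Y = 0)"

definition torsionless ::
  "('m::topological_space, 'e::euclidean_space) chart set \<Rightarrow> 'm vf_operation \<Rightarrow> bool" where
  "torsionless M nabla \<longleftrightarrow>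
     (\<forall>U\<in>opens M. \<forall>X\<in>vector_fields M U. \<forall>Y\<in>vector_fields M U.
        nabla U X Y - nabla U Y X = lie_bracket M X Y)"

definition riemann ::
  "('m::topological_space, 'e::euclidean_space) chart set \<Rightarrow> 'm vf_operation \<Rightarrow> 'm set \<Rightarrow>
    'm vector_field \<Rightarrow> 'm vector_field \<Rightarrow> 'm vector_field \<Rightarrow> 'm vector_field" where
  "riemann M nabla U X Y Z =
     nabla U X (nabla U Y Z) - nabla U Y (nabla U X Z) - nabla U (lie_bracket M X Y) Z"

definition flat ::
  "('m::topological_space, 'e::euclidean_space) chart set \<Rightarrow> 'm vf_operation \<Rightarrow> bool" where
  "flat M nabla \<longleftrightarrow>
     (\<forall>U\<in>opens M. \<forall>X\<in>vector_fields M U. \<forall>Y\<in>vector_fields M U. \<forall>Z\<in>vector_fields M U.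
        riemann M nabla U X Y Z = 0)"

definition cov_deriv_metric ::
  "'m metric \<Rightarrow> 'm vf_operation \<Rightarrow> 'm set \<Rightarrow>
    'm vector_field \<Rightarrow> 'm vector_field \<Rightarrow> 'm vector_field \<Rightarrow> 'm \<Rightarrow> real" where
  "cov_deriv_metric g nabla U X Y Z = (\<lambda>p. X p (metric_vf g Y Z)
     - metric_vf g (nabla U X Y) Z p - metric_vf g Y (nabla U X Z) p)"

definition levi_civita ::
  "('m::topological_space, 'e::euclidean_space) chart set \<Rightarrow> 'm metric \<Rightarrow> 'm vf_operation" where
  "levi_civita M g = (THE nabla. connection M nabla \<and> torsionless M nabla \<and>
     (\<forall>U\<in>opens M. \<forall>X\<in>vector_fields M U. \<forall>Y\<in>vector_fields M U. \<forall>Z\<in>vector_fields M U.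
        \<forall>p\<in>U. cov_deriv_metric g nabla U X Y Z p = 0))"


section \<open>F-manifolds\<close>

definition unital_product ::
  "('m::topological_space, 'e::euclidean_space) chart set \<Rightarrow>
    'm vf_operation \<Rightarrow> 'm vector_field \<Rightarrow> bool" where
  "unital_product M c e \<longleftrightarrow>
     local_operation M c \<and>
     (\<forall>U\<in>opens M. \<forall>X\<in>vector_fields M U. \<forall>Y\<in>vector_fields M U. \<forall>Z\<in>vector_fields M U.
        c U (X + Y) Z = c U X Z + c U Y Z \<and>
        c U X (Y + Z) = c U X Y + c U X Z \<and>
        c U (c U X Y) Z = c U X (c U Y Z)) \<and>
     (\<forall>U\<in>opens M. \<forall>h\<in>smooth_functions M U. \<forall>X\<in>vector_fields M U. \<forall>Y\<in>vector_fields M U.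
        c U (scale_vf h X) Y = scale_vf h (c U X Y) \<and>
        c U X (scale_vf h Y) = scale_vf h (c U X Y)) \<and>
     (\<forall>U\<in>opens M. \<forall>X\<in>vector_fields M U. \<forall>Y\<in>vector_fields M U. c U X Y = c U Y X) \<and>
     e \<in> vector_fields M (carrier M) \<and>
     (\<forall>U\<in>opens M. \<forall>X\<in>vector_fields M U. c U (restrict_vf U e) X = X)"

text \<open>\<open>(\<L>\<^sub>X c)(Y, Z)\<close> for the \<open>(1,2)\<close>-tensor \<open>c\<close>.\<close>

definition lie_deriv_product ::
  "('m::topological_space, 'e::euclidean_space) chart set \<Rightarrow> 'm vf_operation \<Rightarrow> 'm set \<Rightarrow>
    'm vector_field \<Rightarrow> 'm vector_field \<Rightarrow> 'm vector_field \<Rightarrow> 'm vector_field" where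
  "lie_deriv_product M c U X Y Z =
     lie_bracket M X (c U Y Z) - c U (lie_bracket M X Y) Z - c U Y (lie_bracket M X Z)"

definition F_manifold ::
  "('m::topological_space, 'e::euclidean_space) chart set \<Rightarrow>
    'm vf_operation \<Rightarrow> 'm vector_field \<Rightarrow> bool" where
  "F_manifold M c e \<longleftrightarrow>
     unital_product M c e \<and>
     (\<forall>U\<in>opens M. \<forall>X\<in>vector_fields M U. \<forall>Y\<in>vector_fields M U.
        \<forall>Z\<in>vector_fields M U. \<forall>W\<in>vector_fields M U.
        lie_deriv_product M c U (c U X Y) Z W =
          c U X (lie_deriv_product M c U Y Z W) + c U Y (lie_deriv_product M c U X Z W))"

definition riemannian_F_manifold_Killing ::
  "('m::topological_space, 'e::euclidean_space) chart set \<Rightarrow>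
    'm vf_operation \<Rightarrow> 'm metric \<Rightarrow> 'm vector_field \<Rightarrow> bool" where
  "riemannian_F_manifold_Killing M c g e \<longleftrightarrow>
     F_manifold M c e \<and>
     pseudo_riemannian_metric M g \<and>
     (\<forall>U\<in>opens M. \<forall>X\<in>vector_fields M U. \<forall>Y\<in>vector_fields M U. \<forall>Z\<in>vector_fields M U.
        \<forall>p\<in>U. metric_vf g (c U X Y) Z p = metric_vf g X (c U Y Z) p) \<and>
     (let R = riemann M (levi_civita M g) in
        \<forall>U\<in>opens M. \<forall>X\<in>vector_fields M U. \<forall>Y\<in>vector_fields M U.
        \<forall>Z\<in>vector_fields M U. \<forall>W\<in>vector_fields M U.
        R U Y Z (c U X W) + R U X Y (c U Z W) + R U Z X (c U Y W) = 0) \<and>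
     (\<forall>U\<in>opens M. \<forall>Y\<in>vector_fields M U. \<forall>Z\<in>vector_fields M U.
        \<forall>p\<in>U. lie_deriv_metric M g (restrict_vf U e) Y Z p = 0)"

definition counit :: "'m metric \<Rightarrow> 'm vector_field \<Rightarrow> 'm one_form" where
  "counit g e = (\<lambda>X. metric_vf g e X)"

definition cov_deriv_product ::
  "'m vf_operation \<Rightarrow> 'm vf_operation \<Rightarrow> 'm set \<Rightarrow>
    'm vector_field \<Rightarrow> 'm vector_field \<Rightarrow> 'm vector_field \<Rightarrow> 'm vector_field" where
  "cov_deriv_product c nabla U X Y Z = nabla U X (c U Y Z) - c U (nabla U X Y) Z - c U Y (nabla U X Z)"

definition flat_F_manifold ::
  "('m::topological_space, 'e::euclidean_space) chart set \<Rightarrow>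
    'm vf_operation \<Rightarrow> 'm vf_operation \<Rightarrow> 'm vector_field \<Rightarrow> bool" where
  "flat_F_manifold M c nabla e \<longleftrightarrow>
     unital_product M c e \<and>
     connection M nabla \<and> torsionless M nabla \<and> flat M nabla \<and>
     (\<forall>U\<in>opens M. \<forall>X\<in>vector_fields M U. nabla U X (restrict_vf U e) = 0) \<and>
     (\<forall>U\<in>opens M. \<forall>X\<in>vector_fields M U. \<forall>Y\<in>vector_fields M U. \<forall>Z\<in>vector_fields M U.
        cov_deriv_product c nabla U X Y Z = cov_deriv_product c nabla U Y X Z \<and>
        cov_deriv_product c nabla U X Y Z = cov_deriv_product c nabla U X Z Y)"

definition counit_compatible ::
  "('m::topological_space, 'e::euclidean_space) chart set \<Rightarrow>
    'm vf_operation \<Rightarrow> 'm metric \<Rightarrow> 'm vector_field \<Rightarrow> 'm vf_operation \<Rightarrow> bool" where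
  "counit_compatible M c g e nabla \<longleftrightarrow>
     (let d\<theta> = ext_deriv M (counit g e) in
        \<forall>U\<in>opens M. \<forall>X\<in>vector_fields M U. \<forall>Y\<in>vector_fields M U. \<forall>Z\<in>vector_fields M U. \<forall>p\<in>U.
          cov_deriv_metric g nabla U X Y Z p
            = 1/2 * d\<theta> (c U X Y) Z p + 1/2 * d\<theta> (c U X Z) Y p)"

end

theory Submission
  imports Defs
begin

text \<open>Let \<open>n\<close> be the Levi-Civita connection of \<open>g\<close> and \<open>A X = n X e\<close>. That \<open>e\<close> is a Killing field means
  that \<open>A\<close> is skew, and this gives \<open>d\<theta>(X, Y) = 2 g(A X, Y)\<close>. Hence half the vector field dual to the
  contraction of \<open>d\<theta>\<close> with \<open>X \<circ> Y\<close> is \<open>A (X \<circ> Y)\<close>, and the connection of the theorem is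
  \<open>\<nabla> X Y = n X Y - A (X \<circ> Y)\<close>. It is torsionless as the product is commutative, and skewness of \<open>A\<close> turns
  the correction term into the required covariant derivative of \<open>g\<close>. Uniqueness is that of the Levi-Civita
  connection: the difference of two torsionless connections with the same covariant derivative of \<open>g\<close> is
  symmetric in its first two and skew in its last two arguments, hence zero (\<open>symmetric_skew_zero\<close>).

  Compatibility with the product. As the product is invariant, \<open>g((n\<^sub>X c)(Y, Z), W)\<close> is symmetric in
  \<open>Y, Z, W\<close>. The Hertling-Manin condition, with Lie derivatives expressed by \<open>n\<close> and paired with \<open>e\<close>, becomes
  a linear relation between the four values obtained by differentiating in the directions \<open>X, Y, Z, W\<close>
  (\<open>Dm_exchange_pairs\<close>). Three instances of it determine what happens when \<open>X\<close> and \<open>Y\<close> are exchanged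
  (\<open>Dm_exchange\<close>), and the correction by \<open>A\<close> cancels exactly this defect (\<open>nab_compatible\<close>).

  Flatness. Because \<open>\<nabla>c\<close> is symmetric, the curvatures of \<open>n\<close> and \<open>\<nabla>\<close> differ on \<open>(Y, Z, V)\<close> by
  \<open>P Y (Z \<circ> V) - P Z (Y \<circ> V)\<close> for some \<open>P\<close> (\<open>curvature_difference\<close>), and such a term drops out of the cyclic sum
  in the curvature condition, which therefore also holds for \<open>\<nabla>\<close>. The flow of \<open>e\<close> preserves the metric and
  the product, hence \<open>\<nabla>\<close>; since \<open>e\<close> is parallel, this says that the curvature of \<open>\<nabla>\<close> vanishes when one of
  the two directions is \<open>e\<close> (\<open>R_nab_unit\<close>). Inserting \<open>e\<close> into the cyclic condition leaves
  a single term, the full curvature (\<open>nab_flat\<close>).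

  These computations use only finitely many algebraic laws and are carried out in the locale
  \<open>killing_F_algebra\<close>. To supply the laws, the Levi-Civita connection has to be constructed for vector fields that
  are families of derivations of germs: Hadamard's lemma shows that the coordinate derivations span
  the tangent spaces, Cramer's rule in coordinates shows that the dual of a one-form is smooth, and the
  Koszul formula provides the one-form. Coordinates also extend a tangent vector to a vector field, over any open
  subset of a chart domain. Identities between vector fields are therefore proved over such
  subsets, where pairing with all vector fields suffices, and spread to other domains
  because all operations are local (\<open>vf_eq_small\<close>).\<close>

section \<open>Calculus of smooth functions\<close>

lemma Ck_on_cong:
  assumes "Ck_on k S f" "open S" "\<And>x. x \<in> S \<Longrightarrow> f x = h x"
  shows "Ck_on k S h"
  using assms(1,3)
proof (induction k arbitrary: f h)
  case 0
  then show ?case using continuous_on_cong[of S S f h] by simp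
next
  case (Suc k)
  have *: "(h has_derivative frechet_derivative f (at x)) (at x)" if "x \<in> S" for x
  proof (rule has_derivative_transform_within_open[OF _ \<open>open S\<close> that Suc.prems(2)])
    show "(f has_derivative frechet_derivative f (at x)) (at x)"
      using Suc.prems(1) that by (simp flip: frechet_derivative_works)
  qed
  have "frechet_derivative h (at x) = frechet_derivative f (at x)" if "x \<in> S" for x
    using frechet_derivative_at[OF *[OF that]] by simp
  then have "Ck_on k S (\<lambda>x. frechet_derivative h (at x) v)" for v
    using Suc.IH[of "\<lambda>x. frechet_derivative f (at x) v" "\<lambda>x. frechet_derivative h (at x) v"] Suc.prems(1)
    by simp
  with * show ?case by (auto simp: differentiable_def)
qed

text \<open>The recursive clause of \<open>Ck_on\<close> speaks of \<open>frechet_derivative\<close>, a choice; this form works with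
  any family of derivatives.\<close>

lemma Ck_on_SucI:
  assumes "open S" "\<And>x. x \<in> S \<Longrightarrow> (f has_derivative f' x) (at x)" "\<And>v. Ck_on k S (\<lambda>x. f' x v)"
  shows "Ck_on (Suc k) S f"
proof -
  have "Ck_on k S (\<lambda>x. frechet_derivative f (at x) v)" for v
    by (rule Ck_on_cong[OF assms(3)[of v] assms(1)]) (use assms(2) frechet_derivative_at in metis)
  then show ?thesis using assms(2) by (auto simp: differentiable_def)
qed

lemma Ck_on_Suc_has_derivative:
  "Ck_on (Suc k) S f \<Longrightarrow> x \<in> S \<Longrightarrow> (f has_derivative frechet_derivative f (at x)) (at x)"
  using frechet_derivative_works by auto

lemma Ck_on_Suc_imp: "Ck_on (Suc k) S f \<Longrightarrow> Ck_on k S f"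
proof (induction k arbitrary: f)
  case 0
  then show ?case
    by (auto intro!: continuous_at_imp_continuous_on differentiable_imp_continuous_within)
next
  case (Suc k)
  from Suc.prems have "\<forall>x\<in>S. f differentiable (at x)"
    and "\<And>v. Ck_on (Suc k) S (\<lambda>x. frechet_derivative f (at x) v)" by auto
  then show ?case using Suc.IH by auto
qed

lemma Ck_on_subset: "Ck_on k S f \<Longrightarrow> T \<subseteq> S \<Longrightarrow> Ck_on k T f"
  by (induction k arbitrary: f) (auto intro: continuous_on_subset)

lemma Ck_on_local:
  assumes "open S" "\<And>x. x \<in> S \<Longrightarrow> \<exists>T. open T \<and> x \<in> T \<and> Ck_on k T f"
  shows "Ck_on k S f"
  using assms(2)
proof (induction k arbitrary: f)
  case 0
  have "isCont f x" if "x \<in> S" for x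
    using 0[OF that] by (auto simp: continuous_on_eq_continuous_at)
  then show ?case by (simp add: continuous_at_imp_continuous_on)
next
  case (Suc k)
  have "f differentiable (at x)" if "x \<in> S" for x
    using Suc.prems[OF that] by auto
  moreover have "Ck_on k S (\<lambda>x. frechet_derivative f (at x) v)" for v
  proof (rule Suc.IH)
    fix x assume "x \<in> S"
    from Suc.prems[OF this] obtain T where "open T" "x \<in> T" "Ck_on (Suc k) T f" by blast
    then show "\<exists>T. open T \<and> x \<in> T \<and> Ck_on k T (\<lambda>x. frechet_derivative f (at x) v)"
      by (intro exI[of _ T]) simp
  qed
  ultimately show ?case by simp
qed

lemma Ck_on_const: "Ck_on k S (\<lambda>x. a)"
proof (induction k arbitrary: a)
  case (Suc k)
  have "frechet_derivative (\<lambda>x. a) (at x) = (\<lambda>v. 0)" for x :: 'a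
    by (rule frechet_derivative_at[symmetric]) simp
  then show ?case using Suc by simp
qed simp

lemma Ck_on_bounded_linear:
  assumes "open S" "bounded_linear L" shows "Ck_on k S L"
proof (cases k)
  case 0
  then show ?thesis using assms linear_continuous_on by auto
next
  case (Suc n)
  then show ?thesis
    using Ck_on_SucI[OF assms(1), of L "\<lambda>x. L"] bounded_linear_imp_has_derivative[OF assms(2)] Ck_on_const
    by blast
qed

lemma Ck_on_bounded_linear_compose:
  assumes "open S" "bounded_linear L" "Ck_on k S h"
  shows "Ck_on k S (\<lambda>x. L (h x))"
  using assms(3)
proof (induction k arbitrary: h)
  case 0
  then show ?case using bounded_linear.continuous_on[OF assms(2)] by simp
next
  case (Suc k)
  show ?case
    by (rule Ck_on_SucI[OF assms(1) bounded_linear.has_derivative[OF assms(2)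
            Ck_on_Suc_has_derivative[OF Suc.prems]]]) (use Suc in auto)
qed

lemma Ck_on_add:
  assumes "open S" "Ck_on k S f" "Ck_on k S h"
  shows "Ck_on k S (\<lambda>x. f x + h x)"
  using assms(2,3)
proof (induction k arbitrary: f h)
  case (Suc k)
  show ?case
    by (rule Ck_on_SucI[OF assms(1) has_derivative_add[OF Ck_on_Suc_has_derivative[OF Suc.prems(1)]
            Ck_on_Suc_has_derivative[OF Suc.prems(2)]]])
      (use Suc in auto)
qed (auto intro: continuous_intros)

text \<open>Products and, below, inverses go by induction on the order: the product rule expresses the derivative by
  products of functions that are differentiable once less often.\<close>

lemma Ck_on_scaleR:
  fixes f :: "'a::real_normed_vector \<Rightarrow> real" and h :: "'a \<Rightarrow> 'b::real_normed_vector"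
  assumes "open S" "Ck_on k S f" "Ck_on k S h"
  shows "Ck_on k S (\<lambda>x. f x *\<^sub>R h x)"
  using assms(2,3)
proof (induction k arbitrary: f h)
  case (Suc k)
  show ?case
    by (rule Ck_on_SucI[OF assms(1) has_derivative_scaleR[OF Ck_on_Suc_has_derivative[OF Suc.prems(1)]
            Ck_on_Suc_has_derivative[OF Suc.prems(2)]]])
      (use Suc.prems in \<open>auto intro!: Ck_on_add[OF assms(1)] Suc.IH Ck_on_Suc_imp[OF Suc.prems(1)]
          Ck_on_Suc_imp[OF Suc.prems(2)]\<close>)
qed (auto intro: continuous_intros)

lemma Ck_on_mult:
  fixes f h :: "'a::real_normed_vector \<Rightarrow> real"
  shows "open S \<Longrightarrow> Ck_on k S f \<Longrightarrow> Ck_on k S h \<Longrightarrow> Ck_on k S (\<lambda>x. f x * h x)"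
  using Ck_on_scaleR[of S k f h] by simp

lemma Ck_on_sum:
  assumes "open S" "\<And>i. i \<in> I \<Longrightarrow> Ck_on k S (f i)"
  shows "Ck_on k S (\<lambda>x. \<Sum>i\<in>I. f i x)"
  using assms(2) by (induction I rule: infinite_finite_induct)
    (auto intro: Ck_on_const Ck_on_add[OF assms(1)])

lemma Ck_on_inverse:
  fixes f :: "'a::real_normed_vector \<Rightarrow> real"
  assumes "open S" "Ck_on k S f" "\<And>x. x \<in> S \<Longrightarrow> f x \<noteq> 0"
  shows "Ck_on k S (\<lambda>x. inverse (f x))"
  using assms(2)
proof (induction k)
  case (Suc k)
  have *: "((\<lambda>x. inverse (f x)) has_derivative
      (\<lambda>v. (-1) * (inverse (f x) * (frechet_derivative f (at x) v * inverse (f x))))) (at x)" if "x \<in> S" for x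
    using Deriv.has_derivative_inverse[OF assms(3)[OF that] Ck_on_Suc_has_derivative[OF Suc.prems that]]
    by (simp add: mult.assoc)
  have i: "Ck_on k S (\<lambda>x. inverse (f x))" using Suc Ck_on_Suc_imp by blast
  show ?case
    by (rule Ck_on_SucI[OF assms(1) *])
      (use Suc.prems in \<open>auto intro!: Ck_on_mult[OF assms(1)] i Ck_on_const[of k S "-1", simplified]
         Ck_on_mult[OF assms(1) Ck_on_const[of k S "-1"], simplified]\<close>)
qed (use assms in \<open>auto intro: continuous_intros\<close>)

text \<open>The directional derivative of a composition is expanded along a basis of the middle space,
  which turns the chain rule into a sum of products of functions of one lower order.\<close>

lemma Ck_on_compose:
  fixes \<phi> :: "'a::real_normed_vector \<Rightarrow> 'b::euclidean_space" and f :: "'b \<Rightarrow> 'c::real_normed_vector"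
  assumes "open S" "open T" "\<phi> ` S \<subseteq> T" "Ck_on k T f" "Ck_on k S \<phi>"
  shows "Ck_on k S (\<lambda>x. f (\<phi> x))"
  using assms(4,5)
proof (induction k arbitrary: f)
  case 0
  then show ?case using assms(3) by (auto intro: continuous_on_compose2)
next
  case (Suc k)
  let ?D = "\<lambda>x v. \<Sum>b\<in>Basis. (frechet_derivative \<phi> (at x) v \<bullet> b) *\<^sub>R frechet_derivative f (at (\<phi> x)) b"
  have der: "((\<lambda>x. f (\<phi> x)) has_derivative ?D x) (at x)" if x: "x \<in> S" for x
  proof -
    have f: "(f has_derivative frechet_derivative f (at (\<phi> x))) (at (\<phi> x))"
      using Ck_on_Suc_has_derivative[OF Suc.prems(1)] x assms(3) by auto
    have "frechet_derivative f (at (\<phi> x)) w = (\<Sum>b\<in>Basis. (w \<bullet> b) *\<^sub>R frechet_derivative f (at (\<phi> x)) b)" for w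
    proof -
      have lin: "linear (frechet_derivative f (at (\<phi> x)))" using f has_derivative_linear by blast
      have "frechet_derivative f (at (\<phi> x)) w = frechet_derivative f (at (\<phi> x)) (\<Sum>b\<in>Basis. (w \<bullet> b) *\<^sub>R b)"
        by (simp add: euclidean_representation)
      then show ?thesis by (simp add: linear_sum[OF lin] linear_cmul[OF lin])
    qed
    from this[symmetric] have "?D x = (\<lambda>v. frechet_derivative f (at (\<phi> x)) (frechet_derivative \<phi> (at x) v))"
      by (rule ext)
    then show ?thesis
      using has_derivative_compose[OF Ck_on_Suc_has_derivative[OF Suc.prems(2) x] f] by simp
  qed
  show ?case
  proof (rule Ck_on_SucI[OF assms(1) der])
    fix v
    have "Ck_on k S (\<lambda>x. frechet_derivative f (at (\<phi> x)) b)" for b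
      using Suc.IH[of "\<lambda>y. frechet_derivative f (at y) b"] Suc.prems Ck_on_Suc_imp by auto
    moreover have "Ck_on k S (\<lambda>x. frechet_derivative \<phi> (at x) v \<bullet> b)" for b
      by (rule Ck_on_bounded_linear_compose[OF assms(1) bounded_linear_inner_left])
        (use Suc.prems in simp)
    ultimately show "Ck_on k S (\<lambda>x. ?D x v)"
      by (intro Ck_on_sum Ck_on_scaleR assms(1))
  qed
qed

lemma smooth_on_cong: "smooth_on S f \<Longrightarrow> open S \<Longrightarrow> (\<And>x. x \<in> S \<Longrightarrow> f x = h x) \<Longrightarrow> smooth_on S h"
  unfolding smooth_on_def using Ck_on_cong by blast

lemma smooth_on_subset: "smooth_on S f \<Longrightarrow> T \<subseteq> S \<Longrightarrow> smooth_on T f"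
  unfolding smooth_on_def using Ck_on_subset by blast

lemma smooth_on_local:
  assumes "open S" "\<And>x. x \<in> S \<Longrightarrow> \<exists>T. open T \<and> x \<in> T \<and> smooth_on T f"
  shows "smooth_on S f"
  unfolding smooth_on_def
proof (intro allI Ck_on_local[OF assms(1)])
  fix k x assume "x \<in> S"
  from assms(2)[OF this] show "\<exists>T. open T \<and> x \<in> T \<and> Ck_on k T f"
    unfolding smooth_on_def by blast
qed

lemma smooth_on_const: "smooth_on S (\<lambda>x. a)"
  by (simp add: smooth_on_def Ck_on_const)

lemma smooth_on_bounded_linear: "open S \<Longrightarrow> bounded_linear L \<Longrightarrow> smooth_on S L"
  by (simp add: smooth_on_def Ck_on_bounded_linear)

lemma smooth_on_add: "open S \<Longrightarrow> smooth_on S f \<Longrightarrow> smooth_on S h \<Longrightarrow> smooth_on S (\<lambda>x. f x + h x)"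
  by (simp add: smooth_on_def Ck_on_add)

lemma smooth_on_mult:
  fixes f h :: "'a::real_normed_vector \<Rightarrow> real"
  shows "open S \<Longrightarrow> smooth_on S f \<Longrightarrow> smooth_on S h \<Longrightarrow> smooth_on S (\<lambda>x. f x * h x)"
  by (simp add: smooth_on_def Ck_on_mult)

lemma smooth_on_inverse:
  fixes f :: "'a::real_normed_vector \<Rightarrow> real"
  shows "open S \<Longrightarrow> smooth_on S f \<Longrightarrow> (\<And>x. x \<in> S \<Longrightarrow> f x \<noteq> 0) \<Longrightarrow> smooth_on S (\<lambda>x. inverse (f x))"
  by (simp add: smooth_on_def Ck_on_inverse)

lemma smooth_on_compose:
  fixes \<phi> :: "'a::real_normed_vector \<Rightarrow> 'b::euclidean_space"
  shows "open S \<Longrightarrow> open T \<Longrightarrow> \<phi> ` S \<subseteq> T \<Longrightarrow> smooth_on T f \<Longrightarrow> smooth_on S \<phi> \<Longrightarrow> smooth_on S (\<lambda>x. f (\<phi> x))"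
  unfolding smooth_on_def using Ck_on_compose by blast

lemma smooth_on_has_derivative:
  "smooth_on S f \<Longrightarrow> x \<in> S \<Longrightarrow> (f has_derivative frechet_derivative f (at x)) (at x)"
  unfolding smooth_on_def using Ck_on_Suc_has_derivative by blast

lemma smooth_on_frechet_derivative:
  "smooth_on S f \<Longrightarrow> smooth_on S (\<lambda>x. frechet_derivative f (at x) v)"
  unfolding smooth_on_def using Ck_on.simps(2) by blast

lemma smooth_on_imp_continuous_on: "smooth_on S f \<Longrightarrow> continuous_on S f"
  unfolding smooth_on_def using Ck_on.simps(1) by blast

section \<open>Hadamard's lemma\<close>

lemma ball_starlike:
  fixes a x :: "'a::real_normed_vector"
  assumes "x \<in> ball a r" "t \<in> {0..1}"
  shows "a + t *\<^sub>R (x - a) \<in> ball a r"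
proof -
  have "norm (t *\<^sub>R (x - a)) \<le> norm (x - a)" using assms(2) by (auto intro: mult_left_le_one_le)
  then show ?thesis using assms(1) by (simp add: dist_norm norm_minus_commute)
qed

text \<open>Differentiation under the integral sign produces another integral of the same shape, with the
  exponent raised by one; this is why the power of \<open>t\<close> is carried along.\<close>

lemma Ck_on_radial_integral:
  fixes F :: "'a::euclidean_space \<Rightarrow> real"
  assumes "smooth_on (ball a r) F"
  shows "Ck_on k (ball a r) (\<lambda>x. integral {0..1} (\<lambda>t. t ^ m * F (a + t *\<^sub>R (x - a))))"
  using assms
proof (induction k arbitrary: F m)
  note in_ball = ball_starlike
  have cont: "continuous_on (ball a r \<times> cbox 0 1) (\<lambda>(x, t). t ^ m * F (a + t *\<^sub>R (x - a)))"
    if F: "smooth_on (ball a r) F" for F :: "'a \<Rightarrow> real" and m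
  proof -
    have "continuous_on (ball a r \<times> {0..1}) (\<lambda>z. F (a + snd z *\<^sub>R (fst z - a)))"
      by (rule continuous_on_compose2[OF smooth_on_imp_continuous_on[OF F]])
        (auto intro!: continuous_intros simp del: mem_ball simp: in_ball)
    then show ?thesis
      by (auto intro!: continuous_intros simp: case_prod_beta)
  qed
  {
    case (0 F m)
    show ?case using integral_continuous_on_param[OF cont[OF 0]] by simp
  next
    case (Suc k F m)
    let ?D = "frechet_derivative F"
    define J where "J x t = Blinfun (\<lambda>v. t ^ Suc m * ?D (at (a + t *\<^sub>R (x - a))) v)" for x and t :: real
    have J: "blinfun_apply (J x t) = (\<lambda>v. t ^ Suc m * ?D (at (a + t *\<^sub>R (x - a))) v)"
      if "x \<in> ball a r" "t \<in> {0..1}" for x t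
      unfolding J_def
      using has_derivative_bounded_linear[OF smooth_on_has_derivative[OF Suc.prems in_ball[OF that]]]
      by (intro bounded_linear_Blinfun_apply bounded_linear_const_mult)
    have der: "((\<lambda>x. t ^ m * F (a + t *\<^sub>R (x - a))) has_derivative blinfun_apply (J x t)) (at x within ball a r)"
      if "x \<in> ball a r" "t \<in> cbox 0 1" for x t
    proof -
      have t: "t \<in> {0..1}" using that by simp
      note F' = smooth_on_has_derivative[OF Suc.prems in_ball[OF that(1) t]]
      have "((\<lambda>x. a + t *\<^sub>R (x - a)) has_derivative (\<lambda>v. t *\<^sub>R v)) (at x within ball a r)"
        by (auto intro!: derivative_eq_intros)
      from has_derivative_compose[OF this F']
      have "((\<lambda>x. t ^ m * F (a + t *\<^sub>R (x - a))) has_derivative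
          (\<lambda>v. t ^ m * ?D (at (a + t *\<^sub>R (x - a))) (t *\<^sub>R v))) (at x within ball a r)"
        by (rule has_derivative_mult_right)
      moreover have "?D (at (a + t *\<^sub>R (x - a))) (t *\<^sub>R v) = t * ?D (at (a + t *\<^sub>R (x - a))) v" for v
        using linear_cmul[OF has_derivative_linear[OF F']] by simp
      ultimately show ?thesis by (simp add: J[OF that(1) t] mult.assoc mult.commute mult.left_commute)
    qed
    have contJ: "continuous_on (ball a r \<times> cbox 0 1) (\<lambda>(x, t). J x t)"
    proof (rule continuous_on_blinfun_componentwise)
      fix i :: 'a
      show "continuous_on (ball a r \<times> cbox 0 1) (\<lambda>z. blinfun_apply (case z of (x, t) \<Rightarrow> J x t) i)"
        using cont[OF smooth_on_frechet_derivative[OF Suc.prems, of i], of "Suc m"]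
        by (rule continuous_on_eq) (auto simp: J case_prod_beta simp del: mem_ball)
    qed
    have L: "((\<lambda>x. integral (cbox 0 1) (\<lambda>t. t ^ m * F (a + t *\<^sub>R (x - a)))) has_derivative
        integral (cbox 0 1) (J x)) (at x)" if "x \<in> ball a r" for x
    proof -
      have "(\<lambda>t. t ^ m * F (a + t *\<^sub>R (y - a))) integrable_on cbox 0 1" if y: "y \<in> ball a r" for y
        by (rule integrable_continuous, rule continuous_on_compose2[OF cont[OF Suc.prems, of m], where f="\<lambda>t. (y, t)", simplified])
          (use y in \<open>auto intro!: continuous_intros\<close>)
      then show ?thesis
        using leibniz_rule[where U="ball a r" and a=0 and b="1::real", OF der _ contJ that]
          at_within_open[OF that open_ball] by simp
    qed
    show ?case
    proof (rule Ck_on_SucI[OF open_ball])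
      fix x assume x: "x \<in> ball a r"
      show "((\<lambda>x. integral {0..1} (\<lambda>t. t ^ m * F (a + t *\<^sub>R (x - a)))) has_derivative
          blinfun_apply (integral (cbox 0 1) (J x))) (at x)"
        using L[OF x] by simp
    next
      fix v
      have "blinfun_apply (integral (cbox 0 1) (J x)) v =
          integral {0..1} (\<lambda>t. t ^ Suc m * ?D (at (a + t *\<^sub>R (x - a))) v)" if x: "x \<in> ball a r" for x
      proof -
        have "J x integrable_on cbox 0 1"
          by (rule integrable_continuous, rule continuous_on_compose2[OF contJ, where f="\<lambda>t. (x, t)", simplified])
            (use x in \<open>auto intro!: continuous_intros\<close>)
        then have "blinfun_apply (integral (cbox 0 1) (J x)) v = integral (cbox 0 1) (\<lambda>t. blinfun_apply (J x t) v)"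
          by (rule blinfun_apply_integral)
        also have "\<dots> = integral (cbox 0 1) (\<lambda>t. t ^ Suc m * ?D (at (a + t *\<^sub>R (x - a))) v)"
          by (rule integral_cong) (simp add: J[OF x])
        finally show ?thesis by simp
      qed
      then show "Ck_on k (ball a r) (\<lambda>x. blinfun_apply (integral (cbox 0 1) (J x)) v)"
        by (intro Ck_on_cong[OF Suc.IH[OF smooth_on_frechet_derivative[OF Suc.prems]] open_ball]) (rule sym)
    qed
  }
qed

text \<open>The coefficient of \<open>x\<^sub>b - a\<^sub>b\<close> is the integral of the partial derivative along the segment from \<open>a\<close>
  to \<open>x\<close>.\<close>

lemma Hadamard:
  fixes F :: "'a::euclidean_space \<Rightarrow> real"
  assumes F: "smooth_on (ball a r) F"
  obtains G where "\<And>b. smooth_on (ball a r) (G b)"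
    "\<And>x. x \<in> ball a r \<Longrightarrow> F x = F a + (\<Sum>b\<in>Basis. (x \<bullet> b - a \<bullet> b) * G b x)"
    "\<And>b. G b a = frechet_derivative F (at a) b"
proof
  define G where "G b x = integral {0..1} (\<lambda>t. frechet_derivative F (at (a + t *\<^sub>R (x - a))) b)" for b x
  show "smooth_on (ball a r) (G b)" for b
    unfolding smooth_on_def G_def
    using Ck_on_radial_integral[OF smooth_on_frechet_derivative[OF F], where m=0] by simp
  show "G b a = frechet_derivative F (at a) b" for b by (simp add: G_def)
  fix x assume x: "x \<in> ball a r"
  let ?g = "\<lambda>t. a + t *\<^sub>R (x - a)"
  note in_ball = ball_starlike[OF x]
  have vd: "((\<lambda>t. F (?g t)) has_vector_derivative frechet_derivative F (at (?g t)) (x - a)) (at t within {0..1})"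
    if t: "t \<in> {0..1}" for t
  proof -
    note F' = smooth_on_has_derivative[OF F in_ball[OF t]]
    have "(?g has_derivative (\<lambda>s. s *\<^sub>R (x - a))) (at t within {0..1})"
      by (auto intro!: derivative_eq_intros)
    from has_derivative_compose[OF this F'] show ?thesis
      using linear_cmul[OF has_derivative_linear[OF F']] by (simp add: has_vector_derivative_def)
  qed
  have "((\<lambda>t. frechet_derivative F (at (?g t)) (x - a)) has_integral F x - F a) {0..1}"
    using fundamental_theorem_of_calculus[OF _ vd] by simp
  moreover have "((\<lambda>t. frechet_derivative F (at (?g t)) (x - a)) has_integral
      (\<Sum>b\<in>Basis. (x \<bullet> b - a \<bullet> b) * G b x)) {0..1}"
  proof -
    have "((\<lambda>t. frechet_derivative F (at (?g t)) b) has_integral G b x) {0..1}" for b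
    proof -
      have "continuous_on {0..1} (\<lambda>t. frechet_derivative F (at (?g t)) b)"
        by (rule continuous_on_compose2[OF smooth_on_imp_continuous_on[OF smooth_on_frechet_derivative[OF F, of b]]])
          (auto intro!: continuous_intros in_ball simp del: mem_ball)
      then show ?thesis unfolding G_def by (intro integrable_integral integrable_continuous_real)
    qed
    then have "((\<lambda>t. \<Sum>b\<in>Basis. (x \<bullet> b - a \<bullet> b) * frechet_derivative F (at (?g t)) b) has_integral
        (\<Sum>b\<in>Basis. (x \<bullet> b - a \<bullet> b) * G b x)) {0..1}"
      by (intro has_integral_sum has_integral_mult_right) auto
    moreover have "(\<Sum>b\<in>Basis. (x \<bullet> b - a \<bullet> b) * frechet_derivative F (at (?g t)) b) =
        frechet_derivative F (at (?g t)) (x - a)" if "t \<in> {0..1}" for t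
    proof -
      have lin: "linear (frechet_derivative F (at (?g t)))"
        using smooth_on_has_derivative[OF F in_ball[OF that]] has_derivative_linear by blast
      have "frechet_derivative F (at (?g t)) (x - a) = frechet_derivative F (at (?g t)) (\<Sum>b\<in>Basis. ((x - a) \<bullet> b) *\<^sub>R b)"
        by (simp add: euclidean_representation)
      then show ?thesis by (simp add: linear_sum[OF lin] linear_cmul[OF lin] inner_diff_left)
    qed
    ultimately show ?thesis by (rule has_integral_eq[rotated])
  qed
  ultimately have "F x - F a = (\<Sum>b\<in>Basis. (x \<bullet> b - a \<bullet> b) * G b x)"
    by (rule has_integral_unique)
  then show "F x = F a + (\<Sum>b\<in>Basis. (x \<bullet> b - a \<bullet> b) * G b x)"
    by simp
qed

section \<open>Smooth functions and tangent vectors\<close>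

locale manifold =
  fixes M :: "('m::{t2_space, second_countable_topology}, 'e::euclidean_space) chart set"
  assumes smooth_manifold: "smooth_manifold M"
begin

lemma chart_open: "(D, \<phi>) \<in> M \<Longrightarrow> open D"
  using smooth_manifold by (auto simp: smooth_manifold_def is_chart_def)

lemma chart_homeomorphism: "(D, \<phi>) \<in> M \<Longrightarrow> homeomorphism D (\<phi> ` D) \<phi> (inv_into D \<phi>)"
  using smooth_manifold by (auto simp: smooth_manifold_def is_chart_def)

lemma chart_inv: "(D, \<phi>) \<in> M \<Longrightarrow> q \<in> D \<Longrightarrow> inv_into D \<phi> (\<phi> q) = q"
  using chart_homeomorphism homeomorphism_apply1 by blast

lemma chart_image_open:
  assumes "(D, \<phi>) \<in> M" "open V" "V \<subseteq> D" shows "open (\<phi> ` V)"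
proof -
  have "open (\<phi> ` D)" "continuous_on (\<phi> ` D) (inv_into D \<phi>)"
    using assms(1) smooth_manifold chart_homeomorphism
    by (auto simp: smooth_manifold_def is_chart_def homeomorphism_def)
  then have "open (\<phi> ` D \<inter> inv_into D \<phi> -` V)"
    using assms(2) continuous_open_preimage by blast
  moreover have "\<phi> ` D \<inter> inv_into D \<phi> -` V = \<phi> ` V"
    using assms chart_inv[OF assms(1)] by (auto simp: image_iff subset_iff)
  ultimately show ?thesis by simp
qed

lemma chart_preimage_open:
  assumes "(D, \<phi>) \<in> M" "open B" shows "open {q \<in> D. \<phi> q \<in> B}"
proof -
  have "continuous_on D \<phi>" using chart_homeomorphism[OF assms(1)] by (simp add: homeomorphism_def)
  then have "open (D \<inter> \<phi> -` B)" using chart_open[OF assms(1)] assms(2) continuous_open_preimage by blast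
  then show ?thesis by (simp add: Int_def vimage_def)
qed

lemma transition_smooth:
  "(D, \<phi>) \<in> M \<Longrightarrow> (D', \<phi>') \<in> M \<Longrightarrow> smooth_on (\<phi> ` (D \<inter> D')) (\<lambda>x. \<phi>' (inv_into D \<phi> x))"
  using smooth_manifold by (auto simp: smooth_manifold_def comp_def)

lemma opensD: "U \<in> opens M \<Longrightarrow> open U" "U \<in> opens M \<Longrightarrow> U \<subseteq> carrier M"
  by (auto simp: opens_def)

lemma opens_subset: "U \<in> opens M \<Longrightarrow> open V \<Longrightarrow> V \<subseteq> U \<Longrightarrow> V \<in> opens M"
  by (auto simp: opens_def)

lemma opens_Int: "U \<in> opens M \<Longrightarrow> V \<in> opens M \<Longrightarrow> U \<inter> V \<in> opens M"
  by (auto simp: opens_def)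

lemma chart_opens: "(D, \<phi>) \<in> M \<Longrightarrow> D \<in> opens M"
  using chart_open by (force simp: opens_def carrier_def)

lemma carrier_opens: "carrier M \<in> opens M"
  using chart_open by (force simp: opens_def carrier_def intro!: open_Union)

lemma opens_chart:
  assumes "U \<in> opens M" "p \<in> U" obtains D \<phi> where "(D, \<phi>) \<in> M" "p \<in> D"
  using assms by (auto simp: opens_def carrier_def)

lemma smooth_functionsI:
  "(\<And>D \<phi>. (D, \<phi>) \<in> M \<Longrightarrow> smooth_on (\<phi> ` (D \<inter> U)) (\<lambda>x. f (inv_into D \<phi> x))) \<Longrightarrow> f \<in> smooth_functions M U"
  by (auto simp: smooth_functions_def comp_def)

lemma smooth_functionsD:
  "f \<in> smooth_functions M U \<Longrightarrow> (D, \<phi>) \<in> M \<Longrightarrow> smooth_on (\<phi> ` (D \<inter> U)) (\<lambda>x. f (inv_into D \<phi> x))"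
  by (auto simp: smooth_functions_def comp_def)

lemma chart_image_Int_open: "(D, \<phi>) \<in> M \<Longrightarrow> U \<in> opens M \<Longrightarrow> open (\<phi> ` (D \<inter> U))"
  by (rule chart_image_open) (auto simp: chart_open opensD)

lemma smooth_functions_cong:
  assumes "f \<in> smooth_functions M U" "U \<in> opens M" "\<And>q. q \<in> U \<Longrightarrow> f q = h q"
  shows "h \<in> smooth_functions M U"
  by (rule smooth_functionsI, rule smooth_on_cong[OF smooth_functionsD[OF assms(1)]])
    (auto simp: chart_image_Int_open assms chart_inv)

lemma smooth_functions_subset: "f \<in> smooth_functions M U \<Longrightarrow> V \<subseteq> U \<Longrightarrow> f \<in> smooth_functions M V"
  by (rule smooth_functionsI, rule smooth_on_subset[OF smooth_functionsD]) auto

lemma smooth_functions_local: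
  assumes "U \<in> opens M" "\<And>p. p \<in> U \<Longrightarrow> \<exists>V\<in>opens M. p \<in> V \<and> f \<in> smooth_functions M V"
  shows "f \<in> smooth_functions M U"
proof (rule smooth_functionsI, rule smooth_on_local)
  fix D \<phi> assume K: "(D, \<phi>) \<in> M"
  then show "open (\<phi> ` (D \<inter> U))" using assms chart_image_Int_open by blast
  fix x assume "x \<in> \<phi> ` (D \<inter> U)"
  then obtain p where p: "p \<in> D" "p \<in> U" "x = \<phi> p" by blast
  with assms(2) obtain V where "V \<in> opens M" "p \<in> V" "f \<in> smooth_functions M V" by blast
  then show "\<exists>T. open T \<and> x \<in> T \<and> smooth_on T (\<lambda>x. f (inv_into D \<phi> x))"
    using smooth_functionsD[OF _ K] chart_image_Int_open[OF K] p by blast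
qed

lemma smooth_functions_const: "(\<lambda>q. a) \<in> smooth_functions M U"
  by (rule smooth_functionsI) (simp add: smooth_on_const)

context
  fixes U assumes U: "U \<in> opens M"
begin

lemma smooth_functions_add:
  "f \<in> smooth_functions M U \<Longrightarrow> h \<in> smooth_functions M U \<Longrightarrow> (\<lambda>q. f q + h q) \<in> smooth_functions M U"
  by (rule smooth_functionsI, rule smooth_on_add) (simp_all add: chart_image_Int_open U smooth_functionsD)

lemma smooth_functions_mult:
  "f \<in> smooth_functions M U \<Longrightarrow> h \<in> smooth_functions M U \<Longrightarrow> (\<lambda>q. f q * h q) \<in> smooth_functions M U"
  by (rule smooth_functionsI, rule smooth_on_mult) (simp_all add: chart_image_Int_open U smooth_functionsD)

lemma smooth_functions_minus:
  "f \<in> smooth_functions M U \<Longrightarrow> (\<lambda>q. - f q) \<in> smooth_functions M U"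
  using smooth_functions_mult[OF smooth_functions_const[of "-1"]] by simp

lemma smooth_functions_diff:
  "f \<in> smooth_functions M U \<Longrightarrow> h \<in> smooth_functions M U \<Longrightarrow> (\<lambda>q. f q - h q) \<in> smooth_functions M U"
  using smooth_functions_add[OF _ smooth_functions_minus[of h], of f] by simp

lemma smooth_functions_inverse:
  assumes "f \<in> smooth_functions M U" "\<And>q. q \<in> U \<Longrightarrow> f q \<noteq> 0"
  shows "(\<lambda>q. inverse (f q)) \<in> smooth_functions M U"
  by (rule smooth_functionsI, rule smooth_on_inverse)
    (use assms in \<open>auto simp: chart_image_Int_open U smooth_functionsD chart_inv\<close>)

lemma smooth_functions_sum:
  "(\<And>i. i \<in> I \<Longrightarrow> f i \<in> smooth_functions M U) \<Longrightarrow> (\<lambda>q. \<Sum>i\<in>I. f i q) \<in> smooth_functions M U"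
  by (induction I rule: infinite_finite_induct) (auto intro: smooth_functions_const smooth_functions_add)

lemma smooth_functions_prod:
  "(\<And>i. i \<in> I \<Longrightarrow> f i \<in> smooth_functions M U) \<Longrightarrow> (\<lambda>q. \<Prod>i\<in>I. f i q) \<in> smooth_functions M U"
  by (induction I rule: infinite_finite_induct) (auto intro: smooth_functions_const smooth_functions_mult)

text \<open>Smoothness in a single chart is enough, because the transition maps are smooth.\<close>

lemma smooth_functions_chart:
  assumes K: "(D, \<phi>) \<in> M" and "U \<subseteq> D" and F: "smooth_on (\<phi> ` U) F"
  shows "(\<lambda>q. F (\<phi> q)) \<in> smooth_functions M U"
proof (rule smooth_functionsI)
  fix D' \<phi>' assume K': "(D', \<phi>') \<in> M"
  show "smooth_on (\<phi>' ` (D' \<inter> U)) (\<lambda>x. F (\<phi> (inv_into D' \<phi>' x)))"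
  proof (rule smooth_on_compose[OF _ _ _ F])
    show "open (\<phi>' ` (D' \<inter> U))" using K' U chart_image_Int_open by blast
    show "open (\<phi> ` U)" using chart_image_open[OF K opensD(1)[OF U]] assms(2) by blast
    show "(\<lambda>x. \<phi> (inv_into D' \<phi>' x)) ` \<phi>' ` (D' \<inter> U) \<subseteq> \<phi> ` U" by (auto simp: chart_inv[OF K'])
    show "smooth_on (\<phi>' ` (D' \<inter> U)) (\<lambda>x. \<phi> (inv_into D' \<phi>' x))"
      by (rule smooth_on_subset[OF transition_smooth[OF K' K]]) (use assms(2) in auto)
  qed
qed

lemma coordinate_smooth:
  assumes "(D, \<phi>) \<in> M" and "U \<subseteq> D" shows "(\<lambda>q. \<phi> q \<bullet> b) \<in> smooth_functions M U"
  by (rule smooth_functions_chart[OF assms, of "\<lambda>x. x \<bullet> b"])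
    (use assms in \<open>auto intro!: smooth_on_bounded_linear bounded_linear_inner_left chart_image_open opensD U\<close>)

end

lemma smooth_nearI: "U \<in> opens M \<Longrightarrow> p \<in> U \<Longrightarrow> f \<in> smooth_functions M U \<Longrightarrow> f \<in> smooth_near M p"
  by (auto simp: smooth_near_def)

lemma smooth_nearE:
  assumes "f \<in> smooth_near M p" "open W" "p \<in> W"
  obtains U where "U \<in> opens M" "p \<in> U" "U \<subseteq> W" "f \<in> smooth_functions M U"
proof -
  from assms(1) obtain U where U: "U \<in> opens M" "p \<in> U" "f \<in> smooth_functions M U"
    by (auto simp: smooth_near_def)
  show ?thesis
    by (rule that[of "U \<inter> W"]) (use U assms in \<open>auto intro: opens_subset smooth_functions_subset opensD\<close>)
qed

lemma smooth_near_binary: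
  assumes "f \<in> smooth_near M p" "h \<in> smooth_near M p"
  obtains U where "U \<in> opens M" "p \<in> U" "f \<in> smooth_functions M U" "h \<in> smooth_functions M U"
proof -
  from assms(1) obtain U where U: "U \<in> opens M" "p \<in> U" "f \<in> smooth_functions M U"
    by (auto simp: smooth_near_def)
  from smooth_nearE[OF assms(2) opensD(1)[OF U(1)] U(2)] show ?thesis
    using U that smooth_functions_subset by metis
qed

lemma smooth_near_add: "f \<in> smooth_near M p \<Longrightarrow> h \<in> smooth_near M p \<Longrightarrow> (\<lambda>q. f q + h q) \<in> smooth_near M p"
  by (erule smooth_near_binary, assumption) (auto intro: smooth_nearI smooth_functions_add)

lemma smooth_near_mult: "f \<in> smooth_near M p \<Longrightarrow> h \<in> smooth_near M p \<Longrightarrow> (\<lambda>q. f q * h q) \<in> smooth_near M p"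
  by (erule smooth_near_binary, assumption) (auto intro: smooth_nearI smooth_functions_mult)

lemma smooth_near_const: "p \<in> carrier M \<Longrightarrow> (\<lambda>q. a) \<in> smooth_near M p"
  using smooth_nearI[OF carrier_opens _ smooth_functions_const] .

lemma smooth_near_carrier: "f \<in> smooth_near M p \<Longrightarrow> p \<in> carrier M"
  by (auto simp: smooth_near_def opens_def)

lemma smooth_near_diff: "f \<in> smooth_near M p \<Longrightarrow> h \<in> smooth_near M p \<Longrightarrow> (\<lambda>q. f q - h q) \<in> smooth_near M p"
  by (erule smooth_near_binary, assumption) (auto intro: smooth_nearI smooth_functions_diff)

lemma smooth_near_sum:
  "p \<in> carrier M \<Longrightarrow> (\<And>i. i \<in> I \<Longrightarrow> f i \<in> smooth_near M p) \<Longrightarrow> (\<lambda>q. \<Sum>i\<in>I. f i q) \<in> smooth_near M p"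
  by (induction I rule: infinite_finite_induct) (auto intro: smooth_near_const smooth_near_add)

lemma smooth_near_cong:
  assumes "f \<in> smooth_near M p" "open V" "p \<in> V" "\<And>q. q \<in> V \<Longrightarrow> f q = h q"
  shows "h \<in> smooth_near M p"
proof -
  obtain U where "U \<in> opens M" "p \<in> U" "U \<subseteq> V" "f \<in> smooth_functions M U"
    using smooth_nearE[OF assms(1-3)] .
  then show ?thesis using smooth_functions_cong[of f U h] assms(4) smooth_nearI by (metis subsetD)
qed

lemma tangent_add:
  "v \<in> tangent_space M p \<Longrightarrow> f \<in> smooth_near M p \<Longrightarrow> h \<in> smooth_near M p \<Longrightarrow> v (\<lambda>q. f q + h q) = v f + v h"
  by (auto simp: tangent_space_def plus_fun_def)

lemma tangent_mult:
  "v \<in> tangent_space M p \<Longrightarrow> f \<in> smooth_near M p \<Longrightarrow> h \<in> smooth_near M p \<Longrightarrow>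
    v (\<lambda>q. f q * h q) = f p * v h + h p * v f"
  by (auto simp: tangent_space_def times_fun_def)

lemma tangent_cmult: "v \<in> tangent_space M p \<Longrightarrow> f \<in> smooth_near M p \<Longrightarrow> v (\<lambda>q. a * f q) = a * v f"
  by (auto simp: tangent_space_def)

lemma tangent_off: "v \<in> tangent_space M p \<Longrightarrow> f \<notin> smooth_near M p \<Longrightarrow> v f = 0"
  by (auto simp: tangent_space_def)

text \<open>Tangent vectors vanish on functions that are not smooth, so that locality holds for all functions.\<close>

lemma tangent_cong:
  assumes "v \<in> tangent_space M p" "open V" "p \<in> V" "\<And>q. q \<in> V \<Longrightarrow> f q = h q"
  shows "v f = v h"
proof (cases "f \<in> smooth_near M p")
  case True
  moreover have "\<forall>\<^sub>F q in nhds p. f q = h q" using assms(2-4) eventually_nhds by blast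
  ultimately show ?thesis using assms(1) unfolding tangent_space_def by blast
next
  case False
  then have "h \<notin> smooth_near M p" using smooth_near_cong[of h p V f] assms by auto
  with False show ?thesis using tangent_off[OF assms(1)] by simp
qed

lemma tangent_const:
  assumes "v \<in> tangent_space M p" "p \<in> carrier M" shows "v (\<lambda>q. a) = 0"
proof -
  \<comment> \<open>The Leibniz rule for \<open>1 = 1 * 1\<close>.\<close>
  have "v (\<lambda>q. 1) = v (\<lambda>q. 1 * 1)" by simp
  also have "\<dots> = v (\<lambda>q. 1) + v (\<lambda>q. 1)"
    using tangent_mult[OF assms(1) smooth_near_const smooth_near_const, of 1 1] assms(2) by simp
  finally have "v (\<lambda>q. 1) = 0" by simp
  then show ?thesis using tangent_cmult[OF assms(1) smooth_near_const[OF assms(2)], of a 1] by simp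
qed

lemma tangent_diff:
  "v \<in> tangent_space M p \<Longrightarrow> f \<in> smooth_near M p \<Longrightarrow> h \<in> smooth_near M p \<Longrightarrow> v (\<lambda>q. f q - h q) = v f - v h"
  using tangent_add[of v p f "\<lambda>q. (-1) * h q"] tangent_cmult[of v p h "-1"]
    smooth_near_mult[OF smooth_near_const[OF smooth_near_carrier[of h p]], of h "-1"] by simp

lemma tangent_sum:
  assumes "v \<in> tangent_space M p" "p \<in> carrier M" "\<And>i. i \<in> I \<Longrightarrow> f i \<in> smooth_near M p"
  shows "v (\<lambda>q. \<Sum>i\<in>I. f i q) = (\<Sum>i\<in>I. v (f i))"
  using assms(3)
proof (induction I rule: infinite_finite_induct)
  case (insert i I)
  then show ?case
    using tangent_add[OF assms(1), of "f i" "\<lambda>q. \<Sum>i\<in>I. f i q"] smooth_near_sum[OF assms(2), of I f] by simp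
qed (simp_all add: tangent_const[OF assms(1,2)])

lemma tangent_spaceI:
  assumes "\<And>f h. f \<in> smooth_near M p \<Longrightarrow> h \<in> smooth_near M p \<Longrightarrow> v (\<lambda>q. f q + h q) = v f + v h"
    and "\<And>f a. f \<in> smooth_near M p \<Longrightarrow> v (\<lambda>q. a * f q) = a * v f"
    and "\<And>f h. f \<in> smooth_near M p \<Longrightarrow> h \<in> smooth_near M p \<Longrightarrow> v (\<lambda>q. f q * h q) = f p * v h + h p * v f"
    and "\<And>f h V. f \<in> smooth_near M p \<Longrightarrow> h \<in> smooth_near M p \<Longrightarrow> open V \<Longrightarrow> p \<in> V \<Longrightarrow>
      (\<And>q. q \<in> V \<Longrightarrow> f q = h q) \<Longrightarrow> v f = v h"
    and "\<And>f. f \<notin> smooth_near M p \<Longrightarrow> v f = 0"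
  shows "v \<in> tangent_space M p"
proof -
  have "v f = v h" if "f \<in> smooth_near M p" "\<forall>\<^sub>F q in nhds p. f q = h q" for f h
  proof -
    from that(2) obtain V where V: "open V" "p \<in> V" "\<And>q. q \<in> V \<Longrightarrow> f q = h q"
      by (auto simp: eventually_nhds)
    then show ?thesis using assms(4)[OF that(1) smooth_near_cong[OF that(1) V] V] by simp
  qed
  with assms(1,2,3,5) show ?thesis
    unfolding tangent_space_def plus_fun_def times_fun_def by simp
qed

lemma tangent_space_0: "0 \<in> tangent_space M p"
  by (rule tangent_spaceI) auto

lemma tangent_space_add:
  "u \<in> tangent_space M p \<Longrightarrow> v \<in> tangent_space M p \<Longrightarrow> u + v \<in> tangent_space M p"
proof (rule tangent_spaceI, goal_cases)
  case (4 f h V)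
  then show ?case using tangent_cong[of u p V f h] tangent_cong[of v p V f h] by simp
qed (simp_all add: tangent_add tangent_mult tangent_cmult tangent_off algebra_simps)

lemma tangent_space_cmult:
  "u \<in> tangent_space M p \<Longrightarrow> (\<lambda>f. a * u f) \<in> tangent_space M p"
proof (rule tangent_spaceI, goal_cases)
  case (4 f h V)
  then show ?case using tangent_cong[of u p V f h] by simp
qed (simp_all add: tangent_add tangent_mult tangent_cmult tangent_off algebra_simps)

lemma tangent_space_sum:
  assumes "\<And>i. i \<in> I \<Longrightarrow> v i \<in> tangent_space M p" shows "(\<lambda>f. \<Sum>i\<in>I. v i f) \<in> tangent_space M p"
  using assms
proof (induction I rule: infinite_finite_induct)
  case (insert i I)
  then show ?case using tangent_space_add[of "v i" p "\<lambda>f. \<Sum>i\<in>I. v i f"] by (simp add: plus_fun_def)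
qed (use tangent_space_0 in \<open>auto simp: zero_fun_def\<close>)

text \<open>The partial derivative at \<open>p\<close> in the direction \<open>b\<close> in the coordinates \<open>\<phi>\<close>.\<close>

definition coord_deriv :: "'m set \<Rightarrow> ('m \<Rightarrow> 'e) \<Rightarrow> 'm \<Rightarrow> 'e \<Rightarrow> 'm tangent_vector" where
  "coord_deriv D \<phi> p b = (\<lambda>f. if f \<in> smooth_near M p
     then frechet_derivative (\<lambda>x. f (inv_into D \<phi> x)) (at (\<phi> p)) b else 0)"

lemma smooth_near_has_derivative:
  assumes "(D, \<phi>) \<in> M" "p \<in> D" "f \<in> smooth_near M p"
  shows "((\<lambda>x. f (inv_into D \<phi> x)) has_derivative
    frechet_derivative (\<lambda>x. f (inv_into D \<phi> x)) (at (\<phi> p))) (at (\<phi> p))"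
proof -
  obtain U where "U \<in> opens M" "p \<in> U" "U \<subseteq> D" "f \<in> smooth_functions M U"
    using smooth_nearE[OF assms(3) chart_open[OF assms(1)] assms(2)] .
  then show ?thesis
    by (intro smooth_on_has_derivative[OF smooth_functionsD[OF _ assms(1)]]) auto
qed

lemma coord_deriv_tangent:
  assumes K: "(D, \<phi>) \<in> M" "p \<in> D"
  shows "coord_deriv D \<phi> p b \<in> tangent_space M p"
proof -
  note d = smooth_near_has_derivative[OF K]
  have p: "p \<in> carrier M" using K chart_opens opensD(2) by blast
  have eqI: "coord_deriv D \<phi> p b f = L b"
    if "f \<in> smooth_near M p" "((\<lambda>x. f (inv_into D \<phi> x)) has_derivative L) (at (\<phi> p))" for f L
    using that frechet_derivative_at[OF that(2)] by (simp add: coord_deriv_def)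
  have eq: "coord_deriv D \<phi> p b f = frechet_derivative (\<lambda>x. f (inv_into D \<phi> x)) (at (\<phi> p)) b"
    if "f \<in> smooth_near M p" for f
    using that by (simp add: coord_deriv_def)
  show ?thesis
  proof (rule tangent_spaceI)
    fix f h assume f: "f \<in> smooth_near M p" and h: "h \<in> smooth_near M p"
    show "coord_deriv D \<phi> p b (\<lambda>q. f q + h q) = coord_deriv D \<phi> p b f + coord_deriv D \<phi> p b h"
      using eqI[OF smooth_near_add[OF f h] has_derivative_add[OF d[OF f] d[OF h]]] eq f h by simp
    show "coord_deriv D \<phi> p b (\<lambda>q. f q * h q) = f p * coord_deriv D \<phi> p b h + h p * coord_deriv D \<phi> p b f"
      using eqI[OF smooth_near_mult[OF f h] has_derivative_mult[OF d[OF f] d[OF h]]] eq f h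
      by (simp add: chart_inv[OF K])
  next
    fix f a assume f: "f \<in> smooth_near M p"
    show "coord_deriv D \<phi> p b (\<lambda>q. a * f q) = a * coord_deriv D \<phi> p b f"
      using eqI[OF smooth_near_mult[OF smooth_near_const[OF p] f] has_derivative_mult_right[OF d[OF f]]] eq f by simp
  next
    fix f h V assume f: "f \<in> smooth_near M p" and h: "h \<in> smooth_near M p"
      and V: "open V" "p \<in> V" "\<And>q. q \<in> V \<Longrightarrow> f q = h q"
    have "open (\<phi> ` (D \<inter> V))" using chart_image_open[OF K(1)] V(1) chart_open[OF K(1)] by blast
    then have "((\<lambda>x. h (inv_into D \<phi> x)) has_derivative
        frechet_derivative (\<lambda>x. f (inv_into D \<phi> x)) (at (\<phi> p))) (at (\<phi> p))"
      by (rule has_derivative_transform_within_open[OF d[OF f]]) (use V K in \<open>auto simp: chart_inv[OF K(1)]\<close>)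
    then show "coord_deriv D \<phi> p b f = coord_deriv D \<phi> p b h" using eqI[OF h] eq f by simp
  qed (simp add: coord_deriv_def)
qed

text \<open>The coordinate derivations span: by Hadamard's lemma, a smooth function differs from its value
  at the point by a combination of the coordinates with smooth coefficients, and a derivation sees
  of these coefficients only the values at the point, which are the partial derivatives.\<close>

lemma tangent_vector_coordinates:
  assumes K: "(D, \<phi>) \<in> M" "p \<in> D" and v: "v \<in> tangent_space M p"
  shows "v = (\<lambda>f. \<Sum>b\<in>Basis. v (\<lambda>q. \<phi> q \<bullet> b) * coord_deriv D \<phi> p b f)"
proof
  fix f
  have p: "p \<in> carrier M" using K chart_opens opensD(2) by blast
  show "v f = (\<Sum>b\<in>Basis. v (\<lambda>q. \<phi> q \<bullet> b) * coord_deriv D \<phi> p b f)"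
  proof (cases "f \<in> smooth_near M p")
    case False
    then show ?thesis using tangent_off[OF v] by (simp add: coord_deriv_def)
  next
    case True
    then obtain U where U: "U \<in> opens M" "p \<in> U" "U \<subseteq> D" "f \<in> smooth_functions M U"
      using smooth_nearE[OF _ chart_open[OF K(1)] K(2)] by blast
    let ?F = "\<lambda>x. f (inv_into D \<phi> x)"
    have "open (\<phi> ` U)" using chart_image_open[OF K(1) opensD(1)[OF U(1)] U(3)] .
    then obtain r where r: "r > 0" "ball (\<phi> p) r \<subseteq> \<phi> ` U" using U(2) open_contains_ball by blast
    have "smooth_on (\<phi> ` U) ?F" using smooth_functionsD[OF U(4) K(1)] U(3) by (simp add: Int_absorb1)
    then have "smooth_on (ball (\<phi> p) r) ?F" using r(2) smooth_on_subset by blast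
    then obtain G where G: "\<And>b. smooth_on (ball (\<phi> p) r) (G b)"
      "\<And>x. x \<in> ball (\<phi> p) r \<Longrightarrow> ?F x = ?F (\<phi> p) + (\<Sum>b\<in>Basis. (x \<bullet> b - \<phi> p \<bullet> b) * G b x)"
      "\<And>b. G b (\<phi> p) = frechet_derivative ?F (at (\<phi> p)) b"
      using Hadamard by blast
    define V where "V = {q \<in> D. \<phi> q \<in> ball (\<phi> p) r}"
    have V: "open V" "p \<in> V" "V \<subseteq> D"
      unfolding V_def using chart_preimage_open[OF K(1) open_ball] K r(1) by auto
    have VM: "V \<in> opens M" using V chart_opens[OF K(1)] opens_subset by blast
    have "G b \<circ> \<phi> \<in> smooth_functions M V" for b
      using smooth_functions_chart[OF VM K(1) V(3) smooth_on_subset[OF G(1)]] by (force simp: V_def comp_def)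
    then have Gn: "(\<lambda>q. G b (\<phi> q)) \<in> smooth_near M p" for b
      using smooth_nearI[OF VM V(2)] by (simp add: comp_def)
    have xn: "(\<lambda>q. \<phi> q \<bullet> b) \<in> smooth_near M p" for b
      using smooth_nearI[OF VM V(2) coordinate_smooth[OF VM K(1) V(3)]] .
    have xcn: "(\<lambda>q. \<phi> q \<bullet> b - \<phi> p \<bullet> b) \<in> smooth_near M p" for b
      using smooth_near_diff[OF xn smooth_near_const[OF p]] .
    have "v f = v (\<lambda>q. f p + (\<Sum>b\<in>Basis. (\<phi> q \<bullet> b - \<phi> p \<bullet> b) * G b (\<phi> q)))"
    proof (rule tangent_cong[OF v V(1,2)])
      fix q assume "q \<in> V"
      then show "f q = f p + (\<Sum>b\<in>Basis. (\<phi> q \<bullet> b - \<phi> p \<bullet> b) * G b (\<phi> q))"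
        using G(2)[of "\<phi> q"] K by (simp add: V_def chart_inv[OF K(1)])
    qed
    also have "\<dots> = (\<Sum>b\<in>Basis. v (\<lambda>q. (\<phi> q \<bullet> b - \<phi> p \<bullet> b) * G b (\<phi> q)))"
    proof -
      have pn: "(\<lambda>q. (\<phi> q \<bullet> b - \<phi> p \<bullet> b) * G b (\<phi> q)) \<in> smooth_near M p" for b
        using smooth_near_mult[OF xcn Gn] .
      show ?thesis
        by (subst tangent_add[OF v smooth_near_const[OF p] smooth_near_sum[OF p pn]])
          (simp add: tangent_const[OF v p] tangent_sum[OF v p pn])
    qed
    also have "\<dots> = (\<Sum>b\<in>Basis. v (\<lambda>q. \<phi> q \<bullet> b) * coord_deriv D \<phi> p b f)"
    proof (rule sum.cong[OF refl])
      fix b :: 'e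
      have "v (\<lambda>q. \<phi> q \<bullet> b - \<phi> p \<bullet> b) = v (\<lambda>q. \<phi> q \<bullet> b)"
        using tangent_diff[OF v xn smooth_near_const[OF p]] tangent_const[OF v p] by simp
      then show "v (\<lambda>q. (\<phi> q \<bullet> b - \<phi> p \<bullet> b) * G b (\<phi> q)) = v (\<lambda>q. \<phi> q \<bullet> b) * coord_deriv D \<phi> p b f"
        using tangent_mult[OF v xcn Gn] G(3) True by (simp add: coord_deriv_def)
    qed
    finally show ?thesis .
  qed
qed

end

section \<open>Vector fields\<close>

context manifold
begin

lemma vector_fieldsI:
  assumes "\<And>p. p \<in> U \<Longrightarrow> X p \<in> tangent_space M p" "\<And>p. p \<notin> U \<Longrightarrow> X p = 0"
    and "\<And>V f. V \<in> opens M \<Longrightarrow> V \<subseteq> U \<Longrightarrow> f \<in> smooth_functions M V \<Longrightarrow> (\<lambda>p. X p f) \<in> smooth_functions M V"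
  shows "X \<in> vector_fields M U"
  using assms by (auto simp: vector_fields_def)

lemma vf_tangent: "X \<in> vector_fields M U \<Longrightarrow> p \<in> U \<Longrightarrow> X p \<in> tangent_space M p"
  by (auto simp: vector_fields_def)

lemma vf_outside: "X \<in> vector_fields M U \<Longrightarrow> p \<notin> U \<Longrightarrow> X p = 0"
  by (auto simp: vector_fields_def)

lemma vf_smooth:
  "X \<in> vector_fields M U \<Longrightarrow> V \<in> opens M \<Longrightarrow> V \<subseteq> U \<Longrightarrow> f \<in> smooth_functions M V \<Longrightarrow>
    (\<lambda>p. X p f) \<in> smooth_functions M V"
  by (auto simp: vector_fields_def)

lemma vf_eqI:
  assumes "X \<in> vector_fields M U" "Y \<in> vector_fields M U" "\<And>p. p \<in> U \<Longrightarrow> X p = Y p"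
  shows "X = Y"
  using assms vf_outside by (metis ext)

lemma vf_near:
  assumes "X \<in> vector_fields M U" "U \<in> opens M" "p \<in> U" "f \<in> smooth_near M p"
  shows "(\<lambda>q. X q f) \<in> smooth_near M p"
proof -
  obtain V where "V \<in> opens M" "p \<in> V" "V \<subseteq> U" "f \<in> smooth_functions M V"
    using smooth_nearE[OF assms(4) opensD(1)[OF assms(2)] assms(3)] .
  then show ?thesis using vf_smooth[OF assms(1)] smooth_nearI by blast
qed

lemma vf_0: "0 \<in> vector_fields M U"
  by (rule vector_fieldsI) (auto simp: tangent_space_0 smooth_functions_const)

lemma vf_add: "X \<in> vector_fields M U \<Longrightarrow> Y \<in> vector_fields M U \<Longrightarrow> X + Y \<in> vector_fields M U"
  by (rule vector_fieldsI)
    (auto simp: vf_tangent tangent_space_add vf_outside vf_smooth intro!: smooth_functions_add)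

lemma vf_scale:
  "h \<in> smooth_functions M U \<Longrightarrow> X \<in> vector_fields M U \<Longrightarrow> scale_vf h X \<in> vector_fields M U"
  by (rule vector_fieldsI)
    (auto simp: scale_vf_def vf_tangent tangent_space_cmult vf_outside vf_smooth zero_fun_def
      intro!: smooth_functions_mult intro: smooth_functions_subset)

lemma minus_vf_eq: "- X = scale_vf (\<lambda>_. - 1) X" for X :: "'m vector_field"
  by (simp add: scale_vf_def fun_eq_iff)

lemma vf_minus: "X \<in> vector_fields M U \<Longrightarrow> - X \<in> vector_fields M U"
  unfolding minus_vf_eq by (rule vf_scale[OF smooth_functions_const])

lemma vf_diff: "X \<in> vector_fields M U \<Longrightarrow> Y \<in> vector_fields M U \<Longrightarrow> X - Y \<in> vector_fields M U"
  using vf_add[OF _ vf_minus[of Y], of X] by simp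

lemma vf_sum:
  "(\<And>i. i \<in> I \<Longrightarrow> X i \<in> vector_fields M U) \<Longrightarrow> (\<lambda>p f. \<Sum>i\<in>I. X i p f) \<in> vector_fields M U"
proof (induction I rule: infinite_finite_induct)
  case (insert i I)
  then show ?case using vf_add[of "X i" U "\<lambda>p f. \<Sum>i\<in>I. X i p f"] by (simp add: plus_fun_def)
qed (use vf_0 in \<open>auto simp: zero_fun_def\<close>)

lemma vf_restrict:
  assumes "X \<in> vector_fields M U" "V \<subseteq> U" shows "restrict_vf V X \<in> vector_fields M V"
proof (rule vector_fieldsI)
  fix W f assume W: "W \<in> opens M" "W \<subseteq> V" "f \<in> smooth_functions M W"
  show "(\<lambda>p. restrict_vf V X p f) \<in> smooth_functions M W"
    by (rule smooth_functions_cong[OF vf_smooth[OF assms(1) W(1) _ W(3)] W(1)])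
      (use W assms in \<open>auto simp: restrict_vf_def\<close>)
qed (use assms in \<open>auto simp: restrict_vf_def vf_tangent\<close>)

text \<open>Being a smooth vector field is a local property; this serves to glue vector fields.\<close>

lemma vf_local:
  assumes "U \<in> opens M" "\<And>p. p \<notin> U \<Longrightarrow> X p = 0"
    and loc: "\<And>p. p \<in> U \<Longrightarrow> \<exists>V\<in>opens M. p \<in> V \<and> (\<exists>Y\<in>vector_fields M V. \<forall>q\<in>V. X q = Y q)"
  shows "X \<in> vector_fields M U"
proof (rule vector_fieldsI)
  show "X p \<in> tangent_space M p" if "p \<in> U" for p
    using loc[OF that] vf_tangent by force
  fix V f assume V: "V \<in> opens M" "V \<subseteq> U" "f \<in> smooth_functions M V"
  show "(\<lambda>p. X p f) \<in> smooth_functions M V"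
  proof (rule smooth_functions_local[OF V(1)])
    fix p assume "p \<in> V"
    then obtain V' Y where V': "V' \<in> opens M" "p \<in> V'" "Y \<in> vector_fields M V'" "\<And>q. q \<in> V' \<Longrightarrow> X q = Y q"
      using loc V(2) by blast
    have I: "V' \<inter> V \<in> opens M" using opens_Int[OF V'(1) V(1)] .
    have "(\<lambda>p. X p f) \<in> smooth_functions M (V' \<inter> V)"
      by (rule smooth_functions_cong[OF vf_smooth[OF V'(3) I _ smooth_functions_subset[OF V(3)]] I])
        (use V' in auto)
    with I show "\<exists>V\<in>opens M. p \<in> V \<and> (\<lambda>p. X p f) \<in> smooth_functions M V"
      using \<open>p \<in> V\<close> V'(2) by blast
  qed
qed (use assms in auto)

lemma lie_bracket_apply:
  "f \<in> smooth_near M p \<Longrightarrow> lie_bracket M X Y p f = X p (\<lambda>q. Y q f) - Y p (\<lambda>q. X q f)"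
  by (simp add: lie_bracket_def)

lemma lie_bracket_antisym: "lie_bracket M X Y = - lie_bracket M Y X"
  by (simp add: lie_bracket_def fun_eq_iff)

lemma lie_bracket_cong:
  assumes "open V" "p \<in> V" "\<And>q. q \<in> V \<Longrightarrow> X q = X' q" "\<And>q. q \<in> V \<Longrightarrow> Y q = Y' q"
    and "X p \<in> tangent_space M p" "Y p \<in> tangent_space M p"
  shows "lie_bracket M X Y p = lie_bracket M X' Y' p"
proof
  fix f
  have "X p (\<lambda>q. Y q f) = X p (\<lambda>q. Y' q f)"
    by (rule tangent_cong[OF assms(5,1,2)]) (simp add: assms(4))
  moreover have "Y p (\<lambda>q. X q f) = Y p (\<lambda>q. X' q f)"
    by (rule tangent_cong[OF assms(6,1,2)]) (simp add: assms(3))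
  ultimately show "lie_bracket M X Y p f = lie_bracket M X' Y' p f"
    using assms(2-4) by (simp add: lie_bracket_def)
qed

context
  fixes U assumes U: "U \<in> opens M"
begin

lemma vf_iterate_add:
  assumes X: "X \<in> vector_fields M U" and Y: "Y \<in> vector_fields M U" and "p \<in> U"
    and f: "f \<in> smooth_near M p" and h: "h \<in> smooth_near M p"
  shows "X p (\<lambda>q. Y q (\<lambda>r. f r + h r)) = X p (\<lambda>q. Y q f) + X p (\<lambda>q. Y q h)"
proof -
  obtain W where W: "W \<in> opens M" "p \<in> W" "f \<in> smooth_functions M W" "h \<in> smooth_functions M W"
    using smooth_near_binary[OF f h] .
  have "X p (\<lambda>q. Y q (\<lambda>r. f r + h r)) = X p (\<lambda>q. Y q f + Y q h)"
    by (rule tangent_cong[OF vf_tangent[OF X \<open>p \<in> U\<close>], of "W \<inter> U"])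
      (use W U \<open>p \<in> U\<close> in \<open>auto intro!: tangent_add[OF vf_tangent[OF Y]] smooth_nearI[of W] simp: opensD\<close>)
  then show ?thesis
    using tangent_add[OF vf_tangent[OF X \<open>p \<in> U\<close>] vf_near[OF Y U \<open>p \<in> U\<close> f] vf_near[OF Y U \<open>p \<in> U\<close> h]]
    by simp
qed

text \<open>The terms with one derivative on each factor are symmetric in \<open>X\<close> and \<open>Y\<close>. They cancel in the
  commutator, which is why the bracket is again a derivation.\<close>

lemma vf_iterate_mult:
  assumes X: "X \<in> vector_fields M U" and Y: "Y \<in> vector_fields M U" and p: "p \<in> U"
    and f: "f \<in> smooth_near M p" and h: "h \<in> smooth_near M p"
  shows "X p (\<lambda>q. Y q (\<lambda>r. f r * h r)) =
    f p * X p (\<lambda>q. Y q h) + Y p h * X p f + (h p * X p (\<lambda>q. Y q f) + Y p f * X p h)"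
proof -
  obtain W where W: "W \<in> opens M" "p \<in> W" "f \<in> smooth_functions M W" "h \<in> smooth_functions M W"
    using smooth_near_binary[OF f h] .
  note Xp = vf_tangent[OF X p] and Yf = vf_near[OF Y U p f] and Yh = vf_near[OF Y U p h]
  have "X p (\<lambda>q. Y q (\<lambda>r. f r * h r)) = X p (\<lambda>q. f q * Y q h + h q * Y q f)"
    by (rule tangent_cong[OF Xp, of "W \<inter> U"])
      (use W U p in \<open>auto intro!: tangent_mult[OF vf_tangent[OF Y]] smooth_nearI[of W] simp: opensD\<close>)
  then show ?thesis
    using tangent_add[OF Xp smooth_near_mult[OF f Yh] smooth_near_mult[OF h Yf]]
      tangent_mult[OF Xp f Yh] tangent_mult[OF Xp h Yf] by simp
qed

lemma vf_lie_bracket: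
  assumes X: "X \<in> vector_fields M U" and Y: "Y \<in> vector_fields M U"
  shows "lie_bracket M X Y \<in> vector_fields M U"
proof (rule vector_fieldsI)
  fix p assume p: "p \<in> U"
  show "lie_bracket M X Y p \<in> tangent_space M p"
  proof (rule tangent_spaceI)
    fix f h assume fh: "f \<in> smooth_near M p" "h \<in> smooth_near M p"
    show "lie_bracket M X Y p (\<lambda>q. f q + h q) = lie_bracket M X Y p f + lie_bracket M X Y p h"
      using fh by (simp add: lie_bracket_apply smooth_near_add vf_iterate_add[OF X Y p] vf_iterate_add[OF Y X p])
    show "lie_bracket M X Y p (\<lambda>q. f q * h q) = f p * lie_bracket M X Y p h + h p * lie_bracket M X Y p f"
      using fh by (simp add: lie_bracket_apply smooth_near_mult vf_iterate_mult[OF X Y p] vf_iterate_mult[OF Y X p]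
          algebra_simps)
  next
    fix f a assume f: "f \<in> smooth_near M p"
    have c: "(\<lambda>q. a) \<in> smooth_near M p" using f smooth_near_carrier smooth_near_const by blast
    have z: "Z p (\<lambda>q. a) = 0" "Z' p (\<lambda>q. Z q (\<lambda>q. a)) = 0"
      if Z: "Z \<in> vector_fields M U" and Z': "Z' \<in> vector_fields M U" for Z Z' :: "'m vector_field"
    proof -
      have z: "Z q (\<lambda>q. a) = 0" if "q \<in> U" for q
        using tangent_const[OF vf_tangent[OF Z that]] opensD(2)[OF U] that by blast
      then show "Z p (\<lambda>q. a) = 0" using p by simp
      have "Z' p (\<lambda>q. Z q (\<lambda>q. a)) = Z' p (\<lambda>q. 0)"
        by (rule tangent_cong[OF vf_tangent[OF Z' p] opensD(1)[OF U] p]) (rule z)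
      then show "Z' p (\<lambda>q. Z q (\<lambda>q. a)) = 0"
        using tangent_const[OF vf_tangent[OF Z' p]] smooth_near_carrier[OF f] by simp
    qed
    show "lie_bracket M X Y p (\<lambda>q. a * f q) = a * lie_bracket M X Y p f"
      using f c smooth_near_mult[OF c f] z[OF X Y] z[OF Y X]
      by (simp add: lie_bracket_apply vf_iterate_mult[OF X Y p] vf_iterate_mult[OF Y X p] algebra_simps)
  next
    fix f h V assume f: "f \<in> smooth_near M p" and h: "h \<in> smooth_near M p"
      and V: "open V" "p \<in> V" "\<And>q. q \<in> V \<Longrightarrow> f q = h q"
    have eq: "Z q f = Z q h" if "Z \<in> vector_fields M U" "q \<in> V \<inter> U" for Z :: "'m vector_field" and q
      by (rule tangent_cong[OF vf_tangent[OF that(1)] V(1)]) (use V(3) that(2) in auto)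
    have it: "Z' p (\<lambda>q. Z q f) = Z' p (\<lambda>q. Z q h)"
      if "Z \<in> vector_fields M U" "Z' \<in> vector_fields M U" for Z Z' :: "'m vector_field"
      by (rule tangent_cong[OF vf_tangent[OF that(2) p], of "V \<inter> U"])
        (use V(1,2) p that eq U opensD(1) in auto)
    show "lie_bracket M X Y p f = lie_bracket M X Y p h"
      using f h by (simp add: lie_bracket_apply it[OF X Y] it[OF Y X])
  qed (simp add: lie_bracket_def)
next
  fix p assume "p \<notin> U"
  then show "lie_bracket M X Y p = 0" using X Y by (auto simp: lie_bracket_def vf_outside fun_eq_iff)
next
  fix V f assume V: "V \<in> opens M" "V \<subseteq> U" "f \<in> smooth_functions M V"
  have "(\<lambda>p. X p (\<lambda>q. Y q f) - Y p (\<lambda>q. X q f)) \<in> smooth_functions M V"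
    by (intro smooth_functions_diff[OF V(1)] vf_smooth[OF X] vf_smooth[OF Y] V)
  then show "(\<lambda>p. lie_bracket M X Y p f) \<in> smooth_functions M V"
    by (rule smooth_functions_cong[OF _ V(1)]) (simp add: lie_bracket_apply smooth_nearI[OF V(1) _ V(3)])
qed

lemma lie_bracket_add_left:
  assumes X: "X \<in> vector_fields M U" and Y: "Y \<in> vector_fields M U" and Z: "Z \<in> vector_fields M U"
  shows "lie_bracket M (X + Y) Z = lie_bracket M X Z + lie_bracket M Y Z"
proof (rule vf_eqI[OF vf_lie_bracket[OF vf_add[OF X Y] Z] vf_add[OF vf_lie_bracket[OF X Z] vf_lie_bracket[OF Y Z]]])
  fix p assume p: "p \<in> U"
  show "lie_bracket M (X + Y) Z p = (lie_bracket M X Z + lie_bracket M Y Z) p"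
  proof
    fix f
    show "lie_bracket M (X + Y) Z p f = (lie_bracket M X Z + lie_bracket M Y Z) p f"
      using tangent_add[OF vf_tangent[OF Z p] vf_near[OF X U p] vf_near[OF Y U p], of f f]
      by (simp add: lie_bracket_def)
  qed
qed

lemma lie_bracket_add_right:
  assumes X: "X \<in> vector_fields M U" and Y: "Y \<in> vector_fields M U" and Z: "Z \<in> vector_fields M U"
  shows "lie_bracket M X (Y + Z) = lie_bracket M X Y + lie_bracket M X Z"
  using lie_bracket_add_left[OF Y Z X] lie_bracket_antisym[of X] by simp

lemma lie_bracket_scale_right:
  assumes X: "X \<in> vector_fields M U" and Y: "Y \<in> vector_fields M U" and h: "h \<in> smooth_functions M U"
  shows "lie_bracket M X (scale_vf h Y) = scale_vf (\<lambda>p. X p h) Y + scale_vf h (lie_bracket M X Y)"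
proof (rule vf_eqI)
  show "lie_bracket M X (scale_vf h Y) \<in> vector_fields M U"
    by (intro vf_lie_bracket vf_scale h X Y)
  show "scale_vf (\<lambda>p. X p h) Y + scale_vf h (lie_bracket M X Y) \<in> vector_fields M U"
    by (intro vf_add vf_lie_bracket vf_scale h X Y vf_smooth[OF X U order_refl h])
  fix p assume p: "p \<in> U"
  show "lie_bracket M X (scale_vf h Y) p = (scale_vf (\<lambda>p. X p h) Y + scale_vf h (lie_bracket M X Y)) p"
  proof
    fix f
    show "lie_bracket M X (scale_vf h Y) p f = (scale_vf (\<lambda>p. X p h) Y + scale_vf h (lie_bracket M X Y)) p f"
      using tangent_mult[OF vf_tangent[OF X p] smooth_nearI[OF U p h] vf_near[OF Y U p], of f]
        tangent_off[OF vf_tangent[OF Y p]]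
      by (cases "f \<in> smooth_near M p") (simp_all add: lie_bracket_def scale_vf_def algebra_simps)
  qed
qed

lemma lie_bracket_scale_left:
  assumes X: "X \<in> vector_fields M U" and Y: "Y \<in> vector_fields M U" and h: "h \<in> smooth_functions M U"
  shows "lie_bracket M (scale_vf h X) Y = scale_vf h (lie_bracket M X Y) - scale_vf (\<lambda>p. Y p h) X"
  unfolding lie_bracket_antisym[of _ Y] lie_bracket_scale_right[OF Y X h]
  by (simp add: scale_vf_def fun_eq_iff)

lemma lie_bracket_derivation:
  assumes X: "X \<in> vector_fields M U" and Y: "Y \<in> vector_fields M U" and f: "f \<in> smooth_functions M U" and p: "p \<in> U"
  shows "lie_bracket M X Y p f = X p (\<lambda>q. Y q f) - Y p (\<lambda>q. X q f)"
  using lie_bracket_apply[OF smooth_nearI[OF U p f]] .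

lemma vf_bracket_iterate:
  assumes X: "X \<in> vector_fields M U" and Y: "Y \<in> vector_fields M U" and Z: "Z \<in> vector_fields M U"
    and p: "p \<in> U" and f: "f \<in> smooth_near M p"
  shows "X p (\<lambda>q. lie_bracket M Y Z q f) = X p (\<lambda>q. Y q (\<lambda>r. Z r f)) - X p (\<lambda>q. Z q (\<lambda>r. Y r f))"
proof -
  obtain W where W: "W \<in> opens M" "p \<in> W" "W \<subseteq> U" "f \<in> smooth_functions M W"
    using smooth_nearE[OF f opensD(1)[OF U] p] .
  have "X p (\<lambda>q. lie_bracket M Y Z q f) = X p (\<lambda>q. Y q (\<lambda>r. Z r f) - Z q (\<lambda>r. Y r f))"
    by (rule tangent_cong[OF vf_tangent[OF X p] opensD(1)[OF W(1)] W(2)])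
      (simp add: lie_bracket_apply smooth_nearI[OF W(1) _ W(4)])
  then show ?thesis
    using tangent_diff[OF vf_tangent[OF X p] vf_near[OF Y U p vf_near[OF Z U p f]] vf_near[OF Z U p vf_near[OF Y U p f]]]
    by simp
qed

lemma Jacobi:
  assumes X: "X \<in> vector_fields M U" and Y: "Y \<in> vector_fields M U" and Z: "Z \<in> vector_fields M U"
  shows "lie_bracket M X (lie_bracket M Y Z) = lie_bracket M (lie_bracket M X Y) Z + lie_bracket M Y (lie_bracket M X Z)"
proof (rule vf_eqI)
  show "lie_bracket M X (lie_bracket M Y Z) \<in> vector_fields M U"
    by (intro vf_lie_bracket X Y Z)
  show "lie_bracket M (lie_bracket M X Y) Z + lie_bracket M Y (lie_bracket M X Z) \<in> vector_fields M U"
    by (intro vf_add vf_lie_bracket X Y Z)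
  fix p assume p: "p \<in> U"
  show "lie_bracket M X (lie_bracket M Y Z) p =
    (lie_bracket M (lie_bracket M X Y) Z + lie_bracket M Y (lie_bracket M X Z)) p"
  proof
    fix f
    show "lie_bracket M X (lie_bracket M Y Z) p f =
      (lie_bracket M (lie_bracket M X Y) Z + lie_bracket M Y (lie_bracket M X Z)) p f"
    proof (cases "f \<in> smooth_near M p")
      case True
      note n = vf_near[OF X U p True] vf_near[OF Y U p True] vf_near[OF Z U p True]
      show ?thesis
        using True n by (simp add: lie_bracket_apply vf_bracket_iterate[OF X Y Z p]
            vf_bracket_iterate[OF Z X Y p] vf_bracket_iterate[OF Y X Z p])
    qed (simp add: lie_bracket_def)
  qed
qed

end

text \<open>The coordinate fields of a chart form a frame over every open subset of its domain.\<close>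

definition coord_field :: "'m set \<Rightarrow> ('m \<Rightarrow> 'e) \<Rightarrow> 'm set \<Rightarrow> 'e \<Rightarrow> 'm vector_field" where
  "coord_field D \<phi> U b = restrict_vf U (\<lambda>p. coord_deriv D \<phi> p b)"

lemma vf_coord_field:
  assumes K: "(D, \<phi>) \<in> M" and "U \<subseteq> D"
  shows "coord_field D \<phi> U b \<in> vector_fields M U"
proof (rule vector_fieldsI)
  fix V f assume V: "V \<in> opens M" "V \<subseteq> U" "f \<in> smooth_functions M V"
  have VD: "V \<subseteq> D" using V(2) assms(2) by blast
  have "smooth_on (\<phi> ` V) (\<lambda>x. frechet_derivative (\<lambda>x. f (inv_into D \<phi> x)) (at x) b)"
    using smooth_on_frechet_derivative[OF smooth_functionsD[OF V(3) K]] VD by (simp add: Int_absorb1)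
  then show "(\<lambda>p. coord_field D \<phi> U b p f) \<in> smooth_functions M V"
    by (rule smooth_functions_cong[OF smooth_functions_chart[OF V(1) K VD] V(1)])
      (use V(2) smooth_nearI[OF V(1) _ V(3)] in \<open>auto simp: coord_field_def restrict_vf_def coord_deriv_def\<close>)
qed (use assms in \<open>auto simp: coord_field_def restrict_vf_def coord_deriv_tangent\<close>)

lemma vf_coordinates:
  assumes K: "(D, \<phi>) \<in> M" and "U \<subseteq> D" and Z: "Z \<in> vector_fields M U"
  shows "Z = (\<lambda>p f. \<Sum>b\<in>Basis. scale_vf (\<lambda>p. Z p (\<lambda>q. \<phi> q \<bullet> b)) (coord_field D \<phi> U b) p f)"
proof
  fix p
  show "Z p = (\<lambda>f. \<Sum>b\<in>Basis. scale_vf (\<lambda>p. Z p (\<lambda>q. \<phi> q \<bullet> b)) (coord_field D \<phi> U b) p f)"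
  proof (cases "p \<in> U")
    case True
    then show ?thesis
      using tangent_vector_coordinates[OF K _ vf_tangent[OF Z True]] assms(2)
      by (auto simp: scale_vf_def coord_field_def restrict_vf_def)
  next
    case False
    then show ?thesis
      using vf_outside[OF Z] by (auto simp: scale_vf_def coord_field_def restrict_vf_def fun_eq_iff)
  qed
qed

text \<open>The extension has constant coefficients in the coordinate frame.\<close>

lemma tangent_vector_extends:
  assumes K: "(D, \<phi>) \<in> M" and "U \<subseteq> D" and "p \<in> U" and v: "v \<in> tangent_space M p"
  obtains X where "X \<in> vector_fields M U" "X p = v"
proof
  let ?X = "\<lambda>q f. \<Sum>b\<in>Basis. scale_vf (\<lambda>_. v (\<lambda>q. \<phi> q \<bullet> b)) (coord_field D \<phi> U b) q f"
  show "?X \<in> vector_fields M U"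
    by (intro vf_sum vf_scale smooth_functions_const vf_coord_field K assms(2))
  show "?X p = v"
    using tangent_vector_coordinates[OF K _ v] assms by (auto simp: scale_vf_def coord_field_def restrict_vf_def)
qed

end

section \<open>The musical isomorphism\<close>

text \<open>The determinants in Cramer's rule are those of matrices indexed by a finite type; here it consists of the
  basis vectors of the model space.\<close>

typedef (overloaded) 'e basis_index = "Basis :: 'e::euclidean_space set"
  using nonempty_Basis by blast

instance basis_index :: (euclidean_space) finite
proof
  have "(UNIV :: 'a basis_index set) = Abs_basis_index ` Basis"
    by (rule type_definition.Abs_image[OF type_definition_basis_index, symmetric])
  then show "finite (UNIV :: 'a basis_index set)" by (metis finite_Basis finite_imageI)
qed

lemma sum_basis_index:
  "(\<Sum>i\<in>UNIV. f (Rep_basis_index i)) = (\<Sum>b\<in>(Basis::'e::euclidean_space set). f b)"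
  by (rule sum.reindex_bij_betw)
    (use type_definition.Rep_range[OF type_definition_basis_index] in
      \<open>auto simp: bij_betw_def inj_on_def Rep_basis_index_inject\<close>)

context manifold
begin

lemma smooth_functions_det:
  fixes A :: "'m \<Rightarrow> real^'n^'n"
  assumes U: "U \<in> opens M" and "\<And>i j. (\<lambda>p. A p $ i $ j) \<in> smooth_functions M U"
  shows "(\<lambda>p. det (A p)) \<in> smooth_functions M U"
  unfolding det_def
  by (intro smooth_functions_sum smooth_functions_mult smooth_functions_prod smooth_functions_const U assms(2))

text \<open>Cramer's rule writes the solution as a quotient of determinants, which are polynomials in
  the coefficients; so it depends smoothly on the point.\<close>

lemma smooth_linear_system:
  fixes G :: "'e \<Rightarrow> 'e \<Rightarrow> 'm \<Rightarrow> real"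
  assumes U: "U \<in> opens M"
    and G: "\<And>b b'. b \<in> Basis \<Longrightarrow> b' \<in> Basis \<Longrightarrow> G b b' \<in> smooth_functions M U"
    and a: "\<And>b. b \<in> Basis \<Longrightarrow> a b \<in> smooth_functions M U"
    and inj: "\<And>p w. p \<in> U \<Longrightarrow> (\<And>b. b \<in> Basis \<Longrightarrow> (\<Sum>b'\<in>Basis. G b b' p * w b') = 0) \<Longrightarrow>
      (\<And>b. b \<in> Basis \<Longrightarrow> w b = 0)"
  obtains w where "\<And>b. w b \<in> smooth_functions M U"
    "\<And>p b. p \<in> U \<Longrightarrow> b \<in> Basis \<Longrightarrow> (\<Sum>b'\<in>Basis. G b b' p * w b' p) = a b p"
proof
  let ?R = "Rep_basis_index :: 'e basis_index \<Rightarrow> 'e"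
  define A :: "'m \<Rightarrow> real^'e basis_index^'e basis_index" where "A p = (\<chi> i j. G (?R i) (?R j) p)" for p
  define B :: "'e basis_index \<Rightarrow> 'm \<Rightarrow> real^'e basis_index^'e basis_index"
    where "B k p = (\<chi> i j. if j = k then a (?R i) p else A p $ i $ j)" for k p
  define w where "w b p = det (B (Abs_basis_index b) p) * inverse (det (A p))" for b p
  have det: "det (A p) \<noteq> 0" if p: "p \<in> U" for p
  proof -
    have "x = 0" if "A p *v x = 0" for x
    proof -
      have "(\<Sum>b'\<in>Basis. G (?R i) b' p * x $ Abs_basis_index b') = 0" for i
      proof -
        have "(\<Sum>b'\<in>Basis. G (?R i) b' p * x $ Abs_basis_index b') = (\<Sum>j\<in>UNIV. G (?R i) (?R j) p * x $ j)"
          by (subst sum_basis_index[symmetric]) (simp add: Rep_basis_index_inverse)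
        also have "\<dots> = (A p *v x) $ i" by (simp add: matrix_vector_mult_def A_def)
        finally show ?thesis using that by simp
      qed
      then have "(\<Sum>b'\<in>Basis. G b b' p * x $ Abs_basis_index b') = 0" if "b \<in> Basis" for b
        using Abs_basis_index_inverse[OF that] by metis
      from inj[OF p this] have "x $ Abs_basis_index (?R i) = 0" for i using Rep_basis_index by blast
      then show ?thesis by (simp add: Rep_basis_index_inverse vec_eq_iff)
    qed
    then show ?thesis
      using matrix_left_invertible_ker[of "A p"] by (simp add: invertible_left_inverse flip: invertible_det_nz)
  qed
  have A: "(\<lambda>p. A p $ i $ j) \<in> smooth_functions M U" for i j
    by (simp add: A_def G Rep_basis_index)
  then have B: "(\<lambda>p. B k p $ i $ j) \<in> smooth_functions M U" for i j k
    using a[OF Rep_basis_index[of i]] by (cases "j = k") (simp_all add: B_def)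
  show "w b \<in> smooth_functions M U" for b
    unfolding w_def
    by (intro smooth_functions_mult smooth_functions_inverse smooth_functions_det U A B det)
  fix p and b :: 'e assume p: "p \<in> U" and b: "b \<in> Basis"
  have "A p *v (\<chi> k. det (B k p) / det (A p)) = (\<chi> i. a (?R i) p)"
    unfolding cramer[OF det[OF p]] by (simp add: B_def cong: if_cong)
  then have "(A p *v (\<chi> k. det (B k p) / det (A p))) $ Abs_basis_index b = a b p"
    by (simp add: Abs_basis_index_inverse[OF b])
  moreover have "(A p *v (\<chi> k. det (B k p) / det (A p))) $ Abs_basis_index b =
      (\<Sum>j\<in>UNIV. G b (?R j) p * w (?R j) p)"
    by (simp add: matrix_vector_mult_def A_def w_def Abs_basis_index_inverse[OF b] Rep_basis_index_inverse divide_inverse)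
  ultimately show "(\<Sum>b'\<in>Basis. G b b' p * w b' p) = a b p"
    by (simp add: sum_basis_index[of "\<lambda>b'. G b b' p * w b' p"])
qed

text \<open>A one-form on \<open>U\<close> acts on the vector fields over all open subsets of \<open>U\<close>; the last clause ties these actions
  together.\<close>

definition one_form_on :: "'m set \<Rightarrow> 'm one_form \<Rightarrow> bool" where
  "one_form_on U \<alpha> \<longleftrightarrow> (\<forall>V\<in>opens M. V \<subseteq> U \<longrightarrow>
     (\<forall>Y\<in>vector_fields M V. \<alpha> Y \<in> smooth_functions M V \<and>
       (\<forall>Z\<in>vector_fields M V. \<forall>p\<in>V. \<alpha> (Y + Z) p = \<alpha> Y p + \<alpha> Z p) \<and>
       (\<forall>h\<in>smooth_functions M V. \<forall>p\<in>V. \<alpha> (scale_vf h Y) p = h p * \<alpha> Y p) \<and>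
       (\<forall>W\<in>opens M. W \<subseteq> V \<longrightarrow> (\<forall>p\<in>W. \<alpha> (restrict_vf W Y) p = \<alpha> Y p))))"

lemma
  assumes "one_form_on U \<alpha>" "V \<in> opens M" "V \<subseteq> U" "Y \<in> vector_fields M V"
  shows one_form_smooth: "\<alpha> Y \<in> smooth_functions M V"
    and one_form_add: "Z \<in> vector_fields M V \<Longrightarrow> p \<in> V \<Longrightarrow> \<alpha> (Y + Z) p = \<alpha> Y p + \<alpha> Z p"
    and one_form_scale: "h \<in> smooth_functions M V \<Longrightarrow> p \<in> V \<Longrightarrow> \<alpha> (scale_vf h Y) p = h p * \<alpha> Y p"
    and one_form_restrict: "W \<in> opens M \<Longrightarrow> W \<subseteq> V \<Longrightarrow> p \<in> W \<Longrightarrow> \<alpha> (restrict_vf W Y) p = \<alpha> Y p"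
  using assms by (simp_all add: one_form_on_def)

lemma one_form_sum:
  assumes "one_form_on U \<alpha>" "V \<in> opens M" "V \<subseteq> U" "p \<in> V"
    and "\<And>i. i \<in> I \<Longrightarrow> X i \<in> vector_fields M V"
  shows "\<alpha> (\<lambda>p f. \<Sum>i\<in>I. X i p f) p = (\<Sum>i\<in>I. \<alpha> (X i) p)"
proof -
  have z: "\<alpha> (\<lambda>p f. 0) p = 0"
  proof -
    have "\<alpha> (scale_vf (\<lambda>_. 0) 0) p = 0 * \<alpha> 0 p"
      by (rule one_form_scale[OF assms(1-3) vf_0 smooth_functions_const assms(4)])
    then show ?thesis by (simp add: scale_vf_def)
  qed
  show ?thesis
    using assms(5)
  proof (induction I rule: infinite_finite_induct)
    case (insert i I)
    then have "\<alpha> (X i + (\<lambda>p f. \<Sum>i\<in>I. X i p f)) p = \<alpha> (X i) p + \<alpha> (\<lambda>p f. \<Sum>i\<in>I. X i p f) p"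
      by (intro one_form_add[OF assms(1-3)] vf_sum assms(4)) auto
    with insert show ?case by (simp add: plus_fun_def)
  qed (simp_all add: z)
qed

end

locale pseudo_riemannian_manifold = manifold M
  for M :: "('m::{t2_space, second_countable_topology}, 'e::euclidean_space) chart set" +
  fixes g :: "'m metric"
  assumes metric: "pseudo_riemannian_metric M g"
begin

lemma metric_add_left:
  "p \<in> carrier M \<Longrightarrow> u \<in> tangent_space M p \<Longrightarrow> v \<in> tangent_space M p \<Longrightarrow> w \<in> tangent_space M p \<Longrightarrow>
    g p (u + v) w = g p u w + g p v w"
  using metric by (simp add: pseudo_riemannian_metric_def)

lemma metric_scale_left:
  "p \<in> carrier M \<Longrightarrow> u \<in> tangent_space M p \<Longrightarrow> v \<in> tangent_space M p \<Longrightarrow> g p (\<lambda>f. a * u f) v = a * g p u v"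
  using metric by (simp add: pseudo_riemannian_metric_def)

lemma metric_sym:
  "p \<in> carrier M \<Longrightarrow> u \<in> tangent_space M p \<Longrightarrow> v \<in> tangent_space M p \<Longrightarrow> g p u v = g p v u"
  using metric by (simp add: pseudo_riemannian_metric_def)

lemma metric_zero_left:
  "p \<in> carrier M \<Longrightarrow> v \<in> tangent_space M p \<Longrightarrow> g p 0 v = 0"
  using metric_scale_left[of p 0 v 0] tangent_space_0 by (simp add: zero_fun_def)

lemma metric_sum_left:
  assumes "p \<in> carrier M" "v \<in> tangent_space M p" "\<And>i. i \<in> I \<Longrightarrow> u i \<in> tangent_space M p"
  shows "g p (\<lambda>f. \<Sum>i\<in>I. u i f) v = (\<Sum>i\<in>I. g p (u i) v)"
  using assms(3)
proof (induction I rule: infinite_finite_induct)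
  case (insert i I)
  then show ?case
    using metric_add_left[OF assms(1), of "u i" "\<lambda>f. \<Sum>i\<in>I. u i f" v] assms(2) tangent_space_sum[of I u p]
    by (simp add: plus_fun_def)
qed (use metric_zero_left[OF assms(1,2)] in \<open>simp_all add: zero_fun_def\<close>)

lemma metric_nondegenerate:
  assumes "p \<in> carrier M" "u \<in> tangent_space M p" "u' \<in> tangent_space M p"
    and "\<And>v. v \<in> tangent_space M p \<Longrightarrow> g p u v = g p u' v"
  shows "u = u'"
proof -
  let ?d = "u + (\<lambda>f. (-1) * u' f)"
  have d: "?d \<in> tangent_space M p"
    by (intro tangent_space_add tangent_space_cmult assms)
  have "g p ?d v = 0" if "v \<in> tangent_space M p" for v
    using metric_add_left[OF assms(1,2) tangent_space_cmult[OF assms(3)] that, of "-1"]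
      metric_scale_left[OF assms(1,3) that, of "-1"] assms(4)[OF that] by simp
  then have "?d = 0" using metric assms(1) d unfolding pseudo_riemannian_metric_def by blast
  then show ?thesis by (simp add: fun_eq_iff)
qed

lemma metric_vf_smooth:
  "U \<in> opens M \<Longrightarrow> X \<in> vector_fields M U \<Longrightarrow> Y \<in> vector_fields M U \<Longrightarrow> metric_vf g X Y \<in> smooth_functions M U"
  using metric by (simp add: pseudo_riemannian_metric_def)

lemma metric_vf_nondegenerate:
  assumes U: "U \<in> opens M" and X: "X \<in> vector_fields M U" "X' \<in> vector_fields M U"
    and eq: "\<And>V Z p. V \<in> opens M \<Longrightarrow> V \<subseteq> U \<Longrightarrow> Z \<in> vector_fields M V \<Longrightarrow> p \<in> V \<Longrightarrow>
      metric_vf g X Z p = metric_vf g X' Z p"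
  shows "X = X'"
proof (rule vf_eqI[OF X])
  fix p assume p: "p \<in> U"
  obtain D \<phi> where K: "(D, \<phi>) \<in> M" "p \<in> D" using opens_chart[OF U p] .
  have V: "U \<inter> D \<in> opens M" "U \<inter> D \<subseteq> D" "p \<in> U \<inter> D" "U \<inter> D \<subseteq> U"
    using opens_Int[OF U chart_opens[OF K(1)]] p K(2) by auto
  show "X p = X' p"
  proof (rule metric_nondegenerate)
    show "p \<in> carrier M" using opensD(2)[OF U] p by blast
    fix v assume v: "v \<in> tangent_space M p"
    obtain Z where Z: "Z \<in> vector_fields M (U \<inter> D)" "Z p = v"
      using tangent_vector_extends[OF K(1) V(2,3) v] .
    show "g p (X p) v = g p (X' p) v"
      using eq[OF V(1,4) Z(1) V(3)] Z(2) by (simp add: metric_vf_def)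
  qed (use X p vf_tangent in auto)
qed

lemma metric_sum_scale_left:
  assumes "p \<in> carrier M" "v \<in> tangent_space M p" "\<And>i. i \<in> I \<Longrightarrow> u i \<in> tangent_space M p"
  shows "g p (\<lambda>f. \<Sum>i\<in>I. a i * u i f) v = (\<Sum>i\<in>I. a i * g p (u i) v)"
  using metric_sum_left[OF assms(1,2), of I "\<lambda>i f. a i * u i f"] assms(3)
    metric_scale_left[OF assms(1) _ assms(2)] tangent_space_cmult by simp

lemma metric_coordinates_right:
  assumes K: "(D, \<phi>) \<in> M" "p \<in> D" and u: "u \<in> tangent_space M p" and v: "v \<in> tangent_space M p"
  shows "g p u v = (\<Sum>b\<in>Basis. v (\<lambda>q. \<phi> q \<bullet> b) * g p u (coord_deriv D \<phi> p b))"
proof -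
  have p: "p \<in> carrier M" using K chart_opens opensD(2) by blast
  note E = coord_deriv_tangent[OF K]
  have "g p u v = g p (\<lambda>f. \<Sum>b\<in>Basis. v (\<lambda>q. \<phi> q \<bullet> b) * coord_deriv D \<phi> p b f) u"
    using tangent_vector_coordinates[OF K v] metric_sym[OF p u v] by simp
  then show ?thesis
    using metric_sum_scale_left[where I=Basis and a="\<lambda>b. v (\<lambda>q. \<phi> q \<bullet> b)", OF p u E] metric_sym[OF p u E] by simp
qed

text \<open>Over a chart domain, the coefficients of the dual vector field in the coordinate frame solve the linear
  system given by the Gram matrix, which is invertible because the metric is nondegenerate.\<close>

lemma one_form_dual_on_chart:
  assumes K: "(D, \<phi>) \<in> M" and V: "V \<in> opens M" "V \<subseteq> D" and \<alpha>: "one_form_on V \<alpha>"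
  obtains W where "W \<in> vector_fields M V"
    "\<And>V' Z q. V' \<in> opens M \<Longrightarrow> V' \<subseteq> V \<Longrightarrow> Z \<in> vector_fields M V' \<Longrightarrow> q \<in> V' \<Longrightarrow> g q (W q) (Z q) = \<alpha> Z q"
proof -
  let ?E = "coord_field D \<phi> V"
  have E: "?E b \<in> vector_fields M V" for b using vf_coord_field[OF K V(2)] .
  have Et: "?E b p \<in> tangent_space M p" if "p \<in> V" for b p using vf_tangent[OF E that] .
  have Ep: "?E b p = coord_deriv D \<phi> p b" if "p \<in> V" for b p
    using that by (simp add: coord_field_def restrict_vf_def)
  have c: "p \<in> carrier M" if "p \<in> V" for p using opensD(2)[OF V(1)] that by blast
  obtain w where w: "\<And>b. w b \<in> smooth_functions M V"
    "\<And>p b. p \<in> V \<Longrightarrow> b \<in> Basis \<Longrightarrow> (\<Sum>b'\<in>Basis. metric_vf g (?E b') (?E b) p * w b' p) = \<alpha> (?E b) p"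
  proof (rule smooth_linear_system[OF V(1), of "\<lambda>b b'. metric_vf g (?E b') (?E b)" "\<lambda>b. \<alpha> (?E b)"])
    show "metric_vf g (?E b') (?E b) \<in> smooth_functions M V" for b b'
      using metric_vf_smooth[OF V(1) E E] .
    show "\<alpha> (?E b) \<in> smooth_functions M V" for b
      using one_form_smooth[OF \<alpha> V(1) order_refl E] .
    fix p and w :: "'e \<Rightarrow> real" and b :: 'e
    assume p: "p \<in> V" and 0: "\<And>b. b \<in> Basis \<Longrightarrow> (\<Sum>b'\<in>Basis. metric_vf g (?E b') (?E b) p * w b') = 0"
      and b: "b \<in> Basis"
    have pD: "p \<in> D" using p V(2) by blast
    let ?u = "\<lambda>f. \<Sum>b\<in>Basis. w b * ?E b p f"
    have u: "?u \<in> tangent_space M p" by (intro tangent_space_sum tangent_space_cmult Et p)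
    have gE: "g p ?u (coord_deriv D \<phi> p b) = 0" if "b \<in> Basis" for b
      using 0[OF that] metric_sum_scale_left[where I=Basis and a=w and u="\<lambda>b. ?E b p",
          OF c[OF p] Et[OF p, of b] Et[OF p]] Ep[OF p]
      by (simp add: metric_vf_def mult.commute)
    \<comment> \<open>A vector in the kernel of the Gram matrix is orthogonal to a basis, hence zero.\<close>
    have "?u = 0"
    proof (rule metric_nondegenerate[OF c[OF p] u tangent_space_0])
      fix v assume v: "v \<in> tangent_space M p"
      show "g p ?u v = g p 0 v"
        using metric_coordinates_right[OF K pD u v] gE metric_zero_left[OF c[OF p] v] by simp
    qed
    then have "?u (\<lambda>q. \<phi> q \<bullet> b) = 0" by (simp add: fun_eq_iff)
    moreover have "?E b' p (\<lambda>q. \<phi> q \<bullet> b) = b' \<bullet> b" for b'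
    proof -
      have x: "(\<lambda>q. \<phi> q \<bullet> b) \<in> smooth_near M p"
        using smooth_nearI[OF V(1) p coordinate_smooth[OF V(1) K V(2)]] .
      have "((\<lambda>x. x \<bullet> b) has_derivative (\<lambda>x. x \<bullet> b)) (at (\<phi> p))"
        by (rule bounded_linear_imp_has_derivative[OF bounded_linear_inner_left])
      then have "((\<lambda>x. \<phi> (inv_into D \<phi> x) \<bullet> b) has_derivative (\<lambda>x. x \<bullet> b)) (at (\<phi> p))"
        by (rule has_derivative_transform_within_open[of _ _ _ _ "\<phi> ` D"])
          (use pD chart_image_open[OF K chart_open[OF K]] in \<open>auto simp: chart_inv[OF K]\<close>)
      from frechet_derivative_at[OF this] show ?thesis
        using x by (simp add: Ep[OF p] coord_deriv_def) metis
    qed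
    ultimately have "(\<Sum>b'\<in>Basis. w b' * (b' \<bullet> b)) = 0" by simp
    moreover have "(\<Sum>b'\<in>Basis. w b' * (b' \<bullet> b)) = w b"
      using b by (simp add: inner_Basis if_distrib cong: if_cong)
    ultimately show "w b = 0" by simp
  qed (rule that)
  define W where "W = (\<lambda>p f. \<Sum>b\<in>Basis. scale_vf (w b) (?E b) p f)"
  show thesis
  proof
    show "W \<in> vector_fields M V" unfolding W_def by (intro vf_sum vf_scale w(1) E)
    fix V' Z q assume V': "V' \<in> opens M" "V' \<subseteq> V" and Z: "Z \<in> vector_fields M V'" and q: "q \<in> V'"
    let ?E' = "coord_field D \<phi> V'"
    have qV: "q \<in> V" and V'D: "V' \<subseteq> D" using V' q V(2) by auto
    have E': "?E' b \<in> vector_fields M V'" for b using vf_coord_field[OF K V'D] .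
    have Wq: "W q = (\<lambda>f. \<Sum>b\<in>Basis. w b q * ?E b q f)" by (simp add: W_def scale_vf_def)
    have Wt: "W q \<in> tangent_space M q" using \<open>W \<in> vector_fields M V\<close> qV vf_tangent by blast
    have WE: "g q (W q) (?E b q) = \<alpha> (?E b) q" if "b \<in> Basis" for b
      unfolding Wq using metric_sum_scale_left[where I=Basis and a="\<lambda>b. w b q" and u="\<lambda>b. ?E b q",
          OF c[OF qV] Et[OF qV, of b] Et[OF qV]]
        w(2)[OF qV that] by (simp add: metric_vf_def mult.commute)
    have aE: "\<alpha> (?E' b) q = \<alpha> (?E b) q" for b
    proof -
      have "restrict_vf V' (?E b) = ?E' b" using V'(2) by (auto simp: coord_field_def restrict_vf_def fun_eq_iff)
      then show ?thesis using one_form_restrict[OF \<alpha> V(1) order_refl E V' q, of b] by simp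
    qed
    have sm: "(\<lambda>p. Z p (\<lambda>q. \<phi> q \<bullet> b)) \<in> smooth_functions M V'" for b
      using vf_smooth[OF Z V'(1) order_refl coordinate_smooth[OF V'(1) K V'D]] .
    have "\<alpha> Z q = \<alpha> (\<lambda>p f. \<Sum>b\<in>Basis. scale_vf (\<lambda>p. Z p (\<lambda>q. \<phi> q \<bullet> b)) (?E' b) p f) q"
      using vf_coordinates[OF K V'D Z] by simp
    also have "\<dots> = (\<Sum>b\<in>Basis. \<alpha> (scale_vf (\<lambda>p. Z p (\<lambda>q. \<phi> q \<bullet> b)) (?E' b)) q)"
      by (rule one_form_sum[OF \<alpha> V' q]) (intro vf_scale sm E')
    also have "\<dots> = (\<Sum>b\<in>Basis. Z q (\<lambda>q. \<phi> q \<bullet> b) * \<alpha> (?E' b) q)"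
      by (intro sum.cong refl one_form_scale[OF \<alpha> V' E' sm q])
    also have "\<dots> = (\<Sum>b\<in>Basis. Z q (\<lambda>q. \<phi> q \<bullet> b) * g q (W q) (coord_deriv D \<phi> q b))"
      using WE aE Ep[OF qV] by simp
    also have "\<dots> = g q (W q) (Z q)"
      using metric_coordinates_right[OF K _ Wt vf_tangent[OF Z q]] qV V(2) by auto
    finally show "g q (W q) (Z q) = \<alpha> Z q" ..
  qed
qed

lemma one_form_on_subset:
  assumes "one_form_on U \<alpha>" "V \<subseteq> U" shows "one_form_on V \<alpha>"
proof -
  have "V' \<subseteq> U" if "V' \<subseteq> V" for V' using that assms(2) by blast
  then show ?thesis using assms(1) by (simp add: one_form_on_def)
qed

text \<open>Over the whole of \<open>U\<close>, the dual vector field is pieced together from those over charts, which agree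
  on overlaps by nondegeneracy.\<close>

lemma one_form_dual:
  assumes U: "U \<in> opens M" and \<alpha>: "one_form_on U \<alpha>"
  shows "\<exists>!W. W \<in> vector_fields M U \<and>
    (\<forall>V\<in>opens M. V \<subseteq> U \<longrightarrow> (\<forall>Z\<in>vector_fields M V. \<forall>p\<in>V. metric_vf g W Z p = \<alpha> Z p))"
proof (rule ex_ex1I)
  \<comment> \<open>\<open>dual p w\<close>: the vector \<open>w\<close> represents the one-form at the point \<open>p\<close>.\<close>
  define dual where "dual p w \<longleftrightarrow> w \<in> tangent_space M p \<and>
    (\<forall>V\<in>opens M. V \<subseteq> U \<longrightarrow> p \<in> V \<longrightarrow> (\<forall>Z\<in>vector_fields M V. g p w (Z p) = \<alpha> Z p))" for p w
  have dual_unique: "w = w'" if p: "p \<in> U" and w: "dual p w" "dual p w'" for p w w'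
  proof -
    obtain D \<phi> where K: "(D, \<phi>) \<in> M" "p \<in> D" using opens_chart[OF U p] .
    have V: "U \<inter> D \<in> opens M" "U \<inter> D \<subseteq> D" "p \<in> U \<inter> D" "U \<inter> D \<subseteq> U"
      using opens_Int[OF U chart_opens[OF K(1)]] p K(2) by auto
    show ?thesis
    proof (rule metric_nondegenerate)
      show "p \<in> carrier M" using opensD(2)[OF U] p by blast
      fix v assume v: "v \<in> tangent_space M p"
      obtain Z where "Z \<in> vector_fields M (U \<inter> D)" "Z p = v"
        using tangent_vector_extends[OF K(1) V(2,3) v] .
      then show "g p w v = g p w' v" using w V unfolding dual_def by metis
    qed (use w in \<open>auto simp: dual_def\<close>)
  qed
  have local: "\<exists>V\<in>opens M. p \<in> V \<and> (\<exists>Y\<in>vector_fields M V. \<forall>q\<in>V. dual q (Y q))" if p: "p \<in> U" for p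
  proof -
    obtain D \<phi> where K: "(D, \<phi>) \<in> M" "p \<in> D" using opens_chart[OF U p] .
    let ?V = "U \<inter> D"
    have V: "?V \<in> opens M" "?V \<subseteq> D" "p \<in> ?V" "?V \<subseteq> U"
      using opens_Int[OF U chart_opens[OF K(1)]] p K(2) by auto
    obtain Y where Y: "Y \<in> vector_fields M ?V"
      "\<And>V' Z q. V' \<in> opens M \<Longrightarrow> V' \<subseteq> ?V \<Longrightarrow> Z \<in> vector_fields M V' \<Longrightarrow> q \<in> V' \<Longrightarrow> g q (Y q) (Z q) = \<alpha> Z q"
      using one_form_dual_on_chart[OF K(1) V(1,2) one_form_on_subset[OF \<alpha> V(4)]] by blast
    have "dual q (Y q)" if q: "q \<in> ?V" for q
      unfolding dual_def
    proof (intro conjI ballI impI)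
      fix V' Z assume V': "V' \<in> opens M" "V' \<subseteq> U" "q \<in> V'" and Z: "Z \<in> vector_fields M V'"
      let ?I = "V' \<inter> ?V"
      have I: "?I \<in> opens M" "q \<in> ?I" "?I \<subseteq> V'" using opens_Int[OF V'(1) V(1)] V' q by auto
      have "\<alpha> Z q = \<alpha> (restrict_vf ?I Z) q"
        using one_form_restrict[OF \<alpha> V'(1,2) Z I(1,3,2)] by simp
      also have "\<dots> = g q (Y q) (restrict_vf ?I Z q)"
        by (rule Y(2)[OF I(1) Int_lower2 vf_restrict[OF Z I(3)] I(2), symmetric])
      finally show "g q (Y q) (Z q) = \<alpha> Z q" using I(2) by (simp add: restrict_vf_def)
    qed (rule vf_tangent[OF Y(1) q])
    with Y(1) V show ?thesis by blast
  qed
  define W where "W p = (if p \<in> U then SOME w. dual p w else 0)" for p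
  have dW: "dual p (W p)" if "p \<in> U" for p
  proof -
    have "\<exists>w. dual p w" using local[OF that] by blast
    then show ?thesis using that by (simp add: W_def someI_ex)
  qed
  have "W \<in> vector_fields M U"
  proof (rule vf_local[OF U])
    show "W p = 0" if "p \<notin> U" for p using that by (simp add: W_def)
    fix p assume p: "p \<in> U"
    then obtain V Y where V: "V \<in> opens M" "p \<in> V" "Y \<in> vector_fields M V" "\<forall>q\<in>V. dual q (Y q)"
      using local by blast
    have I: "V \<inter> U \<in> opens M" "p \<in> V \<inter> U" using opens_Int[OF V(1) U] V p by auto
    have "W q = restrict_vf (V \<inter> U) Y q" if "q \<in> V \<inter> U" for q
      using dual_unique[of q "W q" "Y q"] dW V(4) that by (simp add: restrict_vf_def)
    then show "\<exists>V\<in>opens M. p \<in> V \<and> (\<exists>Y\<in>vector_fields M V. \<forall>q\<in>V. W q = Y q)"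
      using I vf_restrict[OF V(3), of "V \<inter> U"] by blast
  qed
  moreover have "metric_vf g W Z p = \<alpha> Z p"
    if "V \<in> opens M" "V \<subseteq> U" "Z \<in> vector_fields M V" "p \<in> V" for V Z p
    using dW[of p] that unfolding dual_def metric_vf_def by blast
  ultimately show "\<exists>W. W \<in> vector_fields M U \<and>
      (\<forall>V\<in>opens M. V \<subseteq> U \<longrightarrow> (\<forall>Z\<in>vector_fields M V. \<forall>p\<in>V. metric_vf g W Z p = \<alpha> Z p))"
    by blast
next
  fix W W' assume "W \<in> vector_fields M U \<and>
      (\<forall>V\<in>opens M. V \<subseteq> U \<longrightarrow> (\<forall>Z\<in>vector_fields M V. \<forall>p\<in>V. metric_vf g W Z p = \<alpha> Z p))"
    "W' \<in> vector_fields M U \<and>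
      (\<forall>V\<in>opens M. V \<subseteq> U \<longrightarrow> (\<forall>Z\<in>vector_fields M V. \<forall>p\<in>V. metric_vf g W' Z p = \<alpha> Z p))"
  then show "W = W'" by (intro metric_vf_nondegenerate[OF U]) auto
qed

end

section \<open>The Levi-Civita connection\<close>

context manifold
begin

text \<open>Over such a set every tangent vector extends to a vector field, namely with constant coefficients in the
  coordinate frame.\<close>

definition small :: "'m set \<Rightarrow> bool" where
  "small V \<longleftrightarrow> V \<in> opens M \<and> (\<exists>(D, \<phi>)\<in>M. V \<subseteq> D)"

lemma small_opens: "small V \<Longrightarrow> V \<in> opens M"
  by (simp add: small_def)

lemma small_extends:
  assumes "small V" "p \<in> V" "v \<in> tangent_space M p"
  obtains X where "X \<in> vector_fields M V" "X p = v"
proof -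
  obtain D \<phi> where "(D, \<phi>) \<in> M" "V \<subseteq> D" using assms(1) by (auto simp: small_def)
  then show ?thesis using tangent_vector_extends[OF _ _ assms(2,3)] that by blast
qed

text \<open>Every point has a small neighbourhood inside \<open>U\<close>.\<close>

lemma vf_eq_small:
  assumes U: "U \<in> opens M" and X: "X \<in> vector_fields M U" and Y: "Y \<in> vector_fields M U"
    and eq: "\<And>V. small V \<Longrightarrow> V \<subseteq> U \<Longrightarrow> restrict_vf V X = restrict_vf V Y"
  shows "X = Y"
proof (rule vf_eqI[OF X Y])
  fix p assume p: "p \<in> U"
  obtain D \<phi> where K: "(D, \<phi>) \<in> M" "p \<in> D" using opens_chart[OF U p] .
  have "small (U \<inter> D)" using opens_Int[OF U chart_opens[OF K(1)]] K(1) by (auto simp: small_def)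
  from fun_cong[OF eq[OF this Int_lower1], of p] show "X p = Y p"
    using p K(2) by (simp add: restrict_vf_def)
qed

lemma restrict_vf_add: "restrict_vf V (X + Y) = restrict_vf V X + restrict_vf V Y" for X Y :: "'m vector_field"
  by (simp add: restrict_vf_def fun_eq_iff)

lemma restrict_vf_diff: "restrict_vf V (X - Y) = restrict_vf V X - restrict_vf V Y" for X Y :: "'m vector_field"
  by (simp add: restrict_vf_def fun_eq_iff)

lemma restrict_vf_scale: "restrict_vf V (scale_vf h X) = scale_vf h (restrict_vf V X)"
  by (simp add: restrict_vf_def scale_vf_def fun_eq_iff)

text \<open>Oriented so that restricting the derivative of \<open>h\<close> disappears when the field that it multiplies is itself
  restricted.\<close>

lemma restrict_vf_scale_derivative:
  "scale_vf (\<lambda>p. restrict_vf V X p h) (restrict_vf V Y) = scale_vf (\<lambda>p. X p h) (restrict_vf V Y)"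
  by (simp add: restrict_vf_def scale_vf_def fun_eq_iff)

lemma restrict_vf_restrict: "V \<subseteq> U \<Longrightarrow> restrict_vf V (restrict_vf U X) = restrict_vf V X"
  by (auto simp: restrict_vf_def fun_eq_iff)

lemma restrict_lie_bracket:
  assumes "X \<in> vector_fields M U" "Y \<in> vector_fields M U" "V \<in> opens M" "V \<subseteq> U"
  shows "restrict_vf V (lie_bracket M X Y) = lie_bracket M (restrict_vf V X) (restrict_vf V Y)"
proof
  fix p
  show "restrict_vf V (lie_bracket M X Y) p = lie_bracket M (restrict_vf V X) (restrict_vf V Y) p"
  proof (cases "p \<in> V")
    case True
    have "lie_bracket M X Y p = lie_bracket M (restrict_vf V X) (restrict_vf V Y) p"
      by (rule lie_bracket_cong[OF opensD(1)[OF assms(3)] True])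
        (use assms True vf_tangent in \<open>auto simp: restrict_vf_def\<close>)
    with True show ?thesis by (simp add: restrict_vf_def)
  qed (simp add: restrict_vf_def lie_bracket_def fun_eq_iff)
qed

lemma scale_vf_apply: "scale_vf h X p f = h p * X p f"
  by (simp add: scale_vf_def)

end

context pseudo_riemannian_manifold
begin

abbreviation pairing ("\<langle>_, _\<rangle>") where "\<langle>X, Y\<rangle> \<equiv> metric_vf g X Y"

text \<open>Twice the pairing of \<open>Z\<close> with the Levi-Civita derivative of \<open>Y\<close> along \<open>X\<close>.\<close>

definition koszul :: "'m vector_field \<Rightarrow> 'm vector_field \<Rightarrow> 'm vector_field \<Rightarrow> 'm \<Rightarrow> real" where
  "koszul X Y Z = (\<lambda>p. X p \<langle>Y, Z\<rangle> + Y p \<langle>Z, X\<rangle> - Z p \<langle>X, Y\<rangle>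
     + \<langle>lie_bracket M X Y, Z\<rangle> p - \<langle>lie_bracket M Y Z, X\<rangle> p + \<langle>lie_bracket M Z X, Y\<rangle> p)"

text \<open>The value at \<open>p\<close> depends on the germs of the arguments only. This allows arguments with different domains,
  as they occur in the definition of \<open>sharp\<close>.\<close>

lemma koszul_cong:
  assumes V: "open V" "p \<in> V"
    and eq: "\<And>q. q \<in> V \<Longrightarrow> X q = X' q" "\<And>q. q \<in> V \<Longrightarrow> Y q = Y' q" "\<And>q. q \<in> V \<Longrightarrow> Z q = Z' q"
    and t: "X p \<in> tangent_space M p" "Y p \<in> tangent_space M p" "Z p \<in> tangent_space M p"
  shows "koszul X Y Z p = koszul X' Y' Z' p"
proof -
  have d: "A p \<langle>B, C\<rangle> = A' p \<langle>B', C'\<rangle>"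
    if "A p \<in> tangent_space M p" "\<And>q. q \<in> V \<Longrightarrow> A q = A' q" "\<And>q. q \<in> V \<Longrightarrow> B q = B' q" "\<And>q. q \<in> V \<Longrightarrow> C q = C' q"
    for A A' B B' C C' :: "'m vector_field"
  proof -
    have "A p \<langle>B, C\<rangle> = A p \<langle>B', C'\<rangle>"
      by (rule tangent_cong[OF that(1) V]) (simp add: metric_vf_def that)
    then show ?thesis using that(2) V(2) by simp
  qed
  have b: "\<langle>lie_bracket M A B, C\<rangle> p = \<langle>lie_bracket M A' B', C'\<rangle> p"
    if "A p \<in> tangent_space M p" "B p \<in> tangent_space M p"
      "\<And>q. q \<in> V \<Longrightarrow> A q = A' q" "\<And>q. q \<in> V \<Longrightarrow> B q = B' q" "\<And>q. q \<in> V \<Longrightarrow> C q = C' q"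
    for A A' B B' C C' :: "'m vector_field"
  proof -
    have "lie_bracket M A B p = lie_bracket M A' B' p"
      by (rule lie_bracket_cong[OF V]) (fact that)+
    then show ?thesis using that(5) V(2) by (simp add: metric_vf_def)
  qed
  have "X p \<langle>Y, Z\<rangle> = X' p \<langle>Y', Z'\<rangle>" "Y p \<langle>Z, X\<rangle> = Y' p \<langle>Z', X'\<rangle>" "Z p \<langle>X, Y\<rangle> = Z' p \<langle>X', Y'\<rangle>"
    by (rule d; fact t eq)+
  moreover have "\<langle>lie_bracket M X Y, Z\<rangle> p = \<langle>lie_bracket M X' Y', Z'\<rangle> p"
    "\<langle>lie_bracket M Y Z, X\<rangle> p = \<langle>lie_bracket M Y' Z', X'\<rangle> p"
    "\<langle>lie_bracket M Z X, Y\<rangle> p = \<langle>lie_bracket M Z' X', Y'\<rangle> p"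
    by (rule b; fact t eq)+
  ultimately show ?thesis by (simp add: koszul_def)
qed

context
  fixes U assumes U: "U \<in> opens M"
begin

lemma pairing_add_left:
  "X \<in> vector_fields M U \<Longrightarrow> Y \<in> vector_fields M U \<Longrightarrow> Z \<in> vector_fields M U \<Longrightarrow> p \<in> U \<Longrightarrow>
    \<langle>X + Y, Z\<rangle> p = \<langle>X, Z\<rangle> p + \<langle>Y, Z\<rangle> p"
  using metric_add_left[of p "X p" "Y p" "Z p"] opensD(2)[OF U] by (auto simp: metric_vf_def vf_tangent)

lemma pairing_sym:
  "X \<in> vector_fields M U \<Longrightarrow> Y \<in> vector_fields M U \<Longrightarrow> p \<in> U \<Longrightarrow> \<langle>X, Y\<rangle> p = \<langle>Y, X\<rangle> p"
  using metric_sym[of p "X p" "Y p"] opensD(2)[OF U] by (auto simp: metric_vf_def vf_tangent)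

lemma pairing_scale_left:
  "X \<in> vector_fields M U \<Longrightarrow> Y \<in> vector_fields M U \<Longrightarrow> p \<in> U \<Longrightarrow> \<langle>scale_vf h X, Y\<rangle> p = h p * \<langle>X, Y\<rangle> p"
  using metric_scale_left[of p "X p" "Y p" "h p"] opensD(2)[OF U] by (auto simp: metric_vf_def vf_tangent scale_vf_def)

lemma pairing_add_right:
  "X \<in> vector_fields M U \<Longrightarrow> Y \<in> vector_fields M U \<Longrightarrow> Z \<in> vector_fields M U \<Longrightarrow> p \<in> U \<Longrightarrow>
    \<langle>X, Y + Z\<rangle> p = \<langle>X, Y\<rangle> p + \<langle>X, Z\<rangle> p"
  by (simp add: pairing_sym[of X] vf_add pairing_add_left)

lemma pairing_diff_left:
  "X \<in> vector_fields M U \<Longrightarrow> Y \<in> vector_fields M U \<Longrightarrow> Z \<in> vector_fields M U \<Longrightarrow> p \<in> U \<Longrightarrow>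
    \<langle>X - Y, Z\<rangle> p = \<langle>X, Z\<rangle> p - \<langle>Y, Z\<rangle> p"
  using pairing_add_left[of "X - Y" Y Z p] vf_diff[of X U Y] by simp

lemma pairing_minus_left:
  "X \<in> vector_fields M U \<Longrightarrow> Y \<in> vector_fields M U \<Longrightarrow> p \<in> U \<Longrightarrow> \<langle>- X, Y\<rangle> p = - \<langle>X, Y\<rangle> p"
  unfolding minus_vf_eq by (simp add: pairing_scale_left)

lemma pairing_scale_right:
  "h \<in> smooth_functions M U \<Longrightarrow> X \<in> vector_fields M U \<Longrightarrow> Y \<in> vector_fields M U \<Longrightarrow> p \<in> U \<Longrightarrow>
    \<langle>X, scale_vf h Y\<rangle> p = h p * \<langle>X, Y\<rangle> p"
  by (simp add: pairing_sym[of X] vf_scale pairing_scale_left)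

lemma act_cong:
  "X \<in> vector_fields M U \<Longrightarrow> p \<in> U \<Longrightarrow> (\<And>q. q \<in> U \<Longrightarrow> f q = h q) \<Longrightarrow> X p f = X p h"
  by (rule tangent_cong[OF vf_tangent opensD(1)[OF U]])

lemma act_add:
  "X \<in> vector_fields M U \<Longrightarrow> p \<in> U \<Longrightarrow> f \<in> smooth_functions M U \<Longrightarrow> h \<in> smooth_functions M U \<Longrightarrow>
    X p (\<lambda>q. f q + h q) = X p f + X p h"
  by (rule tangent_add[OF vf_tangent smooth_nearI[OF U] smooth_nearI[OF U]])

lemma act_pairing_sym:
  "W \<in> vector_fields M U \<Longrightarrow> X \<in> vector_fields M U \<Longrightarrow> Y \<in> vector_fields M U \<Longrightarrow> p \<in> U \<Longrightarrow>
    W p \<langle>X, Y\<rangle> = W p \<langle>Y, X\<rangle>"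
  using act_cong[of W p "\<langle>X, Y\<rangle>" "\<langle>Y, X\<rangle>"] pairing_sym by blast

lemma act_pairing_add_left:
  assumes "W \<in> vector_fields M U" "X \<in> vector_fields M U" "Y \<in> vector_fields M U" "Z \<in> vector_fields M U" "p \<in> U"
  shows "W p \<langle>X + Y, Z\<rangle> = W p \<langle>X, Z\<rangle> + W p \<langle>Y, Z\<rangle>"
proof -
  have "W p \<langle>X + Y, Z\<rangle> = W p (\<lambda>q. \<langle>X, Z\<rangle> q + \<langle>Y, Z\<rangle> q)"
    by (rule act_cong[OF assms(1,5)]) (simp add: assms pairing_add_left)
  then show ?thesis by (simp add: act_add assms metric_vf_smooth[OF U])
qed

lemma act_pairing_add_right:
  "W \<in> vector_fields M U \<Longrightarrow> X \<in> vector_fields M U \<Longrightarrow> Y \<in> vector_fields M U \<Longrightarrow> Z \<in> vector_fields M U \<Longrightarrow> p \<in> U \<Longrightarrow>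
    W p \<langle>X, Y + Z\<rangle> = W p \<langle>X, Y\<rangle> + W p \<langle>X, Z\<rangle>"
  by (simp add: act_pairing_sym[of W X] act_pairing_add_left vf_add)

lemma act_pairing_scale_left:
  assumes "W \<in> vector_fields M U" "X \<in> vector_fields M U" "Y \<in> vector_fields M U" "h \<in> smooth_functions M U" "p \<in> U"
  shows "W p \<langle>scale_vf h X, Y\<rangle> = h p * W p \<langle>X, Y\<rangle> + \<langle>X, Y\<rangle> p * W p h"
proof -
  have "W p \<langle>scale_vf h X, Y\<rangle> = W p (\<lambda>q. h q * \<langle>X, Y\<rangle> q)"
    by (rule act_cong[OF assms(1,5)]) (simp add: assms pairing_scale_left)
  then show ?thesis
    using tangent_mult[OF vf_tangent[OF assms(1,5)] smooth_nearI[OF U assms(5,4)]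
      smooth_nearI[OF U assms(5) metric_vf_smooth[OF U assms(2,3)]]] by simp
qed

lemma act_pairing_scale_right:
  "W \<in> vector_fields M U \<Longrightarrow> X \<in> vector_fields M U \<Longrightarrow> Y \<in> vector_fields M U \<Longrightarrow> h \<in> smooth_functions M U \<Longrightarrow> p \<in> U \<Longrightarrow>
    W p \<langle>X, scale_vf h Y\<rangle> = h p * W p \<langle>X, Y\<rangle> + \<langle>X, Y\<rangle> p * W p h"
  by (simp add: act_pairing_sym[of W X] act_pairing_scale_left vf_scale pairing_sym[of X])

lemmas vf_intros = vf_add vf_diff vf_minus vf_scale vf_lie_bracket[OF U] vf_smooth[OF _ U order_refl]

lemmas koszul_simps = koszul_def vf_intros scale_vf_apply
  pairing_add_left pairing_add_right pairing_diff_left pairing_scale_left pairing_scale_right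
  act_pairing_add_left act_pairing_add_right act_pairing_scale_left act_pairing_scale_right
  lie_bracket_add_left[OF U] lie_bracket_add_right[OF U]
  lie_bracket_scale_left[OF U] lie_bracket_scale_right[OF U]

lemma koszul_smooth:
  assumes X: "X \<in> vector_fields M U" and Y: "Y \<in> vector_fields M U" and Z: "Z \<in> vector_fields M U"
  shows "koszul X Y Z \<in> smooth_functions M U"
proof -
  have d: "(\<lambda>p. A p \<langle>B, C\<rangle>) \<in> smooth_functions M U"
    if "A \<in> vector_fields M U" "B \<in> vector_fields M U" "C \<in> vector_fields M U" for A B C
    by (rule vf_smooth[OF that(1) U order_refl metric_vf_smooth[OF U that(2,3)]])
  have b: "(\<lambda>p. \<langle>lie_bracket M A B, C\<rangle> p) \<in> smooth_functions M U"
    if "A \<in> vector_fields M U" "B \<in> vector_fields M U" "C \<in> vector_fields M U" for A B C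
    using metric_vf_smooth[OF U vf_lie_bracket[OF U that(1,2)] that(3)] by simp
  show ?thesis
    unfolding koszul_def
    by (intro smooth_functions_add[OF U] smooth_functions_diff[OF U])
      (rule d[OF X Y Z] d[OF Y Z X] d[OF Z X Y] b[OF X Y Z] b[OF Y Z X] b[OF Z X Y])+
qed

context
  fixes X Y Z p
  assumes X: "X \<in> vector_fields M U" and Y: "Y \<in> vector_fields M U" and Z: "Z \<in> vector_fields M U"
    and p: "p \<in> U"
begin

lemma koszul_add:
  assumes W: "W \<in> vector_fields M U"
  shows "koszul (X + W) Y Z p = koszul X Y Z p + koszul W Y Z p"
    and "koszul X (Y + W) Z p = koszul X Y Z p + koszul X W Z p"
    and "koszul X Y (Z + W) p = koszul X Y Z p + koszul X Y W p"
  using X Y Z W p by (simp_all add: koszul_simps)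

lemma koszul_scale:
  assumes h: "h \<in> smooth_functions M U"
  shows "koszul (scale_vf h X) Y Z p = h p * koszul X Y Z p"
    and "koszul X (scale_vf h Y) Z p = h p * koszul X Y Z p + 2 * (X p h * \<langle>Y, Z\<rangle> p)"
    and "koszul X Y (scale_vf h Z) p = h p * koszul X Y Z p"
  using X Y Z h p pairing_sym[OF X Y p] pairing_sym[OF Y Z p] pairing_sym[OF Z X p]
  by (simp_all add: koszul_simps algebra_simps)

lemma pairing_bracket_antisym: "\<langle>lie_bracket M X Y, Z\<rangle> p = - \<langle>lie_bracket M Y X, Z\<rangle> p"
  using lie_bracket_antisym[of X Y] X Y Z p by (simp add: pairing_minus_left vf_lie_bracket[OF U])

end

lemma koszul_torsion:
  assumes X: "X \<in> vector_fields M U" and Y: "Y \<in> vector_fields M U" and Z: "Z \<in> vector_fields M U" and p: "p \<in> U"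
  shows "koszul X Y Z p - koszul Y X Z p = 2 * \<langle>lie_bracket M X Y, Z\<rangle> p"
  using act_pairing_sym[OF X Y Z p] act_pairing_sym[OF Y Z X p] act_pairing_sym[OF Z X Y p]
    pairing_bracket_antisym[OF X Y Z p] pairing_bracket_antisym[OF Y Z X p] pairing_bracket_antisym[OF Z X Y p]
  by (simp add: koszul_def)

lemma koszul_metric:
  assumes X: "X \<in> vector_fields M U" and Y: "Y \<in> vector_fields M U" and Z: "Z \<in> vector_fields M U" and p: "p \<in> U"
  shows "koszul X Y Z p + koszul X Z Y p = 2 * X p \<langle>Y, Z\<rangle>"
  using act_pairing_sym[OF X Y Z p] act_pairing_sym[OF Y Z X p] act_pairing_sym[OF Z X Y p]
    pairing_bracket_antisym[OF X Y Z p] pairing_bracket_antisym[OF Y Z X p] pairing_bracket_antisym[OF Z X Y p]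
  by (simp add: koszul_def)

end

lemma koszul_restrict:
  assumes X: "X \<in> vector_fields M U" and Y: "Y \<in> vector_fields M U" and V: "V \<in> opens M" "V \<subseteq> U"
    and Z: "Z \<in> vector_fields M V'" and p: "p \<in> V" "p \<in> V'"
  shows "koszul X Y Z p = koszul (restrict_vf V X) (restrict_vf V Y) Z p"
  by (rule koszul_cong[OF opensD(1)[OF V(1)] p(1)])
    (use X Y Z V p vf_tangent in \<open>auto simp: restrict_vf_def\<close>)

text \<open>Two fields on \<open>U\<close> are paired with fields on smaller sets, so each law is transferred from the
  restrictions of the two fields.\<close>

lemma koszul_one_form:
  assumes U: "U \<in> opens M" and X: "X \<in> vector_fields M U" and Y: "Y \<in> vector_fields M U"
  shows "one_form_on U (\<lambda>Z p. koszul X Y Z p / 2)"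
  unfolding one_form_on_def
proof (intro ballI impI)
  fix V Z assume V: "V \<in> opens M" "V \<subseteq> U" and Z: "Z \<in> vector_fields M V"
  let ?X = "restrict_vf V X" and ?Y = "restrict_vf V Y"
  note r = vf_restrict[OF X V(2)] vf_restrict[OF Y V(2)]
  have k: "koszul X Y Z p = koszul ?X ?Y Z p" if "Z \<in> vector_fields M V" "p \<in> V" for Z p
    using koszul_restrict[OF X Y V that(1) that(2) that(2)] .
  have "(\<lambda>p. koszul X Y Z p / 2) \<in> smooth_functions M V"
    by (rule smooth_functions_cong[OF smooth_functions_mult[OF V(1) smooth_functions_const[of "1/2"]
            koszul_smooth[OF V(1) r Z]] V(1)]) (simp add: k Z)
  moreover have "koszul X Y (Z + W) p / 2 = koszul X Y Z p / 2 + koszul X Y W p / 2"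
    if "W \<in> vector_fields M V" "p \<in> V" for W p
    using koszul_add(3)[OF V(1) r Z that(2,1)] by (simp add: k Z that vf_add)
  moreover have "koszul X Y (scale_vf h Z) p / 2 = h p * (koszul X Y Z p / 2)"
    if "h \<in> smooth_functions M V" "p \<in> V" for h p
    using koszul_scale(3)[OF V(1) r Z that(2,1)] by (simp add: k Z that vf_scale)
  moreover have "koszul X Y (restrict_vf W Z) p / 2 = koszul X Y Z p / 2"
    if W: "W \<in> opens M" "W \<subseteq> V" "p \<in> W" for W p
  proof -
    have "koszul X Y Z p = koszul X Y (restrict_vf W Z) p"
      by (rule koszul_cong[OF opensD(1)[OF W(1)] W(3)])
        (use X Y Z V W vf_tangent in \<open>auto simp: restrict_vf_def\<close>)
    then show ?thesis by simp
  qed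
  ultimately show "(\<lambda>p. koszul X Y Z p / 2) \<in> smooth_functions M V \<and>
     (\<forall>W\<in>vector_fields M V. \<forall>p\<in>V. koszul X Y (Z + W) p / 2 = koszul X Y Z p / 2 + koszul X Y W p / 2) \<and>
     (\<forall>h\<in>smooth_functions M V. \<forall>p\<in>V. koszul X Y (scale_vf h Z) p / 2 = h p * (koszul X Y Z p / 2)) \<and>
     (\<forall>W\<in>opens M. W \<subseteq> V \<longrightarrow> (\<forall>p\<in>W. koszul X Y (restrict_vf W Z) p / 2 = koszul X Y Z p / 2))"
    by blast
qed

text \<open>The explicit model of the Levi-Civita connection; outside its domain it is zero, as \<open>connection\<close> demands.\<close>

definition lc :: "'m vf_operation" where
  "lc U X Y = (if U \<in> opens M \<and> X \<in> vector_fields M U \<and> Y \<in> vector_fields M U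
     then sharp M g U (\<lambda>Z p. koszul X Y Z p / 2) else 0)"

lemma
  assumes U: "U \<in> opens M" and X: "X \<in> vector_fields M U" and Y: "Y \<in> vector_fields M U"
  shows lc_vf: "lc U X Y \<in> vector_fields M U"
    and lc_pairing_subset: "V \<in> opens M \<Longrightarrow> V \<subseteq> U \<Longrightarrow> Z \<in> vector_fields M V \<Longrightarrow> p \<in> V \<Longrightarrow>
      \<langle>lc U X Y, Z\<rangle> p = koszul X Y Z p / 2"
  using theI'[OF one_form_dual[OF U koszul_one_form[OF assms]]] assms
  by (simp_all add: lc_def sharp_def)

lemma lc_pairing:
  "U \<in> opens M \<Longrightarrow> X \<in> vector_fields M U \<Longrightarrow> Y \<in> vector_fields M U \<Longrightarrow> Z \<in> vector_fields M U \<Longrightarrow> p \<in> U \<Longrightarrow>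
    \<langle>lc U X Y, Z\<rangle> p = koszul X Y Z p / 2"
  using lc_pairing_subset by blast

lemma lc_restrict:
  assumes U: "U \<in> opens M" and X: "X \<in> vector_fields M U" and Y: "Y \<in> vector_fields M U"
    and V: "V \<in> opens M" "V \<subseteq> U"
  shows "restrict_vf V (lc U X Y) = lc V (restrict_vf V X) (restrict_vf V Y)"
proof (rule metric_vf_nondegenerate[OF V(1)])
  note r = vf_restrict[OF X V(2)] vf_restrict[OF Y V(2)]
  show "restrict_vf V (lc U X Y) \<in> vector_fields M V" using lc_vf[OF U X Y] vf_restrict V(2) by blast
  show "lc V (restrict_vf V X) (restrict_vf V Y) \<in> vector_fields M V" using lc_vf[OF V(1) r] .
  fix V' Z p assume V': "V' \<in> opens M" "V' \<subseteq> V" "Z \<in> vector_fields M V'" "p \<in> V'"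
  have "\<langle>restrict_vf V (lc U X Y), Z\<rangle> p = \<langle>lc U X Y, Z\<rangle> p"
    using V'(2,4) by (auto simp: metric_vf_def restrict_vf_def)
  also have "\<dots> = koszul X Y Z p / 2" using lc_pairing_subset[OF U X Y V'(1) _ V'(3,4)] V' V by auto
  also have "\<dots> = koszul (restrict_vf V X) (restrict_vf V Y) Z p / 2"
    using koszul_restrict[OF X Y V V'(3)] V' by auto
  also have "\<dots> = \<langle>lc V (restrict_vf V X) (restrict_vf V Y), Z\<rangle> p"
    using lc_pairing_subset[OF V(1) r V'] by simp
  finally show "\<langle>restrict_vf V (lc U X Y), Z\<rangle> p = \<langle>lc V (restrict_vf V X) (restrict_vf V Y), Z\<rangle> p" .
qed

lemma nondegenerate_small:
  assumes V: "small V" and X: "X \<in> vector_fields M V" and Y: "Y \<in> vector_fields M V"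
    and eq: "\<And>Z p. Z \<in> vector_fields M V \<Longrightarrow> p \<in> V \<Longrightarrow> \<langle>X, Z\<rangle> p = \<langle>Y, Z\<rangle> p"
  shows "X = Y"
proof (rule vf_eqI[OF X Y])
  fix p assume p: "p \<in> V"
  show "X p = Y p"
  proof (rule metric_nondegenerate)
    show "p \<in> carrier M" using opensD(2)[OF small_opens[OF V]] p by blast
    fix v assume "v \<in> tangent_space M p"
    then obtain Z where "Z \<in> vector_fields M V" "Z p = v" using small_extends[OF V p] by blast
    then show "g p (X p) v = g p (Y p) v" using eq[OF _ p] by (auto simp: metric_vf_def)
  qed (use X Y p vf_tangent in auto)
qed

text \<open>Over a small set, each law of a torsionless connection follows from the corresponding identity for the Koszul
  expression by nondegeneracy.\<close>

lemma lc_laws_small: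
  assumes V: "small V" and X: "X \<in> vector_fields M V" and Y: "Y \<in> vector_fields M V"
  shows "W \<in> vector_fields M V \<Longrightarrow> lc V (X + W) Y = lc V X Y + lc V W Y"
    and "W \<in> vector_fields M V \<Longrightarrow> lc V X (Y + W) = lc V X Y + lc V X W"
    and "h \<in> smooth_functions M V \<Longrightarrow> lc V (scale_vf h X) Y = scale_vf h (lc V X Y)"
    and "h \<in> smooth_functions M V \<Longrightarrow> lc V X (scale_vf h Y) = scale_vf (\<lambda>p. X p h) Y + scale_vf h (lc V X Y)"
    and "lc V X Y - lc V Y X = lie_bracket M X Y"
proof -
  note Vo = small_opens[OF V]
  note s = lc_vf[OF Vo] vf_intros[OF Vo] X Y lc_pairing[OF Vo] pairing_add_left[OF Vo] pairing_diff_left[OF Vo]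
    pairing_scale_left[OF Vo] koszul_add[OF Vo] koszul_scale[OF Vo]
  show "W \<in> vector_fields M V \<Longrightarrow> lc V (X + W) Y = lc V X Y + lc V W Y"
    by (rule nondegenerate_small[OF V]) (simp_all add: s add_divide_distrib)
  show "W \<in> vector_fields M V \<Longrightarrow> lc V X (Y + W) = lc V X Y + lc V X W"
    by (rule nondegenerate_small[OF V]) (simp_all add: s add_divide_distrib)
  show "h \<in> smooth_functions M V \<Longrightarrow> lc V (scale_vf h X) Y = scale_vf h (lc V X Y)"
    by (rule nondegenerate_small[OF V]) (simp_all add: s)
  show "h \<in> smooth_functions M V \<Longrightarrow> lc V X (scale_vf h Y) = scale_vf (\<lambda>p. X p h) Y + scale_vf h (lc V X Y)"
    by (rule nondegenerate_small[OF V]) (simp_all add: s add_divide_distrib)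
  show "lc V X Y - lc V Y X = lie_bracket M X Y"
    by (rule nondegenerate_small[OF V])
      (use koszul_torsion[OF Vo X Y] in \<open>simp_all add: s flip: diff_divide_distrib\<close>)
qed

lemma lc_connection: "connection M lc"
  unfolding connection_def local_operation_def
proof (intro conjI ballI impI allI)
  fix U X Y assume U: "U \<in> opens M" and X: "X \<in> vector_fields M U" and Y: "Y \<in> vector_fields M U"
  show "lc U X Y \<in> vector_fields M U" using lc_vf[OF U X Y] .
  show "lc V (restrict_vf V X) (restrict_vf V Y) = restrict_vf V (lc U X Y)" if "V \<in> opens M" "V \<subseteq> U" for V
    using lc_restrict[OF U X Y that] by simp
  note cl = lc_vf[OF U] vf_intros[OF U] X Y
  note re = restrict_vf_add restrict_vf_diff restrict_vf_scale restrict_vf_scale_derivative lc_restrict[OF U]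
    small_opens vf_restrict[OF X] vf_restrict[OF Y]
  {
    fix W assume W: "W \<in> vector_fields M U"
    show "lc U (X + Y) W = lc U X W + lc U Y W"
      by (rule vf_eq_small[OF U]) (simp_all add: cl W re vf_restrict[OF W] lc_laws_small)
    show "lc U X (Y + W) = lc U X Y + lc U X W"
      by (rule vf_eq_small[OF U]) (simp_all add: cl W re vf_restrict[OF W] lc_laws_small)
  next
    fix h assume h: "h \<in> smooth_functions M U"
    note hV = smooth_functions_subset[OF h]
    show "lc U (scale_vf h X) Y = scale_vf h (lc U X Y)"
      by (rule vf_eq_small[OF U]) (simp_all add: cl h hV re lc_laws_small)
    show "lc U X (scale_vf h Y) = scale_vf (\<lambda>p. X p h) Y + scale_vf h (lc U X Y)"
      by (rule vf_eq_small[OF U]) (simp_all add: cl h hV re lc_laws_small)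
  }
next
  fix U X Y assume "\<not> (U \<in> opens M \<and> X \<in> vector_fields M U \<and> Y \<in> vector_fields M U)"
  then show "lc U X Y = 0" unfolding lc_def by (rule if_not_P)
qed

lemma lc_torsionless: "torsionless M lc"
  unfolding torsionless_def
proof (intro ballI)
  fix U X Y assume U: "U \<in> opens M" and X: "X \<in> vector_fields M U" and Y: "Y \<in> vector_fields M U"
  show "lc U X Y - lc U Y X = lie_bracket M X Y"
    by (rule vf_eq_small[OF U])
      (simp_all add: X Y U lc_vf vf_diff vf_lie_bracket restrict_vf_diff lc_restrict[OF U] small_opens
        vf_restrict[OF X] vf_restrict[OF Y] lc_laws_small(5) restrict_lie_bracket[OF X Y])
qed

lemma lc_metric:
  assumes U: "U \<in> opens M" and X: "X \<in> vector_fields M U" and Y: "Y \<in> vector_fields M U" and Z: "Z \<in> vector_fields M U"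
    and p: "p \<in> U"
  shows "X p \<langle>Y, Z\<rangle> = \<langle>lc U X Y, Z\<rangle> p + \<langle>Y, lc U X Z\<rangle> p"
  using koszul_metric[OF U X Y Z p] pairing_sym[OF U Y lc_vf[OF U X Z] p]
  by (simp add: lc_pairing[OF U X Y Z p] lc_pairing[OF U X Z Y p])

end

text \<open>A trilinear form that is symmetric in the first two arguments and skew in the last two vanishes: six
  alternate exchanges bring the arguments back with the opposite sign.\<close>

lemma symmetric_skew_zero:
  fixes s :: "'v \<Rightarrow> 'v \<Rightarrow> 'v \<Rightarrow> real"
  assumes sym: "\<And>X Y Z. X \<in> S \<Longrightarrow> Y \<in> S \<Longrightarrow> Z \<in> S \<Longrightarrow> s X Y Z = s Y X Z"
    and skew: "\<And>X Y Z. X \<in> S \<Longrightarrow> Y \<in> S \<Longrightarrow> Z \<in> S \<Longrightarrow> s X Y Z = - s X Z Y"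
    and S: "X \<in> S" "Y \<in> S" "Z \<in> S"
  shows "s X Y Z = 0"
  using sym[of X Y Z] skew[of Y X Z] sym[of Y Z X] skew[of Z Y X] sym[of Z X Y] skew[of X Z Y] S by simp

context pseudo_riemannian_manifold
begin

lemma torsionlessD:
  "torsionless M n \<Longrightarrow> U \<in> opens M \<Longrightarrow> X \<in> vector_fields M U \<Longrightarrow> Y \<in> vector_fields M U \<Longrightarrow>
    n U X Y - n U Y X = lie_bracket M X Y"
  by (simp add: torsionless_def)

text \<open>The difference of the two connections, paired with the metric, is symmetric in the first two arguments
  by vanishing torsion and skew in the last two by the equality of the derivatives of \<open>g\<close>.\<close>

lemma torsionless_connection_unique:
  assumes n: "connection M n" "torsionless M n" and n': "connection M n'" "torsionless M n'"
    and eq: "\<And>U X Y Z p. U \<in> opens M \<Longrightarrow> X \<in> vector_fields M U \<Longrightarrow> Y \<in> vector_fields M U \<Longrightarrow>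
      Z \<in> vector_fields M U \<Longrightarrow> p \<in> U \<Longrightarrow> cov_deriv_metric g n U X Y Z p = cov_deriv_metric g n' U X Y Z p"
  shows "n = n'"
proof (intro ext)
  fix U X Y p f
  have cl: "m U X Y \<in> vector_fields M U"
    and re: "V \<in> opens M \<Longrightarrow> V \<subseteq> U \<Longrightarrow> restrict_vf V (m U X Y) = m V (restrict_vf V X) (restrict_vf V Y)"
    if "connection M m" "U \<in> opens M" "X \<in> vector_fields M U" "Y \<in> vector_fields M U" for m U V X Y
    using that by (simp_all add: connection_def local_operation_def)
  have "n U X Y = n' U X Y"
  proof (cases "U \<in> opens M \<and> X \<in> vector_fields M U \<and> Y \<in> vector_fields M U")
    case False
    then show ?thesis using n(1) n'(1) unfolding connection_def by metis
  next
    case True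
    then have U: "U \<in> opens M" and X: "X \<in> vector_fields M U" and Y: "Y \<in> vector_fields M U" by auto
    show ?thesis
    proof (rule vf_eq_small[OF U cl[OF n(1) U X Y] cl[OF n'(1) U X Y]])
      fix V assume V: "small V" "V \<subseteq> U"
      note Vo = small_opens[OF V(1)]
      let ?S = "vector_fields M V"
      have "n V X Y = n' V X Y" if XY: "X \<in> ?S" "Y \<in> ?S" for X Y
      proof (rule nondegenerate_small[OF V(1) cl[OF n(1) Vo XY] cl[OF n'(1) Vo XY]])
        fix Z p assume Z: "Z \<in> ?S" and p: "p \<in> V"
        define s where "s X Y Z = \<langle>n V X Y, Z\<rangle> p - \<langle>n' V X Y, Z\<rangle> p" for X Y Z
        have "s X Y Z = 0"
        proof (rule symmetric_skew_zero[of ?S s])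
          fix X Y Z assume XYZ: "X \<in> ?S" "Y \<in> ?S" "Z \<in> ?S"
          note c = cl[OF n(1) Vo] cl[OF n'(1) Vo]
          have "n V X Y - n V Y X = n' V X Y - n' V Y X"
            unfolding torsionlessD[OF n(2) Vo XYZ(1,2)] torsionlessD[OF n'(2) Vo XYZ(1,2)] ..
          then have "\<langle>n V X Y - n V Y X, Z\<rangle> p = \<langle>n' V X Y - n' V Y X, Z\<rangle> p" by simp
          then show "s X Y Z = s Y X Z"
            using XYZ p by (simp add: s_def pairing_diff_left[OF Vo] c)
          show "s X Y Z = - s X Z Y"
            using eq[OF Vo XYZ p] pairing_sym[OF Vo XYZ(2) c(1)[OF XYZ(1,3)] p] pairing_sym[OF Vo XYZ(2) c(2)[OF XYZ(1,3)] p]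
            by (simp add: s_def cov_deriv_metric_def)
        qed (use XY Z in auto)
        then show "\<langle>n V X Y, Z\<rangle> p = \<langle>n' V X Y, Z\<rangle> p" by (simp add: s_def)
      qed
      then show "restrict_vf V (n U X Y) = restrict_vf V (n' U X Y)"
        using re[OF n(1) U X Y Vo V(2)] re[OF n'(1) U X Y Vo V(2)] vf_restrict V(2) X Y by simp
    qed
  qed
  then show "n U X Y p f = n' U X Y p f" by simp
qed

lemma levi_civita_eq_lc: "levi_civita M g = lc"
  unfolding levi_civita_def
proof (rule the_equality)
  have lc0: "cov_deriv_metric g lc U X Y Z p = 0"
    if "U \<in> opens M" "X \<in> vector_fields M U" "Y \<in> vector_fields M U" "Z \<in> vector_fields M U" "p \<in> U" for U X Y Z p
    using lc_metric[OF that] by (simp add: cov_deriv_metric_def)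
  then show "connection M lc \<and> torsionless M lc \<and>
     (\<forall>U\<in>opens M. \<forall>X\<in>vector_fields M U. \<forall>Y\<in>vector_fields M U. \<forall>Z\<in>vector_fields M U.
        \<forall>p\<in>U. cov_deriv_metric g lc U X Y Z p = 0)"
    using lc_connection lc_torsionless by blast
  fix n assume n: "connection M n \<and> torsionless M n \<and>
     (\<forall>U\<in>opens M. \<forall>X\<in>vector_fields M U. \<forall>Y\<in>vector_fields M U. \<forall>Z\<in>vector_fields M U.
        \<forall>p\<in>U. cov_deriv_metric g n U X Y Z p = 0)"
  show "n = lc"
    by (rule torsionless_connection_unique) (use n lc_connection lc_torsionless lc0 in auto)
qed

text \<open>The flow of a Killing field preserves the metric, hence also the Levi-Civita connection. The Lie derivative
  \<open>T\<close> of the connection is symmetric by the Jacobi identity, and skew after pairing by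
  differentiating the metric property along \<open>K\<close>; so it vanishes.\<close>

lemma Killing_affine:
  assumes V: "small V" and K: "K \<in> vector_fields M V"
    and Killing: "\<And>Y Z p. Y \<in> vector_fields M V \<Longrightarrow> Z \<in> vector_fields M V \<Longrightarrow> p \<in> V \<Longrightarrow>
      K p \<langle>Y, Z\<rangle> = \<langle>lie_bracket M K Y, Z\<rangle> p + \<langle>Y, lie_bracket M K Z\<rangle> p"
    and Y: "Y \<in> vector_fields M V" and Z: "Z \<in> vector_fields M V"
  shows "lie_bracket M K (lc V Y Z) = lc V (lie_bracket M K Y) Z + lc V Y (lie_bracket M K Z)"
proof -
  note Vo = small_opens[OF V]
  let ?S = "vector_fields M V" and ?b = "lie_bracket M K"
  define T where "T Y Z = ?b (lc V Y Z) - lc V (?b Y) Z - lc V Y (?b Z)" for Y Z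
  note cl = lc_vf[OF Vo] vf_lie_bracket[OF Vo] vf_diff
  have T: "T Y Z \<in> ?S" if "Y \<in> ?S" "Z \<in> ?S" for Y Z
    unfolding T_def by (intro cl K that)
  have tor: "lc V X Y = lc V Y X + lie_bracket M X Y" if "X \<in> ?S" "Y \<in> ?S" for X Y
    using lc_laws_small(5)[OF V that] by (simp add: algebra_simps)
  have T_sym: "T Y Z = T Z Y" if Y: "Y \<in> ?S" and Z: "Z \<in> ?S" for Y Z
  proof -
    have "?b (lc V Y Z) = ?b (lc V Z Y) + ?b (lie_bracket M Y Z)"
      unfolding tor[OF Y Z] by (intro lie_bracket_add_right[OF Vo K] cl Y Z)
    moreover have "lc V (?b Y) Z = lc V Z (?b Y) + lie_bracket M (?b Y) Z"
      by (intro tor cl K Y Z)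
    moreover have "lc V Y (?b Z) = lc V (?b Z) Y + lie_bracket M Y (?b Z)"
      by (intro tor cl K Y Z)
    ultimately show ?thesis
      unfolding T_def Jacobi[OF Vo K Y Z] by simp
  qed
  have T_skew: "\<langle>T Y Z, W\<rangle> p = - \<langle>T Y W, Z\<rangle> p"
    if Y: "Y \<in> ?S" and Z: "Z \<in> ?S" and W: "W \<in> ?S" and p: "p \<in> V" for Y Z W p
  proof -
    note [simp] = Y Z W p K cl pairing_diff_left[OF Vo]
    have e: "K p \<langle>lc V Y Z, W\<rangle> = \<langle>?b (lc V Y Z), W\<rangle> p + \<langle>lc V Y Z, ?b W\<rangle> p"
      "K p \<langle>lc V Y W, Z\<rangle> = \<langle>?b (lc V Y W), Z\<rangle> p + \<langle>lc V Y W, ?b Z\<rangle> p"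
      by (rule Killing; simp)+
    have m: "\<langle>lc V (?b Y) Z, W\<rangle> p + \<langle>lc V (?b Y) W, Z\<rangle> p = ?b Y p \<langle>Z, W\<rangle>"
      "\<langle>lc V Y (?b Z), W\<rangle> p + \<langle>lc V Y W, ?b Z\<rangle> p = Y p \<langle>?b Z, W\<rangle>"
      "\<langle>lc V Y (?b W), Z\<rangle> p + \<langle>lc V Y Z, ?b W\<rangle> p = Y p \<langle>Z, ?b W\<rangle>"
      using lc_metric[OF Vo, of "?b Y" Z W p] lc_metric[OF Vo, of Y "?b Z" W p] lc_metric[OF Vo, of Y Z "?b W" p]
        pairing_sym[OF Vo, of Z "lc V (?b Y) W" p] pairing_sym[OF Vo, of "?b Z" "lc V Y W" p]
        pairing_sym[OF Vo, of Z "lc V Y (?b W)" p]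
      by simp_all
    have sm: "\<langle>X, X'\<rangle> \<in> smooth_functions M V" if "X \<in> ?S" "X' \<in> ?S" for X X'
      using metric_vf_smooth[OF Vo that] .
    have "K p (\<lambda>q. Y q \<langle>Z, W\<rangle>) = K p (\<lambda>q. \<langle>lc V Y Z, W\<rangle> q + \<langle>lc V Y W, Z\<rangle> q)"
      by (rule act_cong[OF Vo K p]) (simp add: lc_metric[OF Vo] pairing_sym[OF Vo, of Z "lc V Y W"])
    then have "K p (\<lambda>q. Y q \<langle>Z, W\<rangle>) = K p \<langle>lc V Y Z, W\<rangle> + K p \<langle>lc V Y W, Z\<rangle>"
      by (simp add: act_add[OF Vo] sm)
    moreover have "Y p (\<lambda>q. K q \<langle>Z, W\<rangle>) = Y p (\<lambda>q. \<langle>?b Z, W\<rangle> q + \<langle>Z, ?b W\<rangle> q)"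
      by (rule act_cong[OF Vo Y p]) (simp add: Killing)
    then have "Y p (\<lambda>q. K q \<langle>Z, W\<rangle>) = Y p \<langle>?b Z, W\<rangle> + Y p \<langle>Z, ?b W\<rangle>"
      by (simp add: act_add[OF Vo] sm)
    moreover have "?b Y p \<langle>Z, W\<rangle> = K p (\<lambda>q. Y q \<langle>Z, W\<rangle>) - Y p (\<lambda>q. K q \<langle>Z, W\<rangle>)"
      by (rule lie_bracket_derivation[OF Vo K Y sm[OF Z W] p])
    ultimately show ?thesis using e m by (simp add: T_def)
  qed
  have "T Y Z = 0"
  proof (rule nondegenerate_small[OF V T[OF Y Z] vf_0])
    fix W p assume W: "W \<in> ?S" and p: "p \<in> V"
    have "\<langle>T Y Z, W\<rangle> p = 0"
    proof (rule symmetric_skew_zero[where s="\<lambda>X Y Z. \<langle>T X Y, Z\<rangle> p" and S="?S"])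
      fix X Y Z assume XYZ: "X \<in> ?S" "Y \<in> ?S" "Z \<in> ?S"
      show "\<langle>T X Y, Z\<rangle> p = \<langle>T Y X, Z\<rangle> p" using T_sym[OF XYZ(1,2)] by (rule arg_cong)
      show "\<langle>T X Y, Z\<rangle> p = - \<langle>T X Z, Y\<rangle> p" by (rule T_skew[OF XYZ p])
    qed (rule Y Z W)+
    moreover have "\<langle>0, W\<rangle> p = 0"
      using pairing_diff_left[OF Vo W W W p] by simp
    ultimately show "\<langle>T Y Z, W\<rangle> p = \<langle>0, W\<rangle> p" by simp
  qed
  then show ?thesis by (simp add: T_def algebra_simps)
qed

end

section \<open>Algebra of the corrected connection\<close>

text \<open>Vector fields over a small set, stripped of everything but the laws that enter the theorem: \<open>ip\<close> is the metric,
  \<open>act\<close> differentiates functions, \<open>br\<close> is the bracket, \<open>n\<close> the Levi-Civita connection. The functions on which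
  \<open>ip\<close> takes its values are compared as functions on the whole type, so in the application \<open>ip\<close> is cut off
  outside the domain. The carrier \<open>S\<close> is needed as the vector fields over a given set do not form a type.\<close>

locale killing_F_algebra =
  fixes S :: "'v::ab_group_add set"
    and ip :: "'v \<Rightarrow> 'v \<Rightarrow> 'p \<Rightarrow> real" and act :: "'v \<Rightarrow> ('p \<Rightarrow> real) \<Rightarrow> 'p \<Rightarrow> real"
    and br n :: "'v \<Rightarrow> 'v \<Rightarrow> 'v" and m :: "'v \<Rightarrow> 'v \<Rightarrow> 'v" (infixl "\<star>" 70) and e :: 'v
  assumes closed [simp]: "X \<in> S \<Longrightarrow> Y \<in> S \<Longrightarrow> X + Y \<in> S" "X \<in> S \<Longrightarrow> Y \<in> S \<Longrightarrow> X - Y \<in> S"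
      "X \<in> S \<Longrightarrow> Y \<in> S \<Longrightarrow> n X Y \<in> S" "X \<in> S \<Longrightarrow> Y \<in> S \<Longrightarrow> X \<star> Y \<in> S" "e \<in> S"
    and ip_add_left [simp]: "X \<in> S \<Longrightarrow> Y \<in> S \<Longrightarrow> Z \<in> S \<Longrightarrow> ip (X + Y) Z p = ip X Z p + ip Y Z p"
    and ip_sym: "X \<in> S \<Longrightarrow> Y \<in> S \<Longrightarrow> ip X Y = ip Y X"
    and nondegenerate: "X \<in> S \<Longrightarrow> Y \<in> S \<Longrightarrow> (\<And>Z p. Z \<in> S \<Longrightarrow> ip X Z p = ip Y Z p) \<Longrightarrow> X = Y"
    and n_add_left [simp]: "X \<in> S \<Longrightarrow> Y \<in> S \<Longrightarrow> Z \<in> S \<Longrightarrow> n (X + Y) Z = n X Z + n Y Z"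
    and n_add_right [simp]: "X \<in> S \<Longrightarrow> Y \<in> S \<Longrightarrow> Z \<in> S \<Longrightarrow> n X (Y + Z) = n X Y + n X Z"
    and n_torsionless: "X \<in> S \<Longrightarrow> Y \<in> S \<Longrightarrow> br X Y = n X Y - n Y X"
    and n_metric: "X \<in> S \<Longrightarrow> Y \<in> S \<Longrightarrow> Z \<in> S \<Longrightarrow> act X (ip Y Z) p = ip (n X Y) Z p + ip Y (n X Z) p"
    and m_add_left [simp]: "X \<in> S \<Longrightarrow> Y \<in> S \<Longrightarrow> Z \<in> S \<Longrightarrow> (X + Y) \<star> Z = X \<star> Z + Y \<star> Z"
    and m_commute: "X \<in> S \<Longrightarrow> Y \<in> S \<Longrightarrow> X \<star> Y = Y \<star> X"
    and m_assoc: "X \<in> S \<Longrightarrow> Y \<in> S \<Longrightarrow> Z \<in> S \<Longrightarrow> X \<star> Y \<star> Z = X \<star> (Y \<star> Z)"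
    and unit_left [simp]: "X \<in> S \<Longrightarrow> e \<star> X = X"
    and invariant: "X \<in> S \<Longrightarrow> Y \<in> S \<Longrightarrow> Z \<in> S \<Longrightarrow> ip (X \<star> Y) Z = ip X (Y \<star> Z)"
    and Hertling_Manin: "X \<in> S \<Longrightarrow> Y \<in> S \<Longrightarrow> Z \<in> S \<Longrightarrow> W \<in> S \<Longrightarrow>
      br (X \<star> Y) (Z \<star> W) - br (X \<star> Y) Z \<star> W - Z \<star> br (X \<star> Y) W =
        X \<star> (br Y (Z \<star> W) - br Y Z \<star> W - Z \<star> br Y W) + Y \<star> (br X (Z \<star> W) - br X Z \<star> W - Z \<star> br X W)"
    and Killing: "X \<in> S \<Longrightarrow> Y \<in> S \<Longrightarrow> act e (ip X Y) p = ip (br e X) Y p + ip X (br e Y) p"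
    and affine: "X \<in> S \<Longrightarrow> Y \<in> S \<Longrightarrow> br e (n X Y) = n (br e X) Y + n X (br e Y)"
begin

lemma m_left_commute: "X \<in> S \<Longrightarrow> Y \<in> S \<Longrightarrow> Z \<in> S \<Longrightarrow> X \<star> (Y \<star> Z) = Y \<star> (X \<star> Z)"
  by (metis m_assoc m_commute)

lemmas m_ac = m_assoc m_commute m_left_commute

lemma unit_right [simp]: "X \<in> S \<Longrightarrow> X \<star> e = X"
  using m_commute[of X e] by simp

lemma m_add_right [simp]: "X \<in> S \<Longrightarrow> Y \<in> S \<Longrightarrow> Z \<in> S \<Longrightarrow> X \<star> (Y + Z) = X \<star> Y + X \<star> Z"
  using m_commute[of X "Y + Z"] m_commute[of X Y] m_commute[of X Z] by simp

lemma m_diff_left [simp]: "X \<in> S \<Longrightarrow> Y \<in> S \<Longrightarrow> Z \<in> S \<Longrightarrow> (X - Y) \<star> Z = X \<star> Z - Y \<star> Z"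
  using m_add_left[of "X - Y" Y Z] by (simp del: m_add_left)

lemma m_diff_right [simp]: "X \<in> S \<Longrightarrow> Y \<in> S \<Longrightarrow> Z \<in> S \<Longrightarrow> X \<star> (Y - Z) = X \<star> Y - X \<star> Z"
  using m_add_right[of X "Y - Z" Z] by (simp del: m_add_right)

lemma n_diff_left [simp]: "X \<in> S \<Longrightarrow> Y \<in> S \<Longrightarrow> Z \<in> S \<Longrightarrow> n (X - Y) Z = n X Z - n Y Z"
  using n_add_left[of "X - Y" Y Z] by (simp del: n_add_left)

lemma n_diff_right [simp]: "X \<in> S \<Longrightarrow> Y \<in> S \<Longrightarrow> Z \<in> S \<Longrightarrow> n X (Y - Z) = n X Y - n X Z"
  using n_add_right[of X "Y - Z" Z] by (simp del: n_add_right)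

lemma ip_diff_left [simp]: "X \<in> S \<Longrightarrow> Y \<in> S \<Longrightarrow> Z \<in> S \<Longrightarrow> ip (X - Y) Z p = ip X Z p - ip Y Z p"
  using ip_add_left[of "X - Y" Y Z p] by (simp del: ip_add_left)

lemma ip_diff_right [simp]: "X \<in> S \<Longrightarrow> Y \<in> S \<Longrightarrow> Z \<in> S \<Longrightarrow> ip X (Y - Z) p = ip X Y p - ip X Z p"
  using ip_sym[of X "Y - Z"] ip_sym[of X Y] ip_sym[of X Z] by simp

lemma br_closed [simp]: "X \<in> S \<Longrightarrow> Y \<in> S \<Longrightarrow> br X Y \<in> S"
  by (simp add: n_torsionless)

text \<open>\<open>A\<close> is the covariant derivative of the unit, \<open>nab\<close> the connection of the theorem, and \<open>R f\<close> the curvature of \<open>f\<close>.\<close>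

definition A where "A X = n X e"

definition nab where "nab X Y = n X Y - A (X \<star> Y)"

definition R where "R f X Y Z = f X (f Y Z) - f Y (f X Z) - f (br X Y) Z"

lemma A_closed [simp]: "X \<in> S \<Longrightarrow> A X \<in> S"
  by (simp add: A_def)

lemma A_add [simp]: "X \<in> S \<Longrightarrow> Y \<in> S \<Longrightarrow> A (X + Y) = A X + A Y"
  by (simp add: A_def)

lemma A_diff [simp]: "X \<in> S \<Longrightarrow> Y \<in> S \<Longrightarrow> A (X - Y) = A X - A Y"
  by (simp add: A_def)

lemma nab_closed [simp]: "X \<in> S \<Longrightarrow> Y \<in> S \<Longrightarrow> nab X Y \<in> S"
  by (simp add: nab_def)

lemma nab_add_right [simp]: "X \<in> S \<Longrightarrow> Y \<in> S \<Longrightarrow> Z \<in> S \<Longrightarrow> nab X (Y + Z) = nab X Y + nab X Z"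
  by (simp add: nab_def)

lemma nab_diff_left [simp]: "X \<in> S \<Longrightarrow> Y \<in> S \<Longrightarrow> Z \<in> S \<Longrightarrow> nab (X - Y) Z = nab X Z - nab Y Z"
  by (simp add: nab_def)

lemma nab_torsionless: "X \<in> S \<Longrightarrow> Y \<in> S \<Longrightarrow> nab X Y - nab Y X = br X Y"
  by (simp add: nab_def n_torsionless m_commute)

text \<open>The Killing equation, with the bracket expressed by the torsionless metric connection.\<close>

lemma A_skew: "X \<in> S \<Longrightarrow> Y \<in> S \<Longrightarrow> ip (A X) Y p = - ip (A Y) X p"
  using Killing[of X Y p] n_metric[of e X Y p] ip_sym[of X "n Y e"]
  by (simp add: n_torsionless A_def)

text \<open>The covariant derivative of the product.\<close>

definition Dm where "Dm X Y Z = n X (Y \<star> Z) - n X Y \<star> Z - Y \<star> n X Z"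

lemma Dm_closed [simp]: "X \<in> S \<Longrightarrow> Y \<in> S \<Longrightarrow> Z \<in> S \<Longrightarrow> Dm X Y Z \<in> S"
  by (simp add: Dm_def)

lemma ip_Dm:
  assumes [simp]: "X \<in> S" "Y \<in> S" "Z \<in> S" "W \<in> S"
  shows "ip (Dm X Y Z) W p = act X (ip (Y \<star> Z) W) p
    - ip (n X W) (Y \<star> Z) p - ip (n X Y) (Z \<star> W) p - ip (n X Z) (Y \<star> W) p"
  using n_metric[of X "Y \<star> Z" W p] ip_sym[of "Y \<star> Z" "n X W"] invariant[of "n X Y" Z W]
    invariant[of "n X Z" Y W] m_commute[of Y "n X Z"]
  by (simp add: Dm_def)

lemma Dm_sym: "X \<in> S \<Longrightarrow> Y \<in> S \<Longrightarrow> Z \<in> S \<Longrightarrow> Dm X Y Z = Dm X Z Y"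
  by (simp add: Dm_def m_commute)

text \<open>By invariance, \<open>ip (Dm X Y Z) W\<close> is the derivative of the symmetric trilinear form \<open>ip (Y \<star> Z) W\<close>.\<close>

lemma ip_Dm_sym:
  assumes [simp]: "X \<in> S" "Y \<in> S" "Z \<in> S" "W \<in> S"
  shows "ip (Dm X Y Z) W p = ip (Dm X Y W) Z p"
proof -
  have "ip (Y \<star> Z) W = ip (Y \<star> W) Z"
    using invariant[of Y Z W] invariant[of Y W Z] m_commute[of Z W] by simp
  then show ?thesis by (simp add: ip_Dm m_commute[of W Z])
qed

text \<open>Pairing the product with the unit gives the metric, which is parallel; only the derivative of the unit
  remains.\<close>

lemma ip_Dm_unit:
  assumes [simp]: "X \<in> S" "Y \<in> S" "Z \<in> S"
  shows "ip (Dm X Y Z) e p = - ip (A X) (Y \<star> Z) p"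
proof -
  have "ip (Y \<star> Z) e = ip Y Z" using invariant[of Y Z e] by simp
  then show ?thesis
    using n_metric[of X Y Z p] ip_sym[of Y "n X Z"] by (simp add: ip_Dm A_def)
qed

text \<open>Each Lie derivative of the product equals the covariant derivative \<open>Dm\<close> up to terms that differentiate the
  direction. The remaining such terms combine to derivatives of products, that is, to further values
  of \<open>Dm\<close>.\<close>

lemma Hertling_Manin_covariant:
  assumes [simp]: "X \<in> S" "Y \<in> S" "Z \<in> S" "W \<in> S"
  shows "Dm (X \<star> Y) Z W + W \<star> Dm Z X Y + Z \<star> Dm W X Y = X \<star> Dm Y Z W + Y \<star> Dm X Z W + Dm (Z \<star> W) X Y"
  using Hertling_Manin[of X Y Z W]
  by (simp add: Dm_def n_torsionless m_ac algebra_simps)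

text \<open>The previous identity paired with the unit. The two terms differentiated along a product become terms in
  \<open>A\<close>, which agree by skewness and produce the factor two.\<close>

lemma Dm_exchange_pairs:
  assumes [simp]: "X \<in> S" "Y \<in> S" "Z \<in> S" "W \<in> S"
  shows "ip (Dm Z X Y) W p + ip (Dm W X Y) Z p - ip (Dm X Y Z) W p - ip (Dm Y X Z) W p
    = 2 * ip (A (X \<star> Y)) (Z \<star> W) p"
proof -
  have unit: "ip (U \<star> V) e p = ip V U p" if "U \<in> S" "V \<in> S" for U V
    using invariant[of V U e] m_commute[of U V] that by simp
  have "ip (Dm (X \<star> Y) Z W) e p + ip (Dm Z X Y) W p + ip (Dm W X Y) Z p =
      ip (Dm Y Z W) X p + ip (Dm X Z W) Y p + ip (Dm (Z \<star> W) X Y) e p"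
    using arg_cong[OF Hertling_Manin_covariant[of X Y Z W], of "\<lambda>U. ip U e p"] by (simp add: unit)
  moreover have "ip (Dm Y Z W) X p = ip (Dm Y X Z) W p"
    using ip_Dm_sym[of Y Z W X p] Dm_sym[of Y Z X] by simp
  moreover have "ip (Dm X Z W) Y p = ip (Dm X Y Z) W p"
    using ip_Dm_sym[of X Z W Y p] Dm_sym[of X Z Y] by simp
  ultimately show ?thesis
    using A_skew[of "Z \<star> W" "X \<star> Y" p] by (simp add: ip_Dm_unit)
qed

text \<open>Write \<open>a, b, c, d\<close> for \<open>ip (Dm _ _ _) _\<close> with derivative along \<open>X, Y, Z, W\<close>. Exchanging pairs for the splittings
  \<open>XZ|YW\<close> and \<open>XW|YZ\<close> gives \<open>b + d - a - c\<close> and \<open>c + b - a - d\<close>, whose sum is \<open>2 (b - a)\<close>.\<close>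

lemma Dm_exchange:
  assumes [simp]: "X \<in> S" "Y \<in> S" "Z \<in> S" "W \<in> S"
  shows "ip (Dm Y X Z) W p - ip (Dm X Y Z) W p =
    ip (A (X \<star> Z)) (Y \<star> W) p + ip (A (X \<star> W)) (Y \<star> Z) p"
proof -
  have "ip (Dm Y X Z) W p + ip (Dm W X Z) Y p - ip (Dm X Z Y) W p - ip (Dm Z X Y) W p
    = 2 * ip (A (X \<star> Z)) (Y \<star> W) p"
    using Dm_exchange_pairs[of X Z Y W p] by simp
  moreover have "ip (Dm Z X W) Y p + ip (Dm Y X W) Z p - ip (Dm X W Z) Y p - ip (Dm W X Z) Y p
    = 2 * ip (A (X \<star> W)) (Z \<star> Y) p"
    using Dm_exchange_pairs[of X W Z Y p] by simp
  moreover have "ip (Dm Z X W) Y p = ip (Dm Z X Y) W p" "ip (Dm Y X W) Z p = ip (Dm Y X Z) W p"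
    using ip_Dm_sym[of Z X W Y p] ip_Dm_sym[of Y X W Z p] by simp_all
  moreover have "ip (Dm X W Z) Y p = ip (Dm X Y Z) W p" "ip (Dm X Z Y) W p = ip (Dm X Y Z) W p"
    using ip_Dm_sym[of X Z W Y p] Dm_sym[of X W Z] Dm_sym[of X Z Y] by simp_all
  ultimately show ?thesis using m_commute[of Z Y] by simp
qed

text \<open>The correction of the connection adds to \<open>ip (Dm X Y Z) W\<close> the terms in \<open>A\<close> listed in \<open>E\<close>. Their change under exchange
  of \<open>X\<close> and \<open>Y\<close> is the opposite of that of \<open>ip (Dm X Y Z) W\<close>.\<close>

lemma nab_compatible:
  assumes [simp]: "X \<in> S" "Y \<in> S" "Z \<in> S"
  shows "nab X (Y \<star> Z) - nab X Y \<star> Z - Y \<star> nab X Z = nab Y (X \<star> Z) - nab Y X \<star> Z - X \<star> nab Y Z"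
proof (rule nondegenerate)
  have E: "ip (nab X (Y \<star> Z) - nab X Y \<star> Z - Y \<star> nab X Z) W p =
      ip (Dm X Y Z) W p - ip (A (X \<star> (Y \<star> Z))) W p + ip (A (X \<star> Y)) (Z \<star> W) p + ip (A (X \<star> Z)) (Y \<star> W) p"
    if [simp]: "X \<in> S" "Y \<in> S" "Z \<in> S" "W \<in> S" for X Y Z W p
    using invariant[of "A (X \<star> Y)" Z W] invariant[of "A (X \<star> Z)" Y W] m_commute[of Y "A (X \<star> Z)"]
    by (simp add: nab_def Dm_def)
  fix W p assume [simp]: "W \<in> S"
  show "ip (nab X (Y \<star> Z) - nab X Y \<star> Z - Y \<star> nab X Z) W p =
      ip (nab Y (X \<star> Z) - nab Y X \<star> Z - X \<star> nab Y Z) W p"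
    using Dm_exchange[of X Y Z W p] A_skew[of "X \<star> W" "Y \<star> Z" p] m_left_commute[of X Y Z] m_commute[of X Y]
    by (simp add: E del: ip_diff_left)
qed simp_all

text \<open>Symmetry of the covariant derivative of the product turns \<open>Y \<star> nab Z V - Z \<star> nab Y V - br Y Z \<star> V\<close>, to which \<open>A\<close> is
  applied, into \<open>nab Z (Y \<star> V) - nab Y (Z \<star> V)\<close>.\<close>

lemma curvature_difference:
  assumes [simp]: "Y \<in> S" "Z \<in> S" "V \<in> S"
  defines "P \<equiv> \<lambda>Y U. nab Y (A U) - A (nab Y U) + A (Y \<star> A U)"
  shows "R n Y Z V = R nab Y Z V + P Y (Z \<star> V) - P Z (Y \<star> V)"
proof -
  have n: "n X U = nab X U + A (X \<star> U)" for X U by (simp add: nab_def)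
  have nn: "n X (n X' V) = nab X (nab X' V) + nab X (A (X' \<star> V)) + A (X \<star> nab X' V) + A (X \<star> A (X' \<star> V))"
    if [simp]: "X \<in> S" "X' \<in> S" for X X'
    unfolding n[of X' V] n[of X "nab X' V + A (X' \<star> V)"] by (simp add: add.assoc)
  have b: "n (br Y Z) V = nab (br Y Z) V + A (nab Y Z \<star> V) - A (nab Z Y \<star> V)"
    unfolding n[of "br Y Z" V] by (simp flip: nab_torsionless)
  have "A (nab Y (Z \<star> V)) - A (nab Y Z \<star> V) - A (Z \<star> nab Y V) =
      A (nab Z (Y \<star> V)) - A (nab Z Y \<star> V) - A (Y \<star> nab Z V)"
    using arg_cong[OF nab_compatible[of Y Z V], of A] by simp
  then have c: "A (nab Y (Z \<star> V)) =
      A (nab Z (Y \<star> V)) - A (nab Z Y \<star> V) - A (Y \<star> nab Z V) + A (Z \<star> nab Y V) + A (nab Y Z \<star> V)"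
    by (metis diff_add_cancel)
  show ?thesis
    by (simp add: R_def P_def b c nn)
qed

text \<open>For \<open>X = Y = e\<close>, the Hertling-Manin condition says that the Lie derivative of the product along \<open>e\<close> equals
  twice itself.\<close>

lemma product_invariant:
  assumes [simp]: "X \<in> S" "Y \<in> S"
  shows "br e (X \<star> Y) = br e X \<star> Y + X \<star> br e Y"
  using Hertling_Manin[of e e X Y] by (simp add: algebra_simps)

text \<open>The bracket with \<open>e\<close> is a derivation of \<open>nab\<close>, because it is one of \<open>n\<close> and of the product, and it coincides with \<open>nab e\<close>
  because \<open>e\<close> is parallel.\<close>

lemma R_nab_unit:
  assumes [simp]: "Y \<in> S" "Z \<in> S"
  shows "R nab e Y Z = 0"
proof -
  have e: "nab e U = br e U" if "U \<in> S" for U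
    using that by (simp add: nab_def A_def n_torsionless)
  have "br e e = 0" by (simp add: n_torsionless)
  then have A: "br e (A U) = A (br e U)" if "U \<in> S" for U
    using affine[OF that, of e] n_diff_right[of U e e] that by (simp add: A_def)
  have "br e (nab Y Z) = br e (n Y Z) - br e (A (Y \<star> Z))"
    by (simp add: nab_def n_torsionless A_def algebra_simps)
  also have "\<dots> = nab (br e Y) Z + nab Y (br e Z)"
    by (simp add: A affine product_invariant nab_def)
  finally show ?thesis by (simp add: R_def e)
qed

text \<open>By \<open>curvature_difference\<close> the cyclic condition passes from \<open>n\<close> to \<open>nab\<close>. With \<open>X = e\<close>, only one of its three terms
  survives.\<close>

lemma nab_flat:
  assumes curvature: "\<And>X Y Z W. X \<in> S \<Longrightarrow> Y \<in> S \<Longrightarrow> Z \<in> S \<Longrightarrow> W \<in> S \<Longrightarrow>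
      R n Y Z (X \<star> W) + R n X Y (Z \<star> W) + R n Z X (Y \<star> W) = 0"
    and [simp]: "Y \<in> S" "Z \<in> S" "W \<in> S"
  shows "R nab Y Z W = 0"
proof -
  have "R nab Y Z (e \<star> W) + R nab e Y (Z \<star> W) + R nab Z e (Y \<star> W) = 0"
    using curvature[of e Y Z W] m_left_commute[of Y Z W]
    by (simp add: curvature_difference)
  moreover have "R nab Z e (Y \<star> W) = - R nab e Z (Y \<star> W)"
    by (simp add: R_def n_torsionless)
  ultimately show ?thesis by (simp add: R_nab_unit)
qed

end

section \<open>Riemannian F-manifolds with Killing unit\<close>

locale Killing_F_manifold = pseudo_riemannian_manifold M g
  for M :: "('m::{t2_space, second_countable_topology}, 'e::euclidean_space) chart set" and g +
  fixes c :: "'m vf_operation" and e :: "'m vector_field"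
  assumes Killing_F: "riemannian_F_manifold_Killing M c g e"
begin

lemma unital: "unital_product M c e"
  using Killing_F by (simp add: riemannian_F_manifold_Killing_def F_manifold_def)

lemma unit_vf: "e \<in> vector_fields M (carrier M)"
  using unital by (simp add: unital_product_def)

context
  fixes U assumes U: "U \<in> opens M"
begin

lemma unit_restrict_vf: "restrict_vf U e \<in> vector_fields M U"
  using vf_restrict[OF unit_vf opensD(2)[OF U]] .

lemma product_vf: "X \<in> vector_fields M U \<Longrightarrow> Y \<in> vector_fields M U \<Longrightarrow> c U X Y \<in> vector_fields M U"
  using unital U by (simp add: unital_product_def local_operation_def)

lemma product_restrict:
  "X \<in> vector_fields M U \<Longrightarrow> Y \<in> vector_fields M U \<Longrightarrow> V \<in> opens M \<Longrightarrow> V \<subseteq> U \<Longrightarrow>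
    restrict_vf V (c U X Y) = c V (restrict_vf V X) (restrict_vf V Y)"
  using unital U by (simp add: unital_product_def local_operation_def)

lemma product_add_left:
  "X \<in> vector_fields M U \<Longrightarrow> Y \<in> vector_fields M U \<Longrightarrow> Z \<in> vector_fields M U \<Longrightarrow> c U (X + Y) Z = c U X Z + c U Y Z"
  using unital U by (simp add: unital_product_def)

lemma product_add_right:
  "X \<in> vector_fields M U \<Longrightarrow> Y \<in> vector_fields M U \<Longrightarrow> Z \<in> vector_fields M U \<Longrightarrow> c U X (Y + Z) = c U X Y + c U X Z"
  using unital U by (simp add: unital_product_def)

lemma product_assoc:
  "X \<in> vector_fields M U \<Longrightarrow> Y \<in> vector_fields M U \<Longrightarrow> Z \<in> vector_fields M U \<Longrightarrow> c U (c U X Y) Z = c U X (c U Y Z)"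
  using unital U by (simp add: unital_product_def)

lemma product_scale:
  "h \<in> smooth_functions M U \<Longrightarrow> X \<in> vector_fields M U \<Longrightarrow> Y \<in> vector_fields M U \<Longrightarrow> c U (scale_vf h X) Y = scale_vf h (c U X Y)"
  "h \<in> smooth_functions M U \<Longrightarrow> X \<in> vector_fields M U \<Longrightarrow> Y \<in> vector_fields M U \<Longrightarrow> c U X (scale_vf h Y) = scale_vf h (c U X Y)"
  using unital U by (simp_all add: unital_product_def)

lemma product_commute:
  "X \<in> vector_fields M U \<Longrightarrow> Y \<in> vector_fields M U \<Longrightarrow> c U X Y = c U Y X"
  using unital U unfolding unital_product_def by blast

lemma product_unit: "X \<in> vector_fields M U \<Longrightarrow> c U (restrict_vf U e) X = X"
  using unital U by (simp add: unital_product_def)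

lemma pairing_invariant:
  "X \<in> vector_fields M U \<Longrightarrow> Y \<in> vector_fields M U \<Longrightarrow> Z \<in> vector_fields M U \<Longrightarrow> p \<in> U \<Longrightarrow>
    \<langle>c U X Y, Z\<rangle> p = \<langle>X, c U Y Z\<rangle> p"
  using Killing_F U by (simp add: riemannian_F_manifold_Killing_def)

lemma lie_deriv_product_product:
  "X \<in> vector_fields M U \<Longrightarrow> Y \<in> vector_fields M U \<Longrightarrow> Z \<in> vector_fields M U \<Longrightarrow> W \<in> vector_fields M U \<Longrightarrow>
    lie_deriv_product M c U (c U X Y) Z W =
      c U X (lie_deriv_product M c U Y Z W) + c U Y (lie_deriv_product M c U X Z W)"
  using Killing_F U by (simp add: riemannian_F_manifold_Killing_def F_manifold_def)

lemma curvature_condition: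
  "X \<in> vector_fields M U \<Longrightarrow> Y \<in> vector_fields M U \<Longrightarrow> Z \<in> vector_fields M U \<Longrightarrow> W \<in> vector_fields M U \<Longrightarrow>
    riemann M lc U Y Z (c U X W) + riemann M lc U X Y (c U Z W) + riemann M lc U Z X (c U Y W) = 0"
  using Killing_F U by (simp add: riemannian_F_manifold_Killing_def levi_civita_eq_lc Let_def)

lemma unit_Killing:
  assumes "Y \<in> vector_fields M U" "Z \<in> vector_fields M U" "p \<in> U"
  shows "restrict_vf U e p \<langle>Y, Z\<rangle> =
      \<langle>lie_bracket M (restrict_vf U e) Y, Z\<rangle> p + \<langle>Y, lie_bracket M (restrict_vf U e) Z\<rangle> p"
proof -
  have "lie_deriv_metric M g (restrict_vf U e) Y Z p = 0"
    using Killing_F U assms by (simp add: riemannian_F_manifold_Killing_def)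
  then show ?thesis by (simp add: lie_deriv_metric_def)
qed

lemma lc_add_left:
  "X \<in> vector_fields M U \<Longrightarrow> Y \<in> vector_fields M U \<Longrightarrow> Z \<in> vector_fields M U \<Longrightarrow> lc U (X + Y) Z = lc U X Z + lc U Y Z"
  using lc_connection U by (simp add: connection_def)

lemma lc_add_right:
  "X \<in> vector_fields M U \<Longrightarrow> Y \<in> vector_fields M U \<Longrightarrow> Z \<in> vector_fields M U \<Longrightarrow> lc U X (Y + Z) = lc U X Y + lc U X Z"
  using lc_connection U by (simp add: connection_def)

lemma lc_scale:
  "h \<in> smooth_functions M U \<Longrightarrow> X \<in> vector_fields M U \<Longrightarrow> Y \<in> vector_fields M U \<Longrightarrow>
    lc U (scale_vf h X) Y = scale_vf h (lc U X Y)"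
  "h \<in> smooth_functions M U \<Longrightarrow> X \<in> vector_fields M U \<Longrightarrow> Y \<in> vector_fields M U \<Longrightarrow>
    lc U X (scale_vf h Y) = scale_vf (\<lambda>p. X p h) Y + scale_vf h (lc U X Y)"
  using lc_connection U by (simp_all add: connection_def)

text \<open>The Killing equation says that the covariant derivative of the unit is a skew endomorphism.\<close>

lemma derivative_unit_skew:
  assumes X: "X \<in> vector_fields M U" and Y: "Y \<in> vector_fields M U" and p: "p \<in> U"
  shows "\<langle>lc U X (restrict_vf U e), Y\<rangle> p = - \<langle>lc U Y (restrict_vf U e), X\<rangle> p"
proof -
  let ?e = "restrict_vf U e"
  note E = unit_restrict_vf
  have b: "lie_bracket M ?e Z = lc U ?e Z - lc U Z ?e" if "Z \<in> vector_fields M U" for Z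
    using torsionlessD[OF lc_torsionless U E that] by simp
  show ?thesis
    using unit_Killing[OF X Y p] lc_metric[OF U E X Y p] pairing_sym[OF U X _ p, of "lie_bracket M ?e Y"]
      pairing_sym[OF U X _ p, of "lc U ?e Y"]
    by (simp add: b X Y E p pairing_diff_left[OF U] lc_vf[OF U] vf_diff)
qed

text \<open>The exterior derivative of a one-form is the alternation of its covariant derivative; the skewness of
  the derivative of the unit turns the alternation into a factor two.\<close>

lemma ext_deriv_counit:
  assumes X: "X \<in> vector_fields M U" and Y: "Y \<in> vector_fields M U" and p: "p \<in> U"
  shows "ext_deriv M (counit g e) X Y p = 2 * \<langle>lc U X (restrict_vf U e), Y\<rangle> p"
proof -
  let ?e = "restrict_vf U e"
  note E = unit_restrict_vf
  have ee: "metric_vf g e Z q = \<langle>?e, Z\<rangle> q" if "q \<in> U" for Z q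
    using that by (simp add: metric_vf_def restrict_vf_def)
  have "X p (metric_vf g e Y) = X p \<langle>?e, Y\<rangle>" "Y p (metric_vf g e X) = Y p \<langle>?e, X\<rangle>"
    by (rule act_cong[OF U X p], rule ee, assumption) (rule act_cong[OF U Y p], rule ee, assumption)
  moreover have "\<langle>?e, lie_bracket M X Y\<rangle> p = \<langle>?e, lc U X Y\<rangle> p - \<langle>?e, lc U Y X\<rangle> p"
    using torsionlessD[OF lc_torsionless U X Y, symmetric] X Y E p
    by (simp add: pairing_sym[OF U E] vf_diff lc_vf[OF U] pairing_diff_left[OF U])
  ultimately show ?thesis
    using derivative_unit_skew[OF X Y p] lc_metric[OF U X E Y p] lc_metric[OF U Y E X p]
    by (simp add: ext_deriv_def counit_def ee p)
qed

end

text \<open>The connection of the theorem, with the contraction of \<open>d\<theta>\<close> already expressed by the derivative of the unit.\<close>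

definition nab :: "'m vf_operation" where
  "nab U X Y = (if U \<in> opens M \<and> X \<in> vector_fields M U \<and> Y \<in> vector_fields M U
     then lc U X Y - lc U (c U X Y) (restrict_vf U e) else 0)"

lemma nab_eq:
  "U \<in> opens M \<Longrightarrow> X \<in> vector_fields M U \<Longrightarrow> Y \<in> vector_fields M U \<Longrightarrow>
    nab U X Y = lc U X Y - lc U (c U X Y) (restrict_vf U e)"
  by (simp add: nab_def)

lemma nab_vf:
  "U \<in> opens M \<Longrightarrow> X \<in> vector_fields M U \<Longrightarrow> Y \<in> vector_fields M U \<Longrightarrow> nab U X Y \<in> vector_fields M U"
  by (simp add: nab_eq vf_diff lc_vf product_vf unit_restrict_vf)

lemma nab_restrict:
  assumes U: "U \<in> opens M" and X: "X \<in> vector_fields M U" and Y: "Y \<in> vector_fields M U"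
    and V: "V \<in> opens M" "V \<subseteq> U"
  shows "restrict_vf V (nab U X Y) = nab V (restrict_vf V X) (restrict_vf V Y)"
  using assms by (simp add: nab_eq vf_restrict[OF X] vf_restrict[OF Y] restrict_vf_diff lc_restrict[OF U]
      product_vf unit_restrict_vf product_restrict[OF U] restrict_vf_restrict)

lemma nab_connection: "connection M nab"
  unfolding connection_def local_operation_def
proof (intro conjI ballI impI allI)
  fix U X Y assume U: "U \<in> opens M" and X: "X \<in> vector_fields M U" and Y: "Y \<in> vector_fields M U"
  show "nab U X Y \<in> vector_fields M U" using nab_vf[OF U X Y] .
  show "nab V (restrict_vf V X) (restrict_vf V Y) = restrict_vf V (nab U X Y)" if "V \<in> opens M" "V \<subseteq> U" for V
    using nab_restrict[OF U X Y that] by simp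
  note s = nab_eq U X Y vf_add vf_scale product_vf[OF U] unit_restrict_vf[OF U]
    lc_add_left[OF U] lc_add_right[OF U] product_add_left[OF U] product_add_right[OF U]
    lc_scale[OF U] product_scale[OF U]
  {
    fix W assume W: "W \<in> vector_fields M U"
    show "nab U (X + Y) W = nab U X W + nab U Y W" by (simp add: s W)
    show "nab U X (Y + W) = nab U X Y + nab U X W" by (simp add: s W)
  next
    have d: "scale_vf h (A - B) = scale_vf h A - scale_vf h B" for h and A B :: "'m vector_field"
      by (simp add: scale_vf_def fun_eq_iff right_diff_distrib)
    fix h assume h: "h \<in> smooth_functions M U"
    show "nab U (scale_vf h X) Y = scale_vf h (nab U X Y)" by (simp add: s h d)
    show "nab U X (scale_vf h Y) = scale_vf (\<lambda>p. X p h) Y + scale_vf h (nab U X Y)" by (simp add: s h d)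
  }
next
  fix U X Y assume "\<not> (U \<in> opens M \<and> X \<in> vector_fields M U \<and> Y \<in> vector_fields M U)"
  then show "nab U X Y = 0" unfolding nab_def by (rule if_not_P)
qed

lemma nab_torsionless: "torsionless M nab"
  unfolding torsionless_def
proof (intro ballI)
  fix U X Y assume U: "U \<in> opens M" and X: "X \<in> vector_fields M U" and Y: "Y \<in> vector_fields M U"
  show "nab U X Y - nab U Y X = lie_bracket M X Y"
    using torsionlessD[OF lc_torsionless U X Y] product_commute[OF U X Y] by (simp add: nab_eq U X Y)
qed

lemma nab_counit_compatible: "counit_compatible M c g e nab"
  unfolding counit_compatible_def Let_def
proof (intro ballI)
  fix U X Y Z p
  assume U: "U \<in> opens M" and X: "X \<in> vector_fields M U" and Y: "Y \<in> vector_fields M U" and Z: "Z \<in> vector_fields M U"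
    and p: "p \<in> U"
  let ?A = "\<lambda>X. lc U X (restrict_vf U e)"
  note E = unit_restrict_vf[OF U] and pv = product_vf[OF U] and lv = lc_vf[OF U]
  have "\<langle>Y, nab U X Z\<rangle> p = \<langle>Y, lc U X Z\<rangle> p - \<langle>?A (c U X Z), Y\<rangle> p"
    using U X Y Z p E pairing_sym[OF U Y lv[OF X Z] p]
    by (simp add: pairing_sym[OF U Y] nab_eq vf_diff pv lv pairing_diff_left[OF U])
  moreover have "\<langle>nab U X Y, Z\<rangle> p = \<langle>lc U X Y, Z\<rangle> p - \<langle>?A (c U X Y), Z\<rangle> p"
    using U X Y Z p E by (simp add: nab_eq pv lv pairing_diff_left[OF U])
  ultimately show "cov_deriv_metric g nab U X Y Z p = 1/2 * ext_deriv M (counit g e) (c U X Y) Z p +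
      1/2 * ext_deriv M (counit g e) (c U X Z) Y p"
    using lc_metric[OF U X Y Z p] ext_deriv_counit[OF U pv[OF X Y] Z p] ext_deriv_counit[OF U pv[OF X Z] Y p]
    by (simp add: cov_deriv_metric_def)
qed

lemma counit_compatible_unique:
  assumes "connection M n" "torsionless M n" "counit_compatible M c g e n"
  shows "n = nab"
proof (rule torsionless_connection_unique[OF assms(1,2) nab_connection nab_torsionless])
  fix U X Y Z p assume a: "U \<in> opens M" "X \<in> vector_fields M U" "Y \<in> vector_fields M U" "Z \<in> vector_fields M U" "p \<in> U"
  have "cov_deriv_metric g m U X Y Z p = 1/2 * ext_deriv M (counit g e) (c U X Y) Z p +
      1/2 * ext_deriv M (counit g e) (c U X Z) Y p" if "counit_compatible M c g e m" for m
    using that a unfolding counit_compatible_def Let_def by blast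
  then show "cov_deriv_metric g n U X Y Z p = cov_deriv_metric g nab U X Y Z p"
    using assms(3) nab_counit_compatible by metis
qed

text \<open>The defining property of \<open>sharp\<close> tests against vector fields on all smaller sets, where the first argument has to
  be restricted before \<open>ext_deriv_counit\<close> applies.\<close>

lemma sharp_contraction:
  assumes U: "U \<in> opens M" and X: "X \<in> vector_fields M U"
  shows "sharp M g U (contraction X (ext_deriv M (counit g e))) = scale_vf (\<lambda>_. 2) (lc U X (restrict_vf U e))"
    (is "_ = ?W")
  unfolding sharp_def contraction_def
proof (rule the_equality)
  let ?e = "restrict_vf U e"
  note L = lc_vf[OF U X unit_restrict_vf[OF U]]
  have W: "?W \<in> vector_fields M U" by (intro vf_scale smooth_functions_const L)
  have eq: "metric_vf g ?W Z p = ext_deriv M (counit g e) X Z p"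
    if V: "V \<in> opens M" "V \<subseteq> U" and Z: "Z \<in> vector_fields M V" and p: "p \<in> V" for V Z p
  proof -
    let ?X = "restrict_vf V X"
    note XV = vf_restrict[OF X V(2)]
    have pU: "p \<in> U" using p V(2) by blast
    have "X p (metric_vf g e Z) = ?X p (metric_vf g e Z)" using p by (simp add: restrict_vf_def)
    moreover have "Z p (metric_vf g e X) = Z p (metric_vf g e ?X)"
      by (rule act_cong[OF V(1) Z p]) (simp add: metric_vf_def restrict_vf_def)
    moreover have "lie_bracket M X Z p = lie_bracket M ?X Z p"
      by (rule lie_bracket_cong[OF opensD(1)[OF V(1)] p])
        (use X Z p pU vf_tangent in \<open>auto simp: restrict_vf_def\<close>)
    ultimately have "ext_deriv M (counit g e) X Z p = ext_deriv M (counit g e) ?X Z p"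
      by (simp add: ext_deriv_def counit_def metric_vf_def)
    also have "\<dots> = 2 * \<langle>lc V ?X (restrict_vf V e), Z\<rangle> p" by (rule ext_deriv_counit[OF V(1) XV Z p])
    also have "lc V ?X (restrict_vf V e) = restrict_vf V (lc U X ?e)"
      using lc_restrict[OF U X unit_restrict_vf[OF U] V] by (simp add: restrict_vf_restrict V(2))
    also have "2 * \<langle>restrict_vf V (lc U X ?e), Z\<rangle> p = \<langle>scale_vf (\<lambda>_. 2) (restrict_vf V (lc U X ?e)), Z\<rangle> p"
      using pairing_scale_left[OF V(1) vf_restrict[OF L V(2)] Z p] by simp
    also have "\<dots> = metric_vf g ?W Z p"
      using p by (simp add: metric_vf_def restrict_vf_def scale_vf_def)
    finally show ?thesis ..
  qed
  then show "?W \<in> vector_fields M U \<and> (\<forall>V\<in>opens M. V \<subseteq> U \<longrightarrow>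
      (\<forall>Z\<in>vector_fields M V. \<forall>p\<in>V. metric_vf g ?W Z p = ext_deriv M (counit g e) X Z p))"
    using W by blast
  fix W' assume W': "W' \<in> vector_fields M U \<and> (\<forall>V\<in>opens M. V \<subseteq> U \<longrightarrow>
      (\<forall>Z\<in>vector_fields M V. \<forall>p\<in>V. metric_vf g W' Z p = ext_deriv M (counit g e) X Z p))"
  show "W' = ?W"
    by (rule metric_vf_nondegenerate[OF U _ W]) (use W' eq in auto)
qed

lemma nab_sharp:
  assumes "U \<in> opens M" "X \<in> vector_fields M U" "Y \<in> vector_fields M U"
  shows "nab U X Y = levi_civita M g U X Y
    - scale_vf (\<lambda>_. 1/2) (sharp M g U (contraction (c U X Y) (ext_deriv M (counit g e))))"
proof -
  have "scale_vf (\<lambda>_. 1/2) (scale_vf (\<lambda>_. 2) Z) = Z" for Z :: "'m vector_field"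
    by (simp add: scale_vf_def)
  then show ?thesis
    by (simp add: nab_eq levi_civita_eq_lc sharp_contraction product_vf assms)
qed

lemma killing_F_algebra_small:
  assumes V: "small V"
  shows "killing_F_algebra (vector_fields M V) (\<lambda>X Y p. if p \<in> V then \<langle>X, Y\<rangle> p else 0) (\<lambda>X f p. X p f)
    (lie_bracket M) (lc V) (c V) (restrict_vf V e)"
proof -
  note Vo = small_opens[OF V]
  note E = unit_restrict_vf[OF Vo]
  note cl = vf_add vf_diff lc_vf[OF Vo] product_vf[OF Vo] E
  have act: "X p (\<lambda>p. if p \<in> V then \<langle>Y, Z\<rangle> p else 0) = X p \<langle>Y, Z\<rangle>"
    if "X \<in> vector_fields M V" "p \<in> V" for X Y Z p
    by (rule act_cong[OF Vo that]) simp
  show ?thesis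
  proof (unfold_locales, goal_cases)
    case (7 X Y)
    then show ?case using pairing_sym[OF Vo] by auto
  next
    case (8 X Y)
    then show ?case using nondegenerate_small[OF V, of X Y] by (metis (no_types, lifting))
  next
    case (11 X Y)
    then show ?case using torsionlessD[OF lc_torsionless Vo] by metis
  next
    case (12 X Y Z p)
    then show ?case using lc_metric[OF Vo] by (simp add: act vf_outside)
  next
    case (14 X Y)
    then show ?case by (rule product_commute[OF Vo])
  next
    case (17 X Y Z)
    then show ?case using pairing_invariant[OF Vo] by auto
  next
    case (18 X Y Z W)
    then show ?case using lie_deriv_product_product[OF Vo] unfolding lie_deriv_product_def by blast
  next
    case (19 X Y p)
    then show ?case using unit_Killing[OF Vo] by (simp add: act E vf_outside[OF E])
  next
    case (20 X Y)
    then show ?case using Killing_affine[OF V E unit_Killing[OF Vo]] by blast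
  qed (simp_all add: cl pairing_add_left[OF Vo] lc_add_left[OF Vo] lc_add_right[OF Vo] product_add_left[OF Vo]
      product_assoc[OF Vo] product_unit[OF Vo])
qed

lemma
  assumes V: "small V" and XYZ: "X \<in> vector_fields M V" "Y \<in> vector_fields M V" "Z \<in> vector_fields M V"
  shows nab_compatible_small: "cov_deriv_product c nab V X Y Z = cov_deriv_product c nab V Y X Z"
    and nab_flat_small: "riemann M nab V X Y Z = 0"
proof -
  note Vo = small_opens[OF V]
  interpret A: killing_F_algebra "vector_fields M V" "\<lambda>X Y p. if p \<in> V then \<langle>X, Y\<rangle> p else 0" "\<lambda>X f p. X p f"
    "lie_bracket M" "lc V" "c V" "restrict_vf V e"
    by (rule killing_F_algebra_small[OF V])
  have nab: "nab V X Y = A.nab X Y" if "X \<in> vector_fields M V" "Y \<in> vector_fields M V" for X Y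
    using that by (simp add: nab_eq[OF Vo] A.nab_def A.A_def)
  note s = nab XYZ
  show "cov_deriv_product c nab V X Y Z = cov_deriv_product c nab V Y X Z"
    unfolding cov_deriv_product_def using A.nab_compatible[OF XYZ] by (simp add: s)
  have "A.R (lc V) Y Z (c V X W) + A.R (lc V) X Y (c V Z W) + A.R (lc V) Z X (c V Y W) = 0"
    if "X \<in> vector_fields M V" "Y \<in> vector_fields M V" "Z \<in> vector_fields M V" "W \<in> vector_fields M V" for X Y Z W
    using curvature_condition[OF Vo that] by (simp add: riemann_def A.R_def)
  from A.nab_flat[OF this XYZ] show "riemann M nab V X Y Z = 0"
    by (simp add: riemann_def A.R_def s)
qed

lemma flat_F_manifold_nab: "flat_F_manifold M c nab e"
  unfolding flat_F_manifold_def flat_def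
proof (intro conjI ballI unital nab_connection nab_torsionless)
  fix U X assume U: "U \<in> opens M" and X: "X \<in> vector_fields M U"
  note E = unit_restrict_vf[OF U]
  show "nab U X (restrict_vf U e) = 0"
    using product_commute[OF U X E] by (simp add: nab_eq U X E product_unit)
  fix Y Z assume Y: "Y \<in> vector_fields M U" and Z: "Z \<in> vector_fields M U"
  note cl = nab_vf[OF U] product_vf[OF U] vf_lie_bracket[OF U] vf_diff X Y Z
  have D: "cov_deriv_product c nab U X Y Z \<in> vector_fields M U"
    if "X \<in> vector_fields M U" "Y \<in> vector_fields M U" "Z \<in> vector_fields M U" for X Y Z
    using that by (simp add: cov_deriv_product_def cl)
  show "riemann M nab U X Y Z = 0"
  proof (rule vf_eq_small[OF U _ vf_0])
    show "riemann M nab U X Y Z \<in> vector_fields M U" by (simp add: riemann_def cl)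
    fix V assume V: "small V" "V \<subseteq> U"
    have "restrict_vf V (riemann M nab U X Y Z) =
        riemann M nab V (restrict_vf V X) (restrict_vf V Y) (restrict_vf V Z)"
      using V by (simp add: riemann_def cl restrict_vf_diff nab_restrict[OF U] restrict_lie_bracket[OF X Y] small_opens)
    then show "restrict_vf V (riemann M nab U X Y Z) = restrict_vf V 0"
      using nab_flat_small[OF V(1)] vf_restrict[OF _ V(2)] X Y Z by (simp add: restrict_vf_def fun_eq_iff)
  qed
  show "cov_deriv_product c nab U X Y Z = cov_deriv_product c nab U Y X Z"
  proof (rule vf_eq_small[OF U D[OF X Y Z] D[OF Y X Z]])
    fix V assume V: "small V" "V \<subseteq> U"
    have "restrict_vf V (cov_deriv_product c nab U X Y Z) =
        cov_deriv_product c nab V (restrict_vf V X) (restrict_vf V Y) (restrict_vf V Z)"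
      if "X \<in> vector_fields M U" "Y \<in> vector_fields M U" "Z \<in> vector_fields M U" for X Y Z
      using V that by (simp add: cov_deriv_product_def cl restrict_vf_diff nab_restrict[OF U] product_restrict[OF U] small_opens)
    then show "restrict_vf V (cov_deriv_product c nab U X Y Z) = restrict_vf V (cov_deriv_product c nab U Y X Z)"
      using nab_compatible_small[OF V(1)] vf_restrict[OF _ V(2)] X Y Z by simp
  qed
  show "cov_deriv_product c nab U X Y Z = cov_deriv_product c nab U X Z Y"
    using product_commute[OF U] cl by (simp add: cov_deriv_product_def)
qed

end

theorem theorem1p8:
  fixes M :: "('m::{t2_space, second_countable_topology}, 'e::euclidean_space) chart set"
    and c :: "'m vf_operation" and g :: "'m metric" and e :: "'m vector_field"
  assumes "smooth_manifold M"
    and "riemannian_F_manifold_Killing M c g e"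
  shows "(\<exists>!nabla. connection M nabla \<and> torsionless M nabla \<and> counit_compatible M c g e nabla) \<and>
    (\<forall>nabla. connection M nabla \<and> torsionless M nabla \<and> counit_compatible M c g e nabla \<longrightarrow>
       (\<forall>U\<in>opens M. \<forall>X\<in>vector_fields M U. \<forall>Y\<in>vector_fields M U.
          nabla U X Y = levi_civita M g U X Y
            - scale_vf (\<lambda>_. 1/2)
                (sharp M g U (contraction (c U X Y) (ext_deriv M (counit g e))))) \<and>
       flat_F_manifold M c nabla e)"
proof -
  interpret Killing_F_manifold M g c e
    by unfold_locales (use assms in \<open>simp_all add: riemannian_F_manifold_Killing_def\<close>)
  have "\<exists>!nabla. connection M nabla \<and> torsionless M nabla \<and> counit_compatible M c g e nabla"
    using nab_connection nab_torsionless nab_counit_compatible counit_compatible_unique by blast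
  moreover have "(\<forall>U\<in>opens M. \<forall>X\<in>vector_fields M U. \<forall>Y\<in>vector_fields M U.
          n U X Y = levi_civita M g U X Y
            - scale_vf (\<lambda>_. 1/2)
                (sharp M g U (contraction (c U X Y) (ext_deriv M (counit g e))))) \<and>
       flat_F_manifold M c n e"
    if "connection M n \<and> torsionless M n \<and> counit_compatible M c g e n" for n
  proof -
    have "n = nab" using that counit_compatible_unique by blast
    then show ?thesis using nab_sharp flat_F_manifold_nab by simp
  qed
  ultimately show ?thesis by blast
qed

end
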